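(* Assume $y\in(0,1)^J$, and assume the prior-predictive small-ball law: there exist $c_y>0$ and $\alpha>0$ such that $\mu_0\{q:Q_y(q)\le t\}=c_yt^\alpha\{1+o(1)\}$ as $t\downarrow0$. Let $\sigma\downarrow0$ and let $n=n(\sigma)$ satisfy $\vartheta_\sigma=n/a_\sigma\to\vartheta\in(0,\infty)$. Put $\beta=D_y/\vartheta$. Then, as $\sigma\downarrow0$, \[ \mathbb E W_{\rm act}\sim \begin{cases} \gamma e^\beta\vartheta c_y\kappa_y^{\mathrm{tot}}(y)\Psi_\alpha(\beta)\,a_\sigma^{2-\alpha},&0<\alpha<1,\\[1ex] \gamma e^\beta\vartheta c_y\kappa_y^{\mathrm{tot}}(y)\,a_\sigma\log a_\sigma,&\alpha=1,\\[1ex] \gamma e^\beta\vartheta\,\mathcal I_y\,a_\sigma,&\alpha>1, \end{cases} \] where, for $\alpha>1$, $\mathcal I_y:=\int_{\mathbb X}\frac{\kappa_y^{\mathrm{tot}}(p(q))}{Q_y(q)}\,\mu_0(\mathrm dq)<\infty$. Consequently, \[ \mathbb E W_{\rm act}= \begin{cases} \Theta(\gamma\sigma^{-4+2\alpha}),&0<\alpha<1,\\ \Theta(\gamma\sigma^{-2}\log(1/\sigma)),&\alpha=1,\\ \Theta(\gamma\sigma^{-2}),&\alpha>1. \end{cases} \]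
   Context: Setting. $(\mathbb X,\mathcal X)$ is a measurable space with prior probability measure $\mu_0$; $p=(p_1,\dots,p_J):\mathbb X\to[0,1]^J$ is measurable (forward observables); $y=(y_1,\dots,y_J)\in[0,1]^J$ is the fixed data; the errors are independent Gaussian with common variance $\sigma^2$; $a_\sigma=(2\sigma^2)^{-1}$; $\gamma>0$ is fixed; $n\ge2$ is an integer. A $p$-coin is a Bernoulli($p$) variable; all coins are independent. Bernstein quantities. For $y\in[0,1]$ and $0\le k\le n$: $\beta_{k,n}(y)=y^2-\frac{2yk}{n}+\frac{k(k-1)}{n(n-1)}$, $b_n(y)=-\min_{0\le k\le n}\beta_{k,n}(y)$, $c_{k,n}(y)=\beta_{k,n}(y)+b_n(y)$, $C_n(y)=\max\{1,\max_k c_{k,n}(y)\}$ (which equals $1$ for $y\in[0,1]$), $\widetilde c_{k,n}(y)=c_{k,n}(y)/C_n(y)$. Put $Q_y(q)=\sum_{j=1}^J[p_j(q)-y_j]^2$, $b_n^{\mathrm{tot}}(y)=\sum_{j=1}^J b_n(y_j)$, $D_y=\sum_{j=1}^Jy_j(1-y_j)$. Range-stopped Bernstein event with success probability $p$ and datum $y$: draw $V\sim\operatorname{Unif}(0,1)$ and reveal independent $p$-coins one at a time. After $s\in\{0,\dots,n\}$ coins with $k$ successes, put $\ell=n-s$; stop with output $1$ if $V<\min_{i=k,\ldots,k+\ell}\widetilde c_{i,n}(y)$, and stop with output $0$ if $V\ge\max_{i=k,\ldots,k+\ell}\widetilde c_{i,n}(y)$; otherwise reveal another coin. Sampler. Draw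 $M_\gamma\sim\operatorname{Poisson}(\gamma e^{a_\sigma b_n^{\mathrm{tot}}(y)})$ and candidates $Q_i\stackrel{\rm iid}{\sim}\mu_0$, $i=1,\dots,M_\gamma$. For each candidate independently draw $R\sim\operatorname{Poisson}\bigl(a_\sigma\sum_{j}C_n(y_j)\bigr)$ and process up to $R$ auxiliary events in sequence: for each, independently draw a component label $j$ with probability $C_n(y_j)/\sum_{l}C_n(y_l)$ (i.e. $1/J$), and generate an independent range-stopped Bernstein event with success probability $p_j(Q_i)$ and datum $y_j$. If an event equals $1$, discard the candidate and terminate its remaining tests. If no event equals $1$, retain the candidate. $W_{\rm act}$ is the total number of coins revealed over all candidates and events. Constants. For scalar $y,p\in[0,1]$, with $I_t(p)=[tp,tp+1-t]$, \[ \kappa_y(p)=\int_0^1\Bigl(\sup_{z\in I_t(p)}(z-y)^2-\inf_{z\in I_t(p)}(z-y)^2\Bigr)\mathrm dt, \] and for vectors $\kappa_y^{\mathrm{tot}}(p)=\sum_{j=1}^J\kappa_{y_j}(p_j)$. For $0<\alpha<1$, \[ \Psi_\alpha(\beta)=\alpha\int_0^\infty t^{\alpha-1}\frac{1-e^{-(\beta+t)}}{\beta+t}\,\mathrm dt=\Gamma(\alpha+1)\int_0^1e^{-\beta s}s^{-\alpha}\,\mathrm ds. \] $f\sim g$ means $f/g\to1$. *)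

theory Defs
  imports "HOL-Probability.Probability" "HOL-Library.Landau_Symbols"
begin

definition a_sigma :: "real \<Rightarrow> real" where
  "a_sigma \<sigma> = 1 / (2 * \<sigma>\<^sup>2)"

definition bern_beta :: "nat \<Rightarrow> nat \<Rightarrow> real \<Rightarrow> real" where
  "bern_beta k n y = y\<^sup>2 - 2 * y * real k / real n
     + real k * (real k - 1) / (real n * (real n - 1))"

definition bern_b :: "nat \<Rightarrow> real \<Rightarrow> real" where
  "bern_b n y = - (MIN k\<in>{0..n}. bern_beta k n y)"

definition bern_c :: "nat \<Rightarrow> nat \<Rightarrow> real \<Rightarrow> real" where
  "bern_c k n y = bern_beta k n y + bern_b n y"

definition bern_C :: "nat \<Rightarrow> real \<Rightarrow> real" where
  "bern_C n y = max 1 (MAX k\<in>{0..n}. bern_c k n y)"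

definition bern_ctilde :: "nat \<Rightarrow> nat \<Rightarrow> real \<Rightarrow> real" where
  "bern_ctilde k n y = bern_c k n y / bern_C n y"

definition bern_b_tot :: "nat \<Rightarrow> real ^ 'j::finite \<Rightarrow> real" where
  "bern_b_tot n y = (\<Sum>j\<in>UNIV. bern_b n (y $ j))"

(* Q_y(q) is misfit y (p q), and kappa_y^tot(p(q)) is kappa_tot y (p q). *)
definition misfit :: "real ^ 'j::finite \<Rightarrow> real ^ 'j \<Rightarrow> real" where
  "misfit y x = (\<Sum>j\<in>UNIV. (x $ j - y $ j)\<^sup>2)"

definition D_const :: "real ^ 'j::finite \<Rightarrow> real" where
  "D_const y = (\<Sum>j\<in>UNIV. y $ j * (1 - y $ j))"

(* The range-stopped event given V = v, in the state with k successes and l coins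
   left, i.e. after n - l coins. The result is the output of the event together with
   the number of coins revealed from this state on. For l = 0 the window {k..k+l} is a
   singleton, so one of the two stopping rules of the Suc case necessarily applies. *)
primrec range_stopped ::
  "nat \<Rightarrow> real \<Rightarrow> real \<Rightarrow> real \<Rightarrow> nat \<Rightarrow> nat \<Rightarrow> (bool \<times> nat) pmf" where
  "range_stopped n y pr v 0 k = return_pmf (v < bern_ctilde k n y, 0)"
| "range_stopped n y pr v (Suc l) k =
     (if v < (MIN i\<in>{k..k + Suc l}. bern_ctilde i n y) then return_pmf (True, 0)
      else if v \<ge> (MAX i\<in>{k..k + Suc l}. bern_ctilde i n y) then return_pmf (False, 0)
      else do {
        coin \<leftarrow> bernoulli_pmf pr;
        (out, cnt) \<leftarrow> range_stopped n y pr v l (if coin then Suc k else k);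
        return_pmf (out, Suc cnt)
      })"

(* Laws on countable spaces carry the discrete sigma-algebra; the do-blocks
   below are in the Giry monad. *)
definition bernstein_event :: "nat \<Rightarrow> real \<Rightarrow> real \<Rightarrow> (bool \<times> nat) measure" where
  "bernstein_event n y pr = do {
     v \<leftarrow> uniform_measure lborel {0<..<1};
     measure_pmf (range_stopped n y pr v n 0)
   }"

definition label_pmf :: "nat \<Rightarrow> real ^ 'j::finite \<Rightarrow> 'j pmf" where
  "label_pmf n y = embed_pmf (\<lambda>j. bern_C n (y $ j) / (\<Sum>l\<in>UNIV. bern_C n (y $ l)))"

lemma pmf_label_pmf:
  "pmf (label_pmf n y) j = bern_C n (y $ j) / (\<Sum>l\<in>UNIV. bern_C n (y $ l))"
proof -
  have pos: "bern_C n (y $ l) > 0" for l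
    by (simp add: bern_C_def less_max_iff_disj)
  have S: "(\<Sum>l\<in>UNIV. bern_C n (y $ l)) > 0"
    by (rule sum_pos) (use pos in auto)
  show ?thesis unfolding label_pmf_def
  proof (rule pmf_embed_pmf)
    show "0 \<le> bern_C n (y $ j) / (\<Sum>l\<in>UNIV. bern_C n (y $ l))" for j
      using pos[of j] S by simp
    have "(\<Sum>j\<in>UNIV. bern_C n (y $ j) / (\<Sum>l\<in>UNIV. bern_C n (y $ l))) = 1"
      using S by (simp flip: sum_divide_distrib)
    then show "(\<integral>\<^sup>+ j. ennreal (bern_C n (y $ j) / (\<Sum>l\<in>UNIV. bern_C n (y $ l)))
        \<partial>count_space UNIV) = 1"
      using pos S
      by (subst nn_integral_count_space_finite) (auto simp: sum_ennreal less_imp_le)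
  qed
qed

(* x stands for the forward observables p(q) of the candidate q *)
definition auxiliary_event ::
  "nat \<Rightarrow> real ^ 'j::finite \<Rightarrow> real ^ 'j \<Rightarrow> (bool \<times> nat) measure" where
  "auxiliary_event n y x = do {
     j \<leftarrow> measure_pmf (label_pmf n y);
     bernstein_event n (y $ j) (x $ j)
   }"

(* Up to r auxiliary events: (was the candidate retained, number of coins revealed) *)
primrec candidate_tests ::
  "nat \<Rightarrow> real ^ 'j::finite \<Rightarrow> real ^ 'j \<Rightarrow> nat \<Rightarrow> (bool \<times> nat) measure" where
  "candidate_tests n y x 0 = return (count_space UNIV) (True, 0)"
| "candidate_tests n y x (Suc r) = do {
     (out, cnt) \<leftarrow> auxiliary_event n y x;
     if out then return (count_space UNIV) (False, cnt)
     else do {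
       (retained, cnt') \<leftarrow> candidate_tests n y x r;
       return (count_space UNIV) (retained, cnt + cnt')
     }
   }"

definition candidate ::
  "real \<Rightarrow> nat \<Rightarrow> real ^ 'j::finite \<Rightarrow> real ^ 'j \<Rightarrow> (bool \<times> nat) measure" where
  "candidate a n y x = do {
     r \<leftarrow> measure_pmf (poisson_pmf (a * (\<Sum>j\<in>UNIV. bern_C n (y $ j))));
     candidate_tests n y x r
   }"

(* Total number of coins revealed over m candidates drawn independently from \<mu> *)
primrec coins_of_candidates ::
  "'x measure \<Rightarrow> ('x \<Rightarrow> real ^ 'j::finite) \<Rightarrow> real \<Rightarrow> nat \<Rightarrow> real ^ 'j \<Rightarrow> nat \<Rightarrow> nat measure" where
  "coins_of_candidates \<mu> p a n y 0 = return (count_space UNIV) 0"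
| "coins_of_candidates \<mu> p a n y (Suc m) = do {
     q \<leftarrow> \<mu>;
     (retained, cnt) \<leftarrow> candidate a n y (p q);
     w \<leftarrow> coins_of_candidates \<mu> p a n y m;
     return (count_space UNIV) (cnt + w)
   }"

definition W_act_law ::
  "'x measure \<Rightarrow> ('x \<Rightarrow> real ^ 'j::finite) \<Rightarrow> real \<Rightarrow> real \<Rightarrow> nat \<Rightarrow> real ^ 'j \<Rightarrow> nat measure" where
  "W_act_law \<mu> p \<gamma> a n y = do {
     m \<leftarrow> measure_pmf (poisson_pmf (\<gamma> * exp (a * bern_b_tot n y)));
     coins_of_candidates \<mu> p a n y m
   }"

definition E_W_act ::
  "'x measure \<Rightarrow> ('x \<Rightarrow> real ^ 'j::finite) \<Rightarrow> real \<Rightarrow> real \<Rightarrow> nat \<Rightarrow> real ^ 'j \<Rightarrow> real" where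
  "E_W_act \<mu> p \<gamma> a n y = (\<integral> w. real w \<partial>W_act_law \<mu> p \<gamma> a n y)"

definition kappa :: "real \<Rightarrow> real \<Rightarrow> real" where
  "kappa y x = (LBINT t:{0..1}.
     (SUP z\<in>{t * x..t * x + 1 - t}. (z - y)\<^sup>2) - (INF z\<in>{t * x..t * x + 1 - t}. (z - y)\<^sup>2))"

definition kappa_tot :: "real ^ 'j::finite \<Rightarrow> real ^ 'j \<Rightarrow> real" where
  "kappa_tot y x = (\<Sum>j\<in>UNIV. kappa (y $ j) (x $ j))"

definition Psi :: "real \<Rightarrow> real \<Rightarrow> real" where
  "Psi \<alpha> \<beta> = \<alpha> * (LBINT t:{0<..}. t powr (\<alpha> - 1) * ((1 - exp (- (\<beta> + t))) / (\<beta> + t)))"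

(* The quotient is taken in ennreal, so it is infinite wherever the misfit vanishes
   and kappa_tot does not. *)
definition I_const :: "'x measure \<Rightarrow> ('x \<Rightarrow> real ^ 'j::finite) \<Rightarrow> real ^ 'j \<Rightarrow> ennreal" where
  "I_const \<mu> p y = (\<integral>\<^sup>+ q. ennreal (kappa_tot y (p q)) / ennreal (misfit y (p q)) \<partial>\<mu>)"

end

theory Submission
  imports Defs "HOL-Real_Asymp.Real_Asymp"
begin

text \<open>The mean of a sum of independent costs is the mean number of candidates times the mean cost of
one candidate, so everything rests on one candidate with observables \<open>x\<close>, misfit \<open>Q\<close> and total
Bernstein shift \<open>b\<close>. The Bernstein polynomial with coefficients \<open>bern_beta\<close> is exactly \<open>(x - y)\<^sup>2\<close>, so
a test outputs 1 with a probability proportional to \<open>Q + b\<close>; stopping a Poisson number of tests at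
the first 1 gives (\<open>E_W_act_eq\<close>)

\<open>E W = \<gamma> exp (a b) \<integral> K\<^sub>n(p(q)) (1 - exp (- a (Q + b))) / (Q + b) d\<mu>\<close>,

where \<open>K\<^sub>n\<close> (\<open>mean_coins_tot\<close>) is the sum over the components of \<^const>\<open>bern_C\<close> times the mean number of coins
that an event for this component reveals.
Three facts turn this identity into the asymptotics.

First, \<open>K\<^sub>n(x) / n\<close> tends to \<open>kappa_tot y x\<close> uniformly in \<open>x\<close>, with error of order \<open>1 / sqrt n\<close>
(\<open>mean_coins_tot_close\<close>). As \<open>V\<close> is uniform, an event is still undecided after \<open>s\<close> coins with
conditional probability equal to the oscillation of the normalised coefficients over the window of reachable success counts;
by the law of large numbers this window is close to \<open>[t x, t x + 1 - t]\<close> with \<open>t = s / n\<close>, and the sum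
over \<open>s\<close> is a Riemann sum.

Second, \<open>n b\<^sub>n(y)\<close> tends to \<open>y (1 - y)\<close> (\<open>bern_b_tendsto\<close>), because the coefficient at \<open>z = k / n\<close> is
\<open>(z - y)\<^sup>2 - z (1 - z) / (n - 1)\<close>. Hence \<open>a b\<close> tends to \<open>\<beta>\<close>.

Third, writing the quotient as the integral of \<open>exp (- l (Q + b))\<close> over \<open>l\<close> from 0 to \<open>a\<close> shows that its mean is
the integral of \<open>exp (- l b) L(l)\<close> over the same range, \<open>L\<close> being the Laplace transform of the misfit. The small-ball law
gives \<open>l powr \<alpha> * L(l) \<rightarrow> c \<Gamma>(\<alpha> + 1)\<close> (\<open>laplace_limit\<close>). For \<open>\<alpha> < 1\<close> the substitution \<open>l = a s\<close> yields
the power \<open>a powr (1 - \<alpha>)\<close> with constant \<open>c Psi\<close>; for \<open>\<alpha> = 1\<close> the substitution \<open>l = a powr s\<close> yields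
\<open>c ln a\<close>; in both cases the mean diverges, so it is carried by candidates with misfit near 0, where
\<open>K\<^sub>n / n\<close> can be replaced by \<open>kappa_tot y y\<close> (\<open>concentration\<close>). For \<open>\<alpha> > 1\<close> the function \<open>1 / Q\<close> is integrable
and dominates the quotient, so one can pass to the limit under the integral (\<open>inverse_misfit_limit\<close>).\<close>

section \<open>Measurability of the sampler in the observables\<close>

lemma measurable_pair_count_space2:
  fixes f :: "'a \<times> 'b::countable \<Rightarrow> 'c"
  assumes "\<And>z. (\<lambda>x. f (x, z)) \<in> M \<rightarrow>\<^sub>M K"
  shows "f \<in> M \<Otimes>\<^sub>M count_space UNIV \<rightarrow>\<^sub>M K"
proof -
  have "(\<lambda>w. f (fst w, snd w)) \<in> M \<Otimes>\<^sub>M count_space UNIV \<rightarrow>\<^sub>M K"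
    by (rule measurable_compose_countable'[where I = UNIV and f = "\<lambda>z w. f (fst w, z)"])
       (auto intro: measurable_compose[OF measurable_fst assms])
  then show ?thesis by simp
qed

text \<open>On a countable space a kernel is determined by its point masses, so it suffices to check these. The
sampler lives on countable spaces except for the draws of \<open>V\<close> and of the candidate, and those two
need joint measurability of everything downstream.\<close>

lemma measurable_prob_algebra_count_space:
  fixes K :: "'a \<Rightarrow> 'b::countable measure"
  assumes "\<And>x. x \<in> space M \<Longrightarrow> prob_space (K x)"
    and sets: "\<And>x. x \<in> space M \<Longrightarrow> sets (K x) = UNIV"
    and meas: "\<And>z. (\<lambda>x. emeasure (K x) {z}) \<in> borel_measurable M"
  shows "K \<in> M \<rightarrow>\<^sub>M prob_algebra (count_space UNIV)"
proof (rule measurable_prob_algebraI)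
  show "K \<in> M \<rightarrow>\<^sub>M subprob_algebra (count_space UNIV)"
  proof (rule measurable_subprob_algebra)
    fix x assume "x \<in> space M"
    then show "subprob_space (K x)" "sets (K x) = sets (count_space UNIV)"
      using assms by (auto intro: prob_space_imp_subprob_space)
  next
    fix A :: "'b set"
    interpret sigma_finite_measure "count_space A"
      by (rule sigma_finite_measure_count_space_countable) auto
    have "(\<lambda>w. emeasure (K (fst w)) {snd w}) \<in> borel_measurable (M \<Otimes>\<^sub>M count_space A)"
      by (rule measurable_compose_countable'[where I = A and f = "\<lambda>z w. emeasure (K (fst w)) {z}"])
         (auto intro: measurable_compose[OF measurable_fst meas])
    then have "(\<lambda>x. \<integral>\<^sup>+ z. emeasure (K x) {z} \<partial>count_space A) \<in> borel_measurable M"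
      by (intro borel_measurable_nn_integral) (simp add: case_prod_beta')
    then show "(\<lambda>x. emeasure (K x) A) \<in> borel_measurable M"
      by (rule measurable_cong[THEN iffD1, rotated])
         (auto intro!: emeasure_countable_singleton[symmetric] simp: sets)
  qed
qed fact

lemma measure_pmf_in_prob_algebra:
  "measure_pmf q \<in> space (prob_algebra (count_space UNIV))"
  by (simp add: space_prob_algebra measure_pmf.prob_space_axioms)

lemma measurable_measure_pmf_bernoulli:
  "(\<lambda>x. measure_pmf (bernoulli_pmf x)) \<in> borel \<rightarrow>\<^sub>M prob_algebra (count_space UNIV)"
proof (rule measurable_prob_algebra_count_space)
  fix z
  have "pmf (bernoulli_pmf x) z = (if z then min 1 (max 0 x) else 1 - min 1 (max 0 x))" for x
    by (simp add: bernoulli_pmf.rep_eq)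
  then show "(\<lambda>x. emeasure (bernoulli_pmf x) {z}) \<in> borel_measurable borel"
    by (simp add: emeasure_pmf_single)
qed (auto simp: measure_pmf.prob_space_axioms)

text \<open>The law depends on \<open>v\<close> only through finitely many comparisons, and on \<open>x\<close> only through the coin, hence the
induction on the number of remaining coins.\<close>

lemma measurable_range_stopped:
  "(\<lambda>(x, v). measure_pmf (range_stopped n y x v l k))
     \<in> borel \<Otimes>\<^sub>M borel \<rightarrow>\<^sub>M prob_algebra (count_space UNIV)"
proof (induction l arbitrary: k)
  case 0
  have "(\<lambda>w. if snd w < bern_ctilde k n y then measure_pmf (return_pmf (True, 0::nat))
        else measure_pmf (return_pmf (False, 0))) \<in> borel \<Otimes>\<^sub>M borel \<rightarrow>\<^sub>M prob_algebra (count_space UNIV)"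
    for k by (rule measurable_If) (auto simp: measure_pmf_in_prob_algebra)
  also have "(\<lambda>w. if snd w < bern_ctilde k n y then measure_pmf (return_pmf (True, 0::nat))
        else measure_pmf (return_pmf (False, 0)))
      = (\<lambda>(x, v). measure_pmf (range_stopped n y x v 0 k))"
    by (auto simp: fun_eq_iff)
  finally show ?case .
next
  case (Suc l)
  let ?m = "MIN i\<in>{k..k + Suc l}. bern_ctilde i n y"
  let ?M = "MAX i\<in>{k..k + Suc l}. bern_ctilde i n y"
  have cont: "(\<lambda>w. measure_pmf (do {
        coin \<leftarrow> bernoulli_pmf (fst w);
        (out, cnt) \<leftarrow> range_stopped n y (fst w) (snd w) l (if coin then Suc k else k);
        return_pmf (out, Suc cnt)})) \<in> borel \<Otimes>\<^sub>M borel \<rightarrow>\<^sub>M prob_algebra (count_space UNIV)"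
    unfolding measure_pmf_bind
  proof (rule measurable_bind_prob_space2[where N = "count_space UNIV"], goal_cases)
    case 1
    show ?case by (intro measurable_compose[OF measurable_fst measurable_measure_pmf_bernoulli])
  next
    case 2
    show ?case
    proof (rule measurable_pair_count_space2, unfold prod.case,
        rule measurable_bind_prob_space[where N = "count_space UNIV"], goal_cases)
      case (1 coin)
      show ?case using Suc.IH[of "if coin then Suc k else k"] by (simp add: case_prod_beta')
    next
      case (2 coin)
      show ?case by (auto simp: measure_pmf_in_prob_algebra split: prod.splits)
    qed
  qed
  have "(\<lambda>w. if snd w < ?m then measure_pmf (return_pmf (True, 0::nat))
        else if snd w \<ge> ?M then measure_pmf (return_pmf (False, 0))
        else measure_pmf (do {
        coin \<leftarrow> bernoulli_pmf (fst w);
        (out, cnt) \<leftarrow> range_stopped n y (fst w) (snd w) l (if coin then Suc k else k);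
        return_pmf (out, Suc cnt)})) \<in> borel \<Otimes>\<^sub>M borel \<rightarrow>\<^sub>M prob_algebra (count_space UNIV)"
    by (intro measurable_If cont) (auto simp: measure_pmf_in_prob_algebra)
  also have "(\<lambda>w. if snd w < ?m then measure_pmf (return_pmf (True, 0::nat))
        else if snd w \<ge> ?M then measure_pmf (return_pmf (False, 0))
        else measure_pmf (do {
        coin \<leftarrow> bernoulli_pmf (fst w);
        (out, cnt) \<leftarrow> range_stopped n y (fst w) (snd w) l (if coin then Suc k else k);
        return_pmf (out, Suc cnt)}))
      = (\<lambda>(x, v). measure_pmf (range_stopped n y x v (Suc l) k))"
    by (auto simp: fun_eq_iff)
  finally show ?case .
qed

lemma uniform_unit_in_prob_algebra:
  "uniform_measure lborel {0<..<1::real} \<in> space (prob_algebra borel)"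
  by (auto simp: space_prob_algebra intro!: prob_space_uniform_measure)

lemma measurable_bernstein_event:
  "bernstein_event n y \<in> borel \<rightarrow>\<^sub>M prob_algebra (count_space UNIV)"
  unfolding bernstein_event_def
  by (rule measurable_bind_prob_space2[where N = borel])
     (use measurable_range_stopped in \<open>auto intro: measurable_const uniform_unit_in_prob_algebra\<close>)

lemma measurable_auxiliary_event:
  fixes y :: "real ^ 'j::finite"
  shows "auxiliary_event n y \<in> borel \<rightarrow>\<^sub>M prob_algebra (count_space UNIV)"
  unfolding auxiliary_event_def
proof (rule measurable_bind_prob_space2[where N = "count_space UNIV"])
  show "(\<lambda>x. measure_pmf (label_pmf n y)) \<in> borel \<rightarrow>\<^sub>M prob_algebra (count_space UNIV)"
    by (intro measurable_const measure_pmf_in_prob_algebra)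
  have "(\<lambda>w. bernstein_event n (y $ snd w) (fst w $ snd w))
      \<in> borel \<Otimes>\<^sub>M count_space UNIV \<rightarrow>\<^sub>M prob_algebra (count_space UNIV)"
    by (rule measurable_compose_countable'[where I = UNIV and
          f = "\<lambda>j w. bernstein_event n (y $ j) (fst w $ j)"])
       (auto intro!: measurable_compose[OF _ measurable_bernstein_event]
          measurable_compose[OF measurable_fst] borel_measurable_continuous_onI continuous_intros
          simp: countable_finite)
  then show "(\<lambda>(x, j). bernstein_event n (y $ j) (x $ j))
      \<in> borel \<Otimes>\<^sub>M count_space UNIV \<rightarrow>\<^sub>M prob_algebra (count_space UNIV)"
    by (simp add: case_prod_beta')
qed

lemma measurable_candidate_tests:
  fixes y :: "real ^ 'j::finite"
  shows "(\<lambda>x. candidate_tests n y x r) \<in> borel \<rightarrow>\<^sub>M prob_algebra (count_space UNIV)"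
proof (induction r)
  case 0
  show ?case by (auto simp: space_prob_algebra intro!: prob_space_return)
next
  case (Suc r)
  show ?case
    unfolding candidate_tests.simps
  proof (rule measurable_bind_prob_space2[where N = "count_space UNIV"])
    show "auxiliary_event n y \<in> borel \<rightarrow>\<^sub>M prob_algebra (count_space UNIV)"
      by (rule measurable_auxiliary_event)
    show "(\<lambda>(x, a). case a of (out, cnt) \<Rightarrow>
         if out then return (count_space UNIV) (False, cnt)
         else do { (retained, cnt') \<leftarrow> candidate_tests n y x r;
            return (count_space UNIV) (retained, cnt + cnt') })
       \<in> borel \<Otimes>\<^sub>M count_space UNIV \<rightarrow>\<^sub>M prob_algebra (count_space UNIV)"
    proof (rule measurable_pair_count_space2, goal_cases)
      case (1 a)
      obtain out cnt where a: "a = (out, cnt)" by (cases a)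
      have *: "(\<lambda>x. candidate_tests n y x r \<bind>
               (\<lambda>(retained, cnt'). return (count_space UNIV) (retained, cnt + cnt')))
            \<in> borel \<rightarrow>\<^sub>M prob_algebra (count_space UNIV)"
        by (rule measurable_bind_prob_space[OF Suc.IH])
           (auto simp: space_prob_algebra split: prod.splits intro!: prob_space_return)
      have **: "return (count_space UNIV) (False, cnt) \<in> space (prob_algebra (count_space UNIV))"
        by (auto simp: space_prob_algebra intro!: prob_space_return)
      show ?case using * ** by (cases out) (auto simp: a)
    qed
  qed
qed

lemma measurable_candidate:
  fixes y :: "real ^ 'j::finite"
  shows "candidate a n y \<in> borel \<rightarrow>\<^sub>M prob_algebra (count_space UNIV)"
  unfolding candidate_def
proof (rule measurable_bind_prob_space2[where N = "count_space UNIV"])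
  show "(\<lambda>x. measure_pmf (poisson_pmf (a * (\<Sum>j\<in>UNIV. bern_C n (y $ j)))))
      \<in> borel \<rightarrow>\<^sub>M prob_algebra (count_space UNIV)"
    by (intro measurable_const measure_pmf_in_prob_algebra)
  show "(\<lambda>(x, r). candidate_tests n y x r)
      \<in> borel \<Otimes>\<^sub>M count_space UNIV \<rightarrow>\<^sub>M prob_algebra (count_space UNIV)"
    by (rule measurable_pair_count_space2) (simp add: measurable_candidate_tests)
qed

lemma bind_in_prob_algebra:
  assumes "A \<in> space (prob_algebra M)" and "B \<in> M \<rightarrow>\<^sub>M prob_algebra N"
  shows "A \<bind> B \<in> space (prob_algebra N)"
  using assms prob_space_bind'[OF assms] sets_bind'[OF assms] by (simp add: space_prob_algebra)

lemma return_in_prob_algebra: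
  "return (count_space UNIV) x \<in> space (prob_algebra (count_space UNIV))"
  by (auto simp: space_prob_algebra intro!: prob_space_return)

lemma coins_of_candidates_in_prob_algebra:
  fixes y :: "real ^ 'j::finite"
  assumes "prob_space \<mu>" and p: "p \<in> borel_measurable \<mu>"
  shows "coins_of_candidates \<mu> p a n y m \<in> space (prob_algebra (count_space UNIV))"
proof (induction m)
  case 0
  show ?case by (simp add: return_in_prob_algebra)
next
  case (Suc m)
  have "\<mu> \<in> space (prob_algebra \<mu>)" using assms by (simp add: space_prob_algebra)
  moreover have "(\<lambda>q. candidate a n y (p q)) \<in> \<mu> \<rightarrow>\<^sub>M prob_algebra (count_space UNIV)"
    by (rule measurable_compose[OF p measurable_candidate])
  moreover have "coins_of_candidates \<mu> p a n y m \<bind> (\<lambda>w. return (count_space UNIV) (cnt + w))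
      \<in> space (prob_algebra (count_space UNIV))" for cnt
    by (rule bind_in_prob_algebra[OF Suc.IH]) (simp add: return_in_prob_algebra)
  ultimately show ?case
    unfolding coins_of_candidates.simps
    by (intro bind_in_prob_algebra measurable_bind_prob_space[where N = "count_space UNIV"]) auto
qed

section \<open>Means over coin tosses\<close>

text \<open>The mean of \<open>f\<close> at the success count after \<open>s\<close> further coins, starting from \<open>k\<close> successes. Conditioning on
the first coin, instead of summing against binomial weights, gives the recursion of
\<^const>\<open>range_stopped\<close>, so that all moments needed below are one-line inductions.\<close>

primrec coin_mean :: "real \<Rightarrow> nat \<Rightarrow> (nat \<Rightarrow> real) \<Rightarrow> nat \<Rightarrow> real" where
  "coin_mean x 0 f k = f k"
| "coin_mean x (Suc s) f k = x * coin_mean x s f (Suc k) + (1 - x) * coin_mean x s f k"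

lemma coin_mean_add: "coin_mean x s (\<lambda>i. f i + g i) k = coin_mean x s f k + coin_mean x s g k"
  by (induction s arbitrary: k) (auto simp: algebra_simps)

lemma coin_mean_cmult: "coin_mean x s (\<lambda>i. c * f i) k = c * coin_mean x s f k"
  by (induction s arbitrary: k) (auto simp: algebra_simps)

lemma coin_mean_const: "coin_mean x s (\<lambda>i. c) k = c"
  by (induction s arbitrary: k) (auto simp: algebra_simps)

lemma coin_mean_linear: "coin_mean x s (\<lambda>i. real i) k = real k + real s * x"
  by (induction s arbitrary: k) (auto simp: algebra_simps)

text \<open>Factorial moments are the ones for which the Bernstein coefficients are linear; this is what makes
\<^const>\<open>bern_beta\<close> reproduce the square exactly.\<close>

lemma coin_mean_falling:
  "coin_mean x s (\<lambda>i. real i * (real i - 1)) k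
     = real k * (real k - 1) + 2 * real k * real s * x + real s * (real s - 1) * x\<^sup>2"
proof (induction s arbitrary: k)
  case (Suc s)
  show ?case
    unfolding coin_mean.simps Suc.IH by (simp add: algebra_simps power2_eq_square)
qed simp

lemma coin_mean_mono:
  assumes "x \<in> {0..1}" and "\<And>i. i \<in> {k..k + s} \<Longrightarrow> f i \<le> g i"
  shows "coin_mean x s f k \<le> coin_mean x s g k"
  using assms(2)
proof (induction s arbitrary: k)
  case (Suc s)
  then show ?case using assms(1) by (auto intro!: add_mono mult_left_mono)
qed auto

lemma coin_mean_cong:
  assumes "\<And>i. i \<in> {k..k + s} \<Longrightarrow> f i = g i"
  shows "coin_mean x s f k = coin_mean x s g k"
  using assms
proof (induction s arbitrary: k)
  case (Suc s)
  have "coin_mean x s f (Suc k) = coin_mean x s g (Suc k)" "coin_mean x s f k = coin_mean x s g k"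
    by (rule Suc.IH; use Suc.prems in auto)+
  then show ?case by simp
qed auto

lemma coin_mean_nonneg:
  assumes "x \<in> {0..1}" and "\<And>i. i \<in> {k..k + s} \<Longrightarrow> 0 \<le> f i"
  shows "0 \<le> coin_mean x s f k"
  using coin_mean_mono[OF assms(1), of k s "\<lambda>_. 0" f] assms(2) by (simp add: coin_mean_const)

lemma has_bochner_integral_coin_mean:
  fixes F :: "real \<Rightarrow> nat \<Rightarrow> real"
  assumes "\<And>i. i \<in> {k..k + s} \<Longrightarrow> has_bochner_integral M (\<lambda>v. F v i) (G i)"
  shows "has_bochner_integral M (\<lambda>v. coin_mean x s (F v) k) (coin_mean x s G k)"
  using assms
proof (induction s arbitrary: k)
  case (Suc s)
  have "has_bochner_integral M (\<lambda>v. coin_mean x s (F v) (Suc k)) (coin_mean x s G (Suc k))"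
    "has_bochner_integral M (\<lambda>v. coin_mean x s (F v) k) (coin_mean x s G k)"
    by (rule Suc.IH; use Suc.prems in auto)+
  then show ?case
    by (auto intro!: has_bochner_integral_add has_bochner_integral_mult_right)
qed auto

section \<open>Windows of reachable success counts\<close>

definition window_osc :: "(nat \<Rightarrow> real) \<Rightarrow> nat \<Rightarrow> nat \<Rightarrow> real" where
  "window_osc f l k = (MAX i\<in>{k..k + l}. f i) - (MIN i\<in>{k..k + l}. f i)"

lemma window_osc_nonneg: "0 \<le> window_osc f l k"
proof -
  have "Min (f ` {k..k + l}) \<le> f k" by (intro Min_le) auto
  also have "f k \<le> Max (f ` {k..k + l})" by (intro Max_ge) auto
  finally show ?thesis by (simp add: window_osc_def)
qed

lemma window_osc_affine:
  assumes "c > 0"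
  shows "window_osc (\<lambda>i. (f i + b) / c) l k = window_osc f l k / c"
proof -
  have m: "mono (\<lambda>t::real. (t + b) / c)"
    using assms by (auto intro!: monoI divide_right_mono)
  have "Max ((\<lambda>i. (f i + b) / c) ` {k..k + l}) = (Max (f ` {k..k + l}) + b) / c"
    using mono_Max_commute[OF m, of "f ` {k..k + l}"] by (simp add: image_image)
  moreover have "Min ((\<lambda>i. (f i + b) / c) ` {k..k + l}) = (Min (f ` {k..k + l}) + b) / c"
    using mono_Min_commute[OF m, of "f ` {k..k + l}"] by (simp add: image_image)
  ultimately show ?thesis by (simp add: window_osc_def diff_divide_distrib add_divide_distrib)
qed

text \<open>The values of \<open>V\<close> for which an event with \<open>k\<close> successes and \<open>l\<close> remaining coins goes on.\<close>

definition undecided :: "(nat \<Rightarrow> real) \<Rightarrow> nat \<Rightarrow> nat \<Rightarrow> real set" where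
  "undecided f l k = {MIN i\<in>{k..k + l}. f i ..< MAX i\<in>{k..k + l}. f i}"

lemma undecided_mono:
  assumes "k \<le> i" "i + m \<le> k + l"
  shows "undecided f m i \<subseteq> undecided f l k"
proof -
  have "{i..i + m} \<subseteq> {k..k + l}" using assms by auto
  then show ?thesis
    by (auto simp: undecided_def intro: order.trans[OF Min_antimono] order.strict_trans2[OF _ Max_mono])
qed

text \<open>The expected number of coins for a fixed value \<open>v\<close> of \<open>V\<close>, written as a sum over the number \<open>s\<close> of
coins already revealed of the probability of being undecided at that point.\<close>

definition run_length :: "(nat \<Rightarrow> real) \<Rightarrow> real \<Rightarrow> real \<Rightarrow> nat \<Rightarrow> nat \<Rightarrow> real" where
  "run_length f x v l k = (\<Sum>s<l. coin_mean x s (\<lambda>i. indicator (undecided f (l - s) i) v) k)"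

text \<open>The recursion is linear even though \<^const>\<open>range_stopped\<close> branches on whether the event is decided: a
decided state has only decided successors (\<open>run_length_decided\<close>), so the two recursive terms vanish
by themselves in that case.\<close>

lemma run_length_Suc:
  "run_length f x v (Suc l) k = indicator (undecided f (Suc l) k) v
     + x * run_length f x v l (Suc k) + (1 - x) * run_length f x v l k"
  unfolding run_length_def
  by (subst sum.lessThan_Suc_shift) (simp add: sum.distrib sum_distrib_left)

text \<open>Windows shrink along a run, so a value of \<open>v\<close> outside the current window stays outside all later ones.\<close>

lemma run_length_decided:
  assumes "v \<notin> undecided f l k"
  shows "run_length f x v l k = 0"
  unfolding run_length_def
proof (intro sum.neutral ballI)
  fix s assume s: "s \<in> {..<l}"
  have "coin_mean x s (\<lambda>i. indicator (undecided f (l - s) i) v) k = coin_mean x s (\<lambda>i. 0) k"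
  proof (rule coin_mean_cong)
    fix i assume "i \<in> {k..k + s}"
    then have "undecided f (l - s) i \<subseteq> undecided f l k"
      using s by (intro undecided_mono) auto
    then show "indicator (undecided f (l - s) i) v = (0::real)"
      using assms by (auto simp: indicator_def)
  qed
  then show "coin_mean x s (\<lambda>i. indicator (undecided f (l - s) i) v) k = 0"
    by (simp add: coin_mean_const)
qed

lemma run_length_nonneg: "x \<in> {0..1} \<Longrightarrow> 0 \<le> run_length f x v l k"
  by (auto simp: run_length_def intro!: sum_nonneg coin_mean_nonneg)

section \<open>Success probability and mean length of one event\<close>

lemma ennreal_coin_flip:
  assumes "x \<in> {0..1}" "0 \<le> a" "0 \<le> b"
  shows "ennreal a * ennreal x + ennreal b * ennreal (1 - x) = ennreal (x * a + (1 - x) * b)"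
  using assms by (simp add: ennreal_plus mult.commute flip: ennreal_mult)

text \<open>Early stopping does not change the output: the event stops only when the comparison of \<open>v\<close> with the final
coefficient has the same outcome for every reachable success count. Hence the success probability is that
of the event which reveals all coins.\<close>

lemma range_stopped_success:
  assumes x: "x \<in> {0..1}"
  shows "(\<integral>\<^sup>+ z. indicator {z. fst z} z \<partial>range_stopped n y x v l k)
     = ennreal (coin_mean x l (\<lambda>i. indicator {..<bern_ctilde i n y} v) k)"
proof (induction l arbitrary: k)
  case 0
  show ?case by (auto simp: indicator_def)
next
  case (Suc l)
  let ?f = "\<lambda>i. bern_ctilde i n y"
  let ?m = "MIN i\<in>{k..k + Suc l}. ?f i"
  let ?M = "MAX i\<in>{k..k + Suc l}. ?f i"
  let ?g = "\<lambda>i. indicator {..<?f i} v :: real"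
  have nn: "0 \<le> coin_mean x l ?g k" for k using x by (intro coin_mean_nonneg) auto
  consider "v < ?m" | "v \<ge> ?m" "v \<ge> ?M" | "v \<ge> ?m" "v < ?M" by linarith
  then show ?case
  proof cases
    case 1
    have "coin_mean x (Suc l) ?g k = coin_mean x (Suc l) (\<lambda>i. 1) k"
      using 1 by (intro coin_mean_cong) auto
    then show ?thesis using 1 by (simp add: coin_mean_const del: coin_mean.simps)
  next
    case 2
    have "coin_mean x (Suc l) ?g k = coin_mean x (Suc l) (\<lambda>i. 0) k"
    proof (intro coin_mean_cong)
      fix i assume "i \<in> {k..k + Suc l}"
      then have "?f i \<le> ?M" by (intro Max_ge) auto
      then have "?f i \<le> v" using 2(2) by (rule order.trans)
      then show "?g i = 0" by (simp add: indicator_def)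
    qed
    moreover have "range_stopped n y x v (Suc l) k = return_pmf (False, 0)"
    proof -
      have "\<not> v < ?m" using 2 by linarith
      with 2 show ?thesis by (simp only: range_stopped.simps if_False if_True)
    qed
    ultimately show ?thesis by (simp add: coin_mean_const del: coin_mean.simps range_stopped.simps)
  next
    case 3
    then have "\<not> v < ?m" "\<not> v \<ge> ?M" by linarith+
    then have eq: "range_stopped n y x v (Suc l) k = do {
        coin \<leftarrow> bernoulli_pmf x;
        (out, cnt) \<leftarrow> range_stopped n y x v l (if coin then Suc k else k);
        return_pmf (out, Suc cnt)}"
      by (simp only: range_stopped.simps if_False)
    have "(\<integral>\<^sup>+ z. indicator {z. fst z} z \<partial>range_stopped n y x v (Suc l) k)
      = (\<integral>\<^sup>+ coin. \<integral>\<^sup>+ z. indicator {z. fst z} z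
           \<partial>range_stopped n y x v l (if coin then Suc k else k) \<partial>bernoulli_pmf x)"
      unfolding eq by (simp add: case_prod_beta' indicator_def)
    also have "\<dots> = ennreal (coin_mean x l ?g (Suc k)) * x + ennreal (coin_mean x l ?g k) * (1 - x)"
      using x by (simp add: Suc.IH)
    also have "\<dots> = ennreal (coin_mean x (Suc l) ?g k)"
      using x nn by (simp add: ennreal_coin_flip)
    finally show ?thesis .
  qed
qed

lemma range_stopped_length:
  assumes x: "x \<in> {0..1}"
  shows "(\<integral>\<^sup>+ z. of_nat (snd z) \<partial>range_stopped n y x v l k)
     = ennreal (run_length (\<lambda>i. bern_ctilde i n y) x v l k)"
proof (induction l arbitrary: k)
  case 0
  show ?case by (simp add: run_length_def)
next
  case (Suc l)
  let ?f = "\<lambda>i. bern_ctilde i n y"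
  let ?m = "MIN i\<in>{k..k + Suc l}. ?f i"
  let ?M = "MAX i\<in>{k..k + Suc l}. ?f i"
  have nn: "0 \<le> run_length ?f x v l k" for k using x by (rule run_length_nonneg)
  show ?case
  proof (cases "v \<in> undecided ?f (Suc l) k")
    case False
    then have "v < ?m \<or> \<not> v < ?m \<and> v \<ge> ?M"
      unfolding undecided_def atLeastLessThan_iff by linarith
    then have "range_stopped n y x v (Suc l) k = return_pmf (v < ?m, 0)"
      by (elim disjE conjE) (simp_all only: range_stopped.simps if_True if_False)
    then have "(\<integral>\<^sup>+ z. of_nat (snd z) \<partial>range_stopped n y x v (Suc l) k) = 0"
      by simp
    then show ?thesis using False by (simp add: run_length_decided)
  next
    case True
    then have v: "\<not> v < ?m" "\<not> v \<ge> ?M"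
      unfolding undecided_def atLeastLessThan_iff by linarith+
    have eq: "range_stopped n y x v (Suc l) k = do {
        coin \<leftarrow> bernoulli_pmf x;
        (out, cnt) \<leftarrow> range_stopped n y x v l (if coin then Suc k else k);
        return_pmf (out, Suc cnt)}"
      using v by (simp only: range_stopped.simps if_False)
    have "(\<integral>\<^sup>+ z. of_nat (snd z) \<partial>range_stopped n y x v (Suc l) k)
      = (\<integral>\<^sup>+ coin. \<integral>\<^sup>+ z. 1 + of_nat (snd z)
           \<partial>range_stopped n y x v l (if coin then Suc k else k) \<partial>bernoulli_pmf x)"
      unfolding eq by (simp add: case_prod_beta')
    also have "\<dots> = (\<integral>\<^sup>+ coin. 1 + run_length ?f x v l (if coin then Suc k else k) \<partial>bernoulli_pmf x)"
      by (simp add: nn_integral_add Suc.IH nn)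
    also have "\<dots> = ennreal (1 + run_length ?f x v l (Suc k)) * x + ennreal (1 + run_length ?f x v l k) * (1 - x)"
      using x nn by simp
    also have "\<dots> = ennreal (run_length ?f x v (Suc l) k)"
      using x nn True
      by (subst ennreal_coin_flip) (auto simp: run_length_Suc algebra_simps)
    finally show ?thesis .
  qed
qed

text \<open>Membership is compared only at interior points other than the left end point, which covers half-open windows and
open rays at once.\<close>

lemma has_bochner_integral_uniform_unit:
  assumes "A \<in> sets borel" "\<And>v. v \<in> {0<..<1} \<Longrightarrow> v \<noteq> s \<Longrightarrow> v \<in> A \<longleftrightarrow> s < v \<and> v < (t::real)"
    and "0 \<le> s" "s \<le> t" "t \<le> 1"
  shows "has_bochner_integral (uniform_measure lborel {0<..<1}) (indicator A) (t - s)"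
proof -
  have "emeasure lborel ({0<..<1} \<inter> A) = emeasure lborel {s<..<t}"
  proof (rule emeasure_eq_AE)
    show "AE v in lborel. v \<in> {0<..<1} \<inter> A \<longleftrightarrow> v \<in> {s<..<t}"
      using AE_lborel_singleton[of s] by eventually_elim (use assms in auto)
  qed (use assms in auto)
  then have "emeasure (uniform_measure lborel {0<..<1}) A = ennreal (t - s)"
    using assms by (simp add: ennreal_1[symmetric] divide_ennreal del: ennreal_1)
  then show ?thesis
    using assms by (intro has_bochner_integral_real_indicator[THEN has_bochner_integral_cong[THEN iffD1, rotated -1]])
       (auto simp: measure_def)
qed

lemma bern_C_pos: "0 < bern_C n y"
  by (simp add: bern_C_def less_max_iff_disj)

lemma bern_ctilde_range:
  assumes "i \<le> n"
  shows "bern_ctilde i n y \<in> {0..1}"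
proof -
  have "(MIN k\<in>{0..n}. bern_beta k n y) \<le> bern_beta i n y"
    using assms by (intro Min_le) auto
  then have "0 \<le> bern_c i n y" unfolding bern_c_def bern_b_def by linarith
  moreover have "bern_c i n y \<le> (MAX k\<in>{0..n}. bern_c k n y)"
    using assms by (intro Max_ge) auto
  then have "bern_c i n y \<le> bern_C n y" by (simp add: bern_C_def)
  ultimately show ?thesis using bern_C_pos[of n y] by (simp add: bern_ctilde_def)
qed

text \<open>The Bernstein polynomial of degree \<open>n\<close> with coefficients \<^const>\<open>bern_beta\<close> is \<open>(x - y)\<^sup>2\<close>, without
remainder.\<close>

lemma coin_mean_bern_ctilde:
  assumes "n \<ge> 2"
  shows "coin_mean x n (\<lambda>i. bern_ctilde i n y) 0 = ((x - y)\<^sup>2 + bern_b n y) / bern_C n y"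
proof -
  let ?C = "bern_C n y" and ?n = "real n"
  have n: "?n \<noteq> 0" "?n - 1 \<noteq> 0" using assms by auto
  have "(\<lambda>i. bern_ctilde i n y) = (\<lambda>i. (1 / ?C) * ((y\<^sup>2 + bern_b n y)
      + ((- 2 * y / ?n) * real i + (1 / (?n * (?n - 1))) * (real i * (real i - 1)))))"
    by (simp add: fun_eq_iff bern_ctilde_def bern_c_def bern_beta_def)
  then have "coin_mean x n (\<lambda>i. bern_ctilde i n y) 0 = (1 / ?C) * ((y\<^sup>2 + bern_b n y)
      + ((- 2 * y / ?n) * (?n * x) + (1 / (?n * (?n - 1))) * (?n * (?n - 1) * x\<^sup>2)))"
    by (simp only: coin_mean_cmult coin_mean_add coin_mean_const coin_mean_linear coin_mean_falling) simp
  also have "\<dots> = ((x - y)\<^sup>2 + bern_b n y) / ?C"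
  proof -
    have "(1 / (?n * (?n - 1))) * (?n * (?n - 1) * x\<^sup>2) = x\<^sup>2" using n by simp
    moreover have "(- 2 * y / ?n) * (?n * x) = - 2 * x * y" using n by simp
    ultimately have "y\<^sup>2 + bern_b n y + ((- 2 * y / ?n) * (?n * x) + (1 / (?n * (?n - 1))) * (?n * (?n - 1) * x\<^sup>2))
        = (x - y)\<^sup>2 + bern_b n y"
      by (simp only: power2_diff)
    then show ?thesis by simp
  qed
  finally show ?thesis .
qed

text \<open>The mean number of coins of one event times \<^const>\<open>bern_C\<close>. The normalisation is left out because it
cancels against the label probabilities in \<^const>\<open>auxiliary_event\<close>.\<close>

definition mean_coins :: "nat \<Rightarrow> real \<Rightarrow> real \<Rightarrow> real" where
  "mean_coins n y x = (\<Sum>s<n. coin_mean x s (window_osc (\<lambda>i. bern_beta i n y) (n - s)) 0)"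

lemma mean_coins_nonneg: "x \<in> {0..1} \<Longrightarrow> 0 \<le> mean_coins n y x"
  by (auto simp: mean_coins_def intro!: sum_nonneg coin_mean_nonneg window_osc_nonneg)

lemma nn_integral_bernstein_event:
  "(\<integral>\<^sup>+ z. f z \<partial>bernstein_event n y x)
     = (\<integral>\<^sup>+ v. \<integral>\<^sup>+ z. f z \<partial>range_stopped n y x v n 0 \<partial>uniform_measure lborel {0<..<1})"
  unfolding bernstein_event_def
proof (rule nn_integral_bind[where B = "count_space UNIV"])
  show "(\<lambda>v. measure_pmf (range_stopped n y x v n 0))
      \<in> uniform_measure lborel {0<..<1} \<rightarrow>\<^sub>M subprob_algebra (count_space UNIV)"
  proof -
    have "(\<lambda>v::real. (x, v)) \<in> borel \<rightarrow>\<^sub>M borel \<Otimes>\<^sub>M borel" by measurable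
    from measurable_compose[OF this measurable_range_stopped[of n y n 0]] show ?thesis
      by (auto intro: measurable_prob_algebraD)
  qed
qed simp

lemma bernstein_event_success:
  assumes x: "x \<in> {0..1}" and n: "n \<ge> 2"
  shows "(\<integral>\<^sup>+ z. indicator {z. fst z} z \<partial>bernstein_event n y x)
     = ennreal (((x - y)\<^sup>2 + bern_b n y) / bern_C n y)"
proof -
  let ?U = "uniform_measure lborel {0<..<1::real}"
  let ?h = "\<lambda>v. coin_mean x n (\<lambda>i. indicator {..<bern_ctilde i n y} v) 0"
  have "has_bochner_integral ?U ?h (coin_mean x n (\<lambda>i. bern_ctilde i n y - 0) 0)"
    using bern_ctilde_range[of _ n y]
    by (intro has_bochner_integral_coin_mean has_bochner_integral_uniform_unit) auto
  then have h: "has_bochner_integral ?U ?h (((x - y)\<^sup>2 + bern_b n y) / bern_C n y)"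
    by (simp add: coin_mean_bern_ctilde n)
  have "(\<integral>\<^sup>+ z. indicator {z. fst z} z \<partial>bernstein_event n y x) = (\<integral>\<^sup>+ v. ennreal (?h v) \<partial>?U)"
    by (simp add: nn_integral_bernstein_event range_stopped_success[OF x])
  also have "\<dots> = ennreal (integral\<^sup>L ?U ?h)"
  proof (intro nn_integral_eq_integral AE_I2)
    show "0 \<le> ?h v" for v using x by (intro coin_mean_nonneg) auto
  qed (use h in \<open>auto intro: integrable.intros\<close>)
  finally show ?thesis using h by (simp add: has_bochner_integral_integral_eq)
qed

text \<open>For uniform \<open>V\<close> the probability of being undecided in a state is the length of its window, that is
the oscillation of the coefficients.\<close>

lemma bernstein_event_length:
  assumes x: "x \<in> {0..1}"
  shows "(\<integral>\<^sup>+ z. of_nat (snd z) \<partial>bernstein_event n y x)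
     = ennreal (mean_coins n y x / bern_C n y)"
proof -
  let ?U = "uniform_measure lborel {0<..<1::real}"
  let ?f = "\<lambda>i. bern_ctilde i n y"
  let ?h = "\<lambda>v. run_length ?f x v n 0"
  have window: "has_bochner_integral ?U (indicator (undecided ?f l i)) (window_osc ?f l i)"
    if "i + l \<le> n" for i l
  proof -
    have "?f j \<in> {0..1}" if "j \<in> {i..i + l}" for j
      using that \<open>i + l \<le> n\<close> by (intro bern_ctilde_range) auto
    then have "0 \<le> Min (?f ` {i..i + l})" "Max (?f ` {i..i + l}) \<le> 1"
      by (subst Min_ge_iff Max_le_iff; fastforce)+
    then show ?thesis
      unfolding window_osc_def
      using window_osc_nonneg[of ?f l i]
      by (intro has_bochner_integral_uniform_unit) (auto simp: undecided_def window_osc_def)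
  qed
  have "has_bochner_integral ?U ?h (\<Sum>s<n. coin_mean x s (window_osc ?f (n - s)) 0)"
    unfolding run_length_def
    by (intro has_bochner_integral_sum has_bochner_integral_coin_mean window) auto
  also have "(\<Sum>s<n. coin_mean x s (window_osc ?f (n - s)) 0) = mean_coins n y x / bern_C n y"
  proof -
    have win: "window_osc ?f l i = (1 / bern_C n y) * window_osc (\<lambda>i. bern_beta i n y) l i" for l i
      using bern_C_pos[of n y]
      by (simp add: bern_ctilde_def bern_c_def window_osc_affine)
    have "coin_mean x s (window_osc ?f (n - s)) 0
      = (1 / bern_C n y) * coin_mean x s (window_osc (\<lambda>i. bern_beta i n y) (n - s)) 0" for s
      unfolding coin_mean_cmult[symmetric] by (rule coin_mean_cong) (rule win)
    then show ?thesis by (simp add: mean_coins_def sum_divide_distrib)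
  qed
  finally have h: "has_bochner_integral ?U ?h (mean_coins n y x / bern_C n y)" .
  have "(\<integral>\<^sup>+ z. of_nat (snd z) \<partial>bernstein_event n y x) = (\<integral>\<^sup>+ v. ennreal (?h v) \<partial>?U)"
    by (simp add: nn_integral_bernstein_event range_stopped_length[OF x])
  also have "\<dots> = ennreal (integral\<^sup>L ?U ?h)"
    using h x by (intro nn_integral_eq_integral AE_I2 run_length_nonneg)
      (auto intro: integrable.intros)
  finally show ?thesis using h by (simp add: has_bochner_integral_integral_eq)
qed

definition mean_coins_tot :: "nat \<Rightarrow> real ^ 'j::finite \<Rightarrow> real ^ 'j \<Rightarrow> real" where
  "mean_coins_tot n y x = (\<Sum>j\<in>UNIV. mean_coins n (y $ j) (x $ j))"

lemma nn_integral_auxiliary_event: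
  fixes y :: "real ^ 'j::finite"
  shows "(\<integral>\<^sup>+ z. f z \<partial>auxiliary_event n y x)
     = (\<Sum>j\<in>UNIV. (\<integral>\<^sup>+ z. f z \<partial>bernstein_event n (y $ j) (x $ j)) * ennreal (pmf (label_pmf n y) j))"
proof -
  have "(\<integral>\<^sup>+ z. f z \<partial>auxiliary_event n y x)
     = (\<integral>\<^sup>+ j. \<integral>\<^sup>+ z. f z \<partial>bernstein_event n (y $ j) (x $ j) \<partial>label_pmf n y)"
    unfolding auxiliary_event_def
  proof (rule nn_integral_bind[where B = "count_space UNIV"])
    have "bernstein_event n (y $ j) (x $ j) \<in> space (subprob_algebra (count_space UNIV))" for j
      using measurable_space[OF measurable_bernstein_event, of "x $ j" n "y $ j"]
      by (auto simp: space_prob_algebra space_subprob_algebra prob_space_imp_subprob_space)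
    then show "(\<lambda>j. bernstein_event n (y $ j) (x $ j)) \<in> label_pmf n y \<rightarrow>\<^sub>M subprob_algebra (count_space UNIV)"
      by auto
  qed simp
  also have "\<dots> = (\<Sum>j\<in>UNIV. (\<integral>\<^sup>+ z. f z \<partial>bernstein_event n (y $ j) (x $ j)) * ennreal (pmf (label_pmf n y) j))"
    by (rule nn_integral_measure_pmf_support) auto
  finally show ?thesis .
qed

text \<open>The label is drawn proportionally to \<^const>\<open>bern_C\<close>, which cancels the normalisation of each component.\<close>

lemma label_weights:
  fixes y :: "real ^ 'j::finite"
  assumes "\<And>j. 0 \<le> g j"
  shows "(\<Sum>j\<in>UNIV. ennreal (g j / bern_C n (y $ j)) * ennreal (pmf (label_pmf n y) j))
     = ennreal ((\<Sum>j\<in>UNIV. g j) / (\<Sum>j\<in>UNIV. bern_C n (y $ j)))"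
proof -
  have "bern_C n (y $ j) \<noteq> 0" for j using bern_C_pos[of n "y $ j"] by simp
  then have "(\<Sum>j\<in>UNIV. ennreal (g j / bern_C n (y $ j)) * ennreal (pmf (label_pmf n y) j))
     = (\<Sum>j\<in>UNIV. ennreal (g j / (\<Sum>j\<in>UNIV. bern_C n (y $ j))))"
    using assms bern_C_pos[of n, THEN less_imp_le]
    by (intro sum.cong refl) (simp add: pmf_label_pmf sum_nonneg flip: ennreal_mult)
  also have "\<dots> = ennreal ((\<Sum>j\<in>UNIV. g j) / (\<Sum>j\<in>UNIV. bern_C n (y $ j)))"
    using assms bern_C_pos[of n, THEN less_imp_le]
    by (subst sum_ennreal) (auto simp: sum_divide_distrib intro!: divide_nonneg_nonneg sum_nonneg)
  finally show ?thesis .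
qed

text \<open>Under the binomial law with success probability \<open>y\<close> the shifted coefficients, which are nonnegative, have
mean \<open>(y - y)\<^sup>2 + bern_b n y\<close>.\<close>

lemma bern_b_nonneg:
  assumes "n \<ge> 2" "y \<in> {0..1}"
  shows "0 \<le> bern_b n y"
proof -
  have "coin_mean y n (\<lambda>i. bern_ctilde i n y) 0 \<ge> 0"
    using bern_ctilde_range[of _ n y] assms by (intro coin_mean_nonneg) auto
  then show ?thesis using bern_C_pos[of n y] assms
    by (simp add: coin_mean_bern_ctilde zero_le_divide_iff)
qed

section \<open>Mean cost of one candidate and of the whole sampler\<close>

lemma auxiliary_event_success:
  fixes y x :: "real ^ 'j::finite"
  assumes y: "\<And>j. y $ j \<in> {0..1}" and x: "\<And>j. x $ j \<in> {0..1}" and n: "n \<ge> 2"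
  shows "(\<integral>\<^sup>+ z. indicator {z. fst z} z \<partial>auxiliary_event n y x)
     = ennreal ((misfit y x + bern_b_tot n y) / (\<Sum>j\<in>UNIV. bern_C n (y $ j)))"
  using label_weights[of "\<lambda>j. (x $ j - y $ j)\<^sup>2 + bern_b n (y $ j)" n y] bern_b_nonneg[OF n y]
  by (simp add: nn_integral_auxiliary_event bernstein_event_success[OF x n] sum.distrib
      misfit_def bern_b_tot_def)

lemma auxiliary_event_length:
  fixes y x :: "real ^ 'j::finite"
  assumes x: "\<And>j. x $ j \<in> {0..1}"
  shows "(\<integral>\<^sup>+ z. of_nat (snd z) \<partial>auxiliary_event n y x)
     = ennreal (mean_coins_tot n y x / (\<Sum>j\<in>UNIV. bern_C n (y $ j)))"
  using label_weights[of "\<lambda>j. mean_coins n (y $ j) (x $ j)" n y] mean_coins_nonneg[OF x]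
  by (simp add: nn_integral_auxiliary_event bernstein_event_length[OF x] mean_coins_tot_def)

lemma auxiliary_event_space:
  fixes y x :: "real ^ 'j::finite"
  shows "auxiliary_event n y x \<in> space (prob_algebra (count_space UNIV))"
  using measurable_space[OF measurable_auxiliary_event] by simp

lemma candidate_tests_space:
  fixes y x :: "real ^ 'j::finite"
  shows "candidate_tests n y x r \<in> space (prob_algebra (count_space UNIV))"
  using measurable_space[OF measurable_candidate_tests] by simp

lemma candidate_space:
  fixes y x :: "real ^ 'j::finite"
  shows "candidate a n y x \<in> space (prob_algebra (count_space UNIV))"
  using measurable_space[OF measurable_candidate] by simp

lemma nn_integral_bind_prob_algebra:
  assumes "A \<in> space (prob_algebra M)" and "K \<in> M \<rightarrow>\<^sub>M prob_algebra N" and "f \<in> borel_measurable N"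
  shows "(\<integral>\<^sup>+ z. f z \<partial>(A \<bind> K)) = (\<integral>\<^sup>+ x. \<integral>\<^sup>+ z. f z \<partial>K x \<partial>A)"
proof (rule nn_integral_bind[OF assms(3)])
  have "sets A = sets M" using assms(1) by (simp add: space_prob_algebra)
  then show "K \<in> A \<rightarrow>\<^sub>M subprob_algebra N"
    using measurable_prob_algebraD[OF assms(2)] by (simp cong: measurable_cong_sets)
qed

lemma nn_integral_bind_count_space:
  assumes "A \<in> space (prob_algebra (count_space UNIV))"
    and "\<And>z. K z \<in> space (prob_algebra (count_space UNIV))"
  shows "(\<integral>\<^sup>+ z. f z \<partial>(A \<bind> K)) = (\<integral>\<^sup>+ x. \<integral>\<^sup>+ z. f z \<partial>K x \<partial>A)"
  by (rule nn_integral_bind_prob_algebra[OF assms(1), of K "count_space UNIV"]) (auto simp: assms(2))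

lemma nn_integral_add_const_prob_algebra:
  assumes "A \<in> space (prob_algebra (count_space UNIV))"
  shows "(\<integral>\<^sup>+ z. c + f z \<partial>A) = c + (\<integral>\<^sup>+ z. f z \<partial>A)"
proof -
  from assms interpret prob_space A by (simp add: space_prob_algebra)
  have [measurable_cong]: "sets A = sets (count_space UNIV)"
    using assms by (simp add: space_prob_algebra)
  show ?thesis by (subst nn_integral_add) (auto simp: emeasure_space_1)
qed

lemma borel_measurable_discrete:
  assumes "A \<in> space (prob_algebra (count_space UNIV))"
  shows "f \<in> borel_measurable A"
proof -
  have "sets A = sets (count_space UNIV)" using assms by (simp add: space_prob_algebra)
  show ?thesis unfolding measurable_cong_sets[OF \<open>sets A = _\<close> refl] by simp
qed

lemma candidate_tests_length_Suc:
  fixes y x :: "real ^ 'j::finite"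
  shows "(\<integral>\<^sup>+ z. of_nat (snd z) \<partial>candidate_tests n y x (Suc r))
     = (\<integral>\<^sup>+ z. of_nat (snd z) \<partial>auxiliary_event n y x)
       + (\<integral>\<^sup>+ z. indicator {z. \<not> fst z} z \<partial>auxiliary_event n y x)
         * (\<integral>\<^sup>+ z. of_nat (snd z) \<partial>candidate_tests n y x r)"
proof -
  let ?T = "\<integral>\<^sup>+ z. of_nat (snd z) \<partial>candidate_tests n y x r"
  let ?K = "\<lambda>z. if fst z then return (count_space UNIV) (False, snd z)
     else candidate_tests n y x r \<bind> (\<lambda>w. return (count_space UNIV) (fst w, snd z + snd w))"
  note [simp] = borel_measurable_discrete[OF auxiliary_event_space]
  have K: "?K z \<in> space (prob_algebra (count_space UNIV))" for z
    by (auto intro!: return_in_prob_algebra bind_in_prob_algebra[OF candidate_tests_space])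
  have "(\<integral>\<^sup>+ w. of_nat (snd w) \<partial>?K z) = of_nat (snd z) + indicator {z. \<not> fst z} z * ?T" for z
  proof (cases "fst z")
    case False
    then have "(\<integral>\<^sup>+ w. of_nat (snd w) \<partial>?K z) = (\<integral>\<^sup>+ w. of_nat (snd z) + of_nat (snd w) \<partial>candidate_tests n y x r)"
      by (simp add: nn_integral_bind_count_space[OF candidate_tests_space] return_in_prob_algebra
          nn_integral_return)
    then show ?thesis using False
      by (simp add: nn_integral_add_const_prob_algebra[OF candidate_tests_space])
  qed (simp add: nn_integral_return)
  then have "(\<integral>\<^sup>+ z. of_nat (snd z) \<partial>candidate_tests n y x (Suc r))
     = (\<integral>\<^sup>+ z. of_nat (snd z) + indicator {z. \<not> fst z} z * ?T \<partial>auxiliary_event n y x)"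
    unfolding candidate_tests.simps case_prod_beta'
    by (subst nn_integral_bind_count_space[OF auxiliary_event_space]) (use K in auto)
  also have "\<dots> = (\<integral>\<^sup>+ z. of_nat (snd z) \<partial>auxiliary_event n y x)
       + (\<integral>\<^sup>+ z. indicator {z. \<not> fst z} z \<partial>auxiliary_event n y x) * ?T"
    by (subst nn_integral_add) (simp_all add: nn_integral_multc del: nn_integral_indicator)
  finally show ?thesis .
qed

text \<open>Each further test is reached with probability \<open>1 - \<rho>\<close> given the previous one, so the mean is a geometric sum.\<close>

lemma candidate_tests_length:
  fixes y x :: "real ^ 'j::finite"
  assumes \<rho>: "(\<integral>\<^sup>+ z. indicator {z. fst z} z \<partial>auxiliary_event n y x) = ennreal \<rho>" "0 < \<rho>"
    and A: "(\<integral>\<^sup>+ z. of_nat (snd z) \<partial>auxiliary_event n y x) = ennreal A" "0 \<le> A"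
  shows "\<rho> \<le> 1"
    and "(\<integral>\<^sup>+ z. of_nat (snd z) \<partial>candidate_tests n y x r) = ennreal (A * (1 - (1 - \<rho>) ^ r) / \<rho>)"
proof -
  interpret prob_space "auxiliary_event n y x"
    using auxiliary_event_space[of n y x] by (simp add: space_prob_algebra)
  have [measurable_cong]: "sets (auxiliary_event n y x) = sets (count_space UNIV)"
    using auxiliary_event_space[of n y x] by (simp add: space_prob_algebra)
  have prob: "prob {z. fst z} = \<rho>"
    using \<rho> by (simp add: emeasure_eq_measure)
  then show le: "\<rho> \<le> 1" using prob_le_1[of "{z. fst z}"] by simp
  have "space (auxiliary_event n y x) - {z. fst z} = {z. \<not> fst z}"
    using sets_eq_imp_space_eq[of "auxiliary_event n y x" "count_space UNIV"]
      auxiliary_event_space[of n y x] by (auto simp: space_prob_algebra)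
  then have "prob {z. \<not> fst z} = 1 - \<rho>"
    using prob_compl[of "{z. fst z}"] prob by simp
  then have failure: "(\<integral>\<^sup>+ z. indicator {z. \<not> fst z} z \<partial>auxiliary_event n y x) = ennreal (1 - \<rho>)"
    by (simp add: emeasure_eq_measure)
  show "(\<integral>\<^sup>+ z. of_nat (snd z) \<partial>candidate_tests n y x r) = ennreal (A * (1 - (1 - \<rho>) ^ r) / \<rho>)"
  proof (induction r)
    case 0
    show ?case by (simp add: nn_integral_return)
  next
    case (Suc r)
    have "(1 - \<rho>) ^ r \<le> 1" using le \<rho>(2) by (intro power_le_one) auto
    then have "0 \<le> A * (1 - (1 - \<rho>) ^ r) / \<rho>" using A \<rho>(2) by simp
    then have "(\<integral>\<^sup>+ z. of_nat (snd z) \<partial>candidate_tests n y x (Suc r))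
        = ennreal (A + (1 - \<rho>) * (A * (1 - (1 - \<rho>) ^ r) / \<rho>))"
      using A le unfolding candidate_tests_length_Suc failure A Suc.IH
      by (subst ennreal_plus) (auto simp: ennreal_mult simp del: times_divide_eq_right)
    also have "A + (1 - \<rho>) * (A * (1 - (1 - \<rho>) ^ r) / \<rho>) = A * (1 - (1 - \<rho>) ^ Suc r) / \<rho>"
      using \<rho>(2) by (simp add: field_simps)
    finally show ?case .
  qed
qed

lemma nn_integral_poisson_sums:
  assumes "0 < \<Lambda>" "\<And>r. 0 \<le> f r" "(\<lambda>r. f r * \<Lambda> ^ r / fact r) sums t"
  shows "(\<integral>\<^sup>+ r. ennreal (f r) \<partial>poisson_pmf \<Lambda>) = ennreal (exp (- \<Lambda>) * t)"
proof -
  have "(\<integral>\<^sup>+ r. ennreal (f r) \<partial>poisson_pmf \<Lambda>) = (\<Sum>r. ennreal (exp (- \<Lambda>) * (f r * \<Lambda> ^ r / fact r)))"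
    using assms(1,2)
    by (simp add: nn_integral_measure_pmf nn_integral_count_space_nat algebra_simps flip: ennreal_mult)
  also have "\<dots> = ennreal (exp (- \<Lambda>) * t)"
    using assms(1,2) by (intro suminf_ennreal_eq sums_mult assms(3)) auto
  finally show ?thesis .
qed

lemma exp_sums: "(\<lambda>r. z ^ r / fact r) sums exp (z::real)"
  using exp_converges[of z] by (simp add: divide_inverse mult.commute)

text \<open>Averaging the geometric sum over the Poisson number of tests thins the Poisson law and turns the power
\<open>(1 - \<rho>) ^ r\<close> into an exponential; the sum of the \<^const>\<open>bern_C\<close> cancels.\<close>

lemma candidate_length:
  fixes y x :: "real ^ 'j::finite"
  assumes y: "\<And>j. y $ j \<in> {0..1}" and x: "\<And>j. x $ j \<in> {0..1}" and n: "n \<ge> 2"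
    and a: "a > 0" and b: "bern_b_tot n y > 0"
  shows "(\<integral>\<^sup>+ z. of_nat (snd z) \<partial>candidate a n y x)
     = ennreal (mean_coins_tot n y x *
         ((1 - exp (- (a * (misfit y x + bern_b_tot n y)))) / (misfit y x + bern_b_tot n y)))"
proof -
  define S where "S = (\<Sum>j\<in>UNIV. bern_C n (y $ j))"
  define w where "w = misfit y x + bern_b_tot n y"
  define \<rho> where "\<rho> = w / S"
  define A where "A = mean_coins_tot n y x / S"
  have S: "0 < S" unfolding S_def by (intro sum_pos bern_C_pos) auto
  have w: "0 < w" using b unfolding w_def misfit_def by (intro add_nonneg_pos sum_nonneg) auto
  have A: "0 \<le> A" using S mean_coins_nonneg[OF x]
    by (auto simp: A_def mean_coins_tot_def intro!: sum_nonneg divide_nonneg_nonneg)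
  have \<rho>: "0 < \<rho>" using S w by (simp add: \<rho>_def)
  have T: "(\<integral>\<^sup>+ z. of_nat (snd z) \<partial>candidate_tests n y x r) = ennreal (A * (1 - (1 - \<rho>) ^ r) / \<rho>)"
    and le: "\<rho> \<le> 1" for r
    using candidate_tests_length[of n y x \<rho> A] \<rho> A
      auxiliary_event_success[OF y x n] auxiliary_event_length[OF x, of n y]
    by (simp_all add: \<rho>_def A_def S_def w_def)
  have le1: "(1 - \<rho>) ^ r \<le> 1" for r using le \<rho> by (intro power_le_one) auto
  have "(\<lambda>r. (A / \<rho>) * ((a * S) ^ r / fact r - (a * S * (1 - \<rho>)) ^ r / fact r)) sums
      ((A / \<rho>) * (exp (a * S) - exp (a * S * (1 - \<rho>))))"
    by (intro sums_mult sums_diff exp_sums)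
  then have sums: "(\<lambda>r. A * (1 - (1 - \<rho>) ^ r) / \<rho> * (a * S) ^ r / fact r) sums
      ((A / \<rho>) * (exp (a * S) - exp (a * S * (1 - \<rho>))))"
    by (rule sums_cong[THEN iffD1, rotated])
       (simp only: power_mult_distrib[of "a * S"], simp add: field_simps)
  have "(\<integral>\<^sup>+ z. of_nat (snd z) \<partial>candidate a n y x)
      = (\<integral>\<^sup>+ r. ennreal (A * (1 - (1 - \<rho>) ^ r) / \<rho>) \<partial>poisson_pmf (a * S))"
    unfolding candidate_def S_def[symmetric]
    by (simp add: nn_integral_bind_count_space[OF measure_pmf_in_prob_algebra] T candidate_tests_space)
  also have "\<dots> = ennreal (exp (- (a * S)) * ((A / \<rho>) * (exp (a * S) - exp (a * S * (1 - \<rho>)))))"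
    using S a A \<rho> le1 by (intro nn_integral_poisson_sums sums) auto
  also have "exp (- (a * S)) * ((A / \<rho>) * (exp (a * S) - exp (a * S * (1 - \<rho>))))
      = A / \<rho> * (1 - exp (- (a * w)))"
    using S by (simp add: \<rho>_def algebra_simps flip: exp_add)
  also have "A / \<rho> = mean_coins_tot n y x / w" using S by (simp add: A_def \<rho>_def)
  finally show ?thesis by (simp add: w_def)
qed

text \<open>The mean number of tests made on a candidate, divided by the sum of the \<^const>\<open>bern_C\<close> over the components.\<close>

definition tests_per_label :: "real \<Rightarrow> nat \<Rightarrow> real ^ 'j::finite \<Rightarrow> real ^ 'j \<Rightarrow> real" where
  "tests_per_label a n y x =
     (1 - exp (- (a * (misfit y x + bern_b_tot n y)))) / (misfit y x + bern_b_tot n y)"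

lemma coins_of_candidates_length:
  fixes y :: "real ^ 'j::finite"
  assumes "prob_space \<mu>" and p: "p \<in> borel_measurable \<mu>"
  shows "(\<integral>\<^sup>+ w. of_nat w \<partial>coins_of_candidates \<mu> p a n y m)
     = of_nat m * (\<integral>\<^sup>+ q. \<integral>\<^sup>+ z. of_nat (snd z) \<partial>candidate a n y (p q) \<partial>\<mu>)"
proof (induction m)
  case 0
  show ?case by (simp add: nn_integral_return)
next
  case (Suc m)
  interpret prob_space \<mu> by fact
  let ?L = "coins_of_candidates \<mu> p a n y m"
  have L: "?L \<in> space (prob_algebra (count_space UNIV))"
    using assms by (rule coins_of_candidates_in_prob_algebra)
  have cand: "(\<lambda>q. candidate a n y (p q)) \<in> \<mu> \<rightarrow>\<^sub>M prob_algebra (count_space UNIV)"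
    by (rule measurable_compose[OF p measurable_candidate])
  have inner: "?L \<bind> (\<lambda>w. return (count_space UNIV) (k + w)) \<in> space (prob_algebra (count_space UNIV))" for k
    by (rule bind_in_prob_algebra[OF L]) (simp add: return_in_prob_algebra)
  have "(\<integral>\<^sup>+ w. of_nat w \<partial>coins_of_candidates \<mu> p a n y (Suc m))
     = (\<integral>\<^sup>+ q. \<integral>\<^sup>+ z. \<integral>\<^sup>+ w. of_nat w \<partial>(?L \<bind> (\<lambda>w. return (count_space UNIV) (snd z + w)))
          \<partial>candidate a n y (p q) \<partial>\<mu>)"
    unfolding coins_of_candidates.simps case_prod_beta'
    using assms inner
    by (subst nn_integral_bind_prob_algebra[where M = \<mu> and N = "count_space UNIV"])
       (auto intro!: measurable_bind_prob_space[OF cand] nn_integral_cong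
          simp: space_prob_algebra nn_integral_bind_count_space[OF candidate_space])
  also have "\<dots> = (\<integral>\<^sup>+ q. \<integral>\<^sup>+ z. (\<integral>\<^sup>+ w. of_nat w \<partial>?L) + of_nat (snd z) \<partial>candidate a n y (p q) \<partial>\<mu>)"
    by (simp add: nn_integral_bind_count_space[OF L] return_in_prob_algebra nn_integral_return
        nn_integral_add_const_prob_algebra[OF L] add.commute[of "integral\<^sup>N ?L of_nat"])
  also have "\<dots> = (\<integral>\<^sup>+ q. (\<integral>\<^sup>+ w. of_nat w \<partial>?L) + (\<integral>\<^sup>+ z. of_nat (snd z) \<partial>candidate a n y (p q)) \<partial>\<mu>)"
    by (simp add: nn_integral_add_const_prob_algebra[OF candidate_space])
  also have "\<dots> = (\<integral>\<^sup>+ w. of_nat w \<partial>?L) + (\<integral>\<^sup>+ q. \<integral>\<^sup>+ z. of_nat (snd z) \<partial>candidate a n y (p q) \<partial>\<mu>)"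
  proof (subst nn_integral_add)
    show "(\<lambda>q. \<integral>\<^sup>+ z. of_nat (snd z) \<partial>candidate a n y (p q)) \<in> borel_measurable \<mu>"
      by (rule measurable_compose[OF measurable_prob_algebraD[OF cand] nn_integral_measurable_subprob_algebra]) simp
  qed (auto simp: emeasure_space_1)
  finally show ?case by (simp add: Suc.IH algebra_simps)
qed

lemma continuous_misfit: "continuous_on UNIV (misfit y)"
  unfolding misfit_def by (intro continuous_intros)

lemma continuous_coin_mean: "continuous_on UNIV (\<lambda>x. coin_mean x s f k)"
  by (induction s arbitrary: k) (auto intro!: continuous_intros)

lemma continuous_mean_coins_tot: "continuous_on UNIV (mean_coins_tot n y)"
  unfolding mean_coins_tot_def mean_coins_def
  by (intro continuous_intros continuous_on_compose2[OF continuous_coin_mean]) auto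

lemma measurable_misfit[measurable]: "misfit y \<in> borel_measurable borel"
  by (intro borel_measurable_continuous_onI continuous_misfit)

lemma measurable_mean_coins_tot[measurable]: "mean_coins_tot n y \<in> borel_measurable borel"
  by (intro borel_measurable_continuous_onI continuous_mean_coins_tot)

lemma measurable_tests_per_label[measurable]: "tests_per_label a n y \<in> borel_measurable borel"
  unfolding tests_per_label_def by measurable

lemma misfit_nonneg: "0 \<le> misfit y x"
  by (simp add: misfit_def sum_nonneg)

lemma mean_coins_tot_nonneg: "(\<And>j. x $ j \<in> {0..1}) \<Longrightarrow> 0 \<le> mean_coins_tot n y x"
  by (auto simp: mean_coins_tot_def intro!: sum_nonneg mean_coins_nonneg)

text \<open>The exact expected cost, by Wald-type factorisations over the Poisson numbers of candidates and tests. A positive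
shift keeps the quotient away from \<open>0 / 0\<close> at candidates that fit the data exactly.\<close>

lemma E_W_act_eq:
  fixes y :: "real ^ 'j::finite"
  assumes \<mu>: "prob_space \<mu>" and p: "p \<in> borel_measurable \<mu>"
    and x: "\<And>q j. q \<in> space \<mu> \<Longrightarrow> p q $ j \<in> {0..1}" and y: "\<And>j. y $ j \<in> {0..1}"
    and n: "n \<ge> 2" and a: "a > 0" and \<gamma>: "\<gamma> > 0" and b: "bern_b_tot n y > 0"
  shows "E_W_act \<mu> p \<gamma> a n y = \<gamma> * exp (a * bern_b_tot n y)
     * (\<integral> q. mean_coins_tot n y (p q) * tests_per_label a n y (p q) \<partial>\<mu>)"
proof -
  define \<Lambda> where "\<Lambda> = \<gamma> * exp (a * bern_b_tot n y)"
  let ?X = "\<integral>\<^sup>+ q. \<integral>\<^sup>+ z. of_nat (snd z) \<partial>candidate a n y (p q) \<partial>\<mu>"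
  let ?h = "\<lambda>q. mean_coins_tot n y (p q) * tests_per_label a n y (p q)"
  have \<Lambda>: "0 < \<Lambda>" using \<gamma> by (simp add: \<Lambda>_def)
  have coins: "coins_of_candidates \<mu> p a n y m \<in> space (prob_algebra (count_space UNIV))" for m
    using \<mu> p by (rule coins_of_candidates_in_prob_algebra)
  have W: "W_act_law \<mu> p \<gamma> a n y \<in> space (prob_algebra (count_space UNIV))"
    unfolding W_act_law_def by (rule bind_in_prob_algebra[OF measure_pmf_in_prob_algebra]) (simp add: coins)
  have "(\<lambda>m. real (Suc m) * \<Lambda> ^ Suc m / fact (Suc m)) sums (\<Lambda> * exp \<Lambda>)"
  proof -
    have "real (Suc m) * \<Lambda> ^ Suc m / fact (Suc m) = \<Lambda> * (\<Lambda> ^ m / fact m)" for m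
      by (simp add: field_simps del: of_nat_Suc)
    then show ?thesis using sums_mult[OF exp_sums[of \<Lambda>], of \<Lambda>] by simp
  qed
  then have "(\<lambda>m. real m * \<Lambda> ^ m / fact m) sums (\<Lambda> * exp \<Lambda>)"
    by (subst (asm) sums_Suc_iff) simp
  then have "(\<integral>\<^sup>+ m. ennreal (real m) \<partial>poisson_pmf \<Lambda>) = ennreal (exp (- \<Lambda>) * (\<Lambda> * exp \<Lambda>))"
    using \<Lambda> by (intro nn_integral_poisson_sums) auto
  then have mean: "(\<integral>\<^sup>+ m. of_nat m \<partial>poisson_pmf \<Lambda>) = ennreal \<Lambda>"
    by (simp add: mult.left_commute[of _ \<Lambda>] ennreal_of_nat_eq_real_of_nat flip: exp_add)
  have [measurable_cong]: "sets (W_act_law \<mu> p \<gamma> a n y) = sets (count_space UNIV)"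
    using W by (simp add: space_prob_algebra)
  have "E_W_act \<mu> p \<gamma> a n y = enn2real (\<integral>\<^sup>+ w. of_nat w \<partial>W_act_law \<mu> p \<gamma> a n y)"
    unfolding E_W_act_def by (subst integral_eq_nn_integral) (auto simp flip: ennreal_of_nat_eq_real_of_nat)
  also have "(\<integral>\<^sup>+ w. of_nat w \<partial>W_act_law \<mu> p \<gamma> a n y) = (\<integral>\<^sup>+ m. of_nat m * ?X \<partial>poisson_pmf \<Lambda>)"
    unfolding W_act_law_def \<Lambda>_def[symmetric]
    by (simp add: nn_integral_bind_count_space[OF measure_pmf_in_prob_algebra] coins coins_of_candidates_length[OF \<mu> p])
  also have "\<dots> = ennreal \<Lambda> * ?X" by (simp add: nn_integral_multc mean)
  also have "?X = (\<integral>\<^sup>+ q. ennreal (?h q) \<partial>\<mu>)"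
    by (intro nn_integral_cong candidate_length[OF y x n a b, folded tests_per_label_def])
  also have "enn2real (ennreal \<Lambda> * (\<integral>\<^sup>+ q. ennreal (?h q) \<partial>\<mu>)) = \<Lambda> * integral\<^sup>L \<mu> ?h"
  proof -
    have "0 \<le> ?h q" if "q \<in> space \<mu>" for q
      using mean_coins_tot_nonneg[OF x[OF that], of n y] misfit_nonneg[of y "p q"] a b
      by (auto simp: tests_per_label_def)
    then have "integral\<^sup>L \<mu> ?h = enn2real (\<integral>\<^sup>+ q. ennreal (?h q) \<partial>\<mu>)"
      using p by (intro integral_eq_nn_integral) (auto intro: AE_I2)
    then show ?thesis using \<Lambda> by (simp add: enn2real_mult)
  qed
  finally show ?thesis by (simp add: \<Lambda>_def)
qed

section \<open>Coefficient windows and real intervals\<close>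

text \<open>This comparison is applied both to two intervals and to a discrete window and an interval.\<close>

lemma Sup_minus_Inf_close:
  fixes A B :: "real set"
  assumes "A \<noteq> {}" "B \<noteq> {}" "bdd_above A" "bdd_above B" "bdd_below A" "bdd_below B"
    and AB: "\<And>a. a \<in> A \<Longrightarrow> \<exists>b\<in>B. \<bar>a - b\<bar> \<le> e" and BA: "\<And>b. b \<in> B \<Longrightarrow> \<exists>a\<in>A. \<bar>a - b\<bar> \<le> e"
  shows "\<bar>(Sup A - Inf A) - (Sup B - Inf B)\<bar> \<le> 2 * e"
proof -
  have "Sup A \<le> Sup B + e"
  proof (rule cSup_least[OF assms(1)])
    fix a assume "a \<in> A"
    with AB obtain b where "b \<in> B" "\<bar>a - b\<bar> \<le> e" by blast
    with cSup_upper[OF this(1) assms(4)] show "a \<le> Sup B + e" by linarith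
  qed
  moreover have "Sup B \<le> Sup A + e"
  proof (rule cSup_least[OF assms(2)])
    fix b assume "b \<in> B"
    with BA obtain a where "a \<in> A" "\<bar>a - b\<bar> \<le> e" by blast
    with cSup_upper[OF this(1) assms(3)] show "b \<le> Sup A + e" by linarith
  qed
  moreover have "Inf B - e \<le> Inf A"
  proof (rule cInf_greatest[OF assms(1)])
    fix a assume "a \<in> A"
    with AB obtain b where "b \<in> B" "\<bar>a - b\<bar> \<le> e" by blast
    with cInf_lower[OF this(1) assms(6)] show "Inf B - e \<le> a" by linarith
  qed
  moreover have "Inf A - e \<le> Inf B"
  proof (rule cInf_greatest[OF assms(2)])
    fix b assume "b \<in> B"
    with BA obtain a where "a \<in> A" "\<bar>a - b\<bar> \<le> e" by blast
    with cInf_lower[OF this(1) assms(5)] show "Inf A - e \<le> b" by linarith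
  qed
  ultimately show ?thesis by linarith
qed

text \<open>The oscillation of the squared distance to \<open>y\<close> over an interval, which is the integrand of \<^const>\<open>kappa\<close>.\<close>

definition sq_osc :: "real \<Rightarrow> real \<Rightarrow> real \<Rightarrow> real" where
  "sq_osc y u w = (SUP z\<in>{u..w}. (z - y)\<^sup>2) - (INF z\<in>{u..w}. (z - y)\<^sup>2)"

lemma bdd_sq_image:
  fixes y u w :: real
  shows "bdd_above ((\<lambda>z. (z - y)\<^sup>2) ` {u..w})" "bdd_below ((\<lambda>z. (z - y)\<^sup>2) ` {u..w})"
proof -
  have "compact ((\<lambda>z. (z - y)\<^sup>2) ` {u..w})"
    by (intro compact_continuous_image continuous_intros) auto
  then show "bdd_above ((\<lambda>z. (z - y)\<^sup>2) ` {u..w})" "bdd_below ((\<lambda>z. (z - y)\<^sup>2) ` {u..w})"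
    by (auto dest!: compact_imp_bounded intro: bounded_imp_bdd_above bounded_imp_bdd_below)
qed

lemma sq_diff_le:
  fixes y z z' :: real
  assumes "y \<in> {0..1}" "z \<in> {0..1}" "z' \<in> {0..1}"
  shows "\<bar>(z - y)\<^sup>2 - (z' - y)\<^sup>2\<bar> \<le> 2 * \<bar>z - z'\<bar>"
proof -
  have "(z - y)\<^sup>2 - (z' - y)\<^sup>2 = (z + z' - 2 * y) * (z - z')"
    by (simp add: power2_eq_square algebra_simps)
  moreover have "\<bar>z + z' - 2 * y\<bar> \<le> 2" using assms by auto
  ultimately show ?thesis by (simp add: abs_mult mult_right_mono)
qed

lemma sq_osc_close:
  assumes y: "y \<in> {0..1}" and "0 \<le> u" "u \<le> w" "w \<le> 1" "0 \<le> u'" "u' \<le> w'" "w' \<le> 1"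
    and "\<bar>u - u'\<bar> \<le> d" "\<bar>w - w'\<bar> \<le> d"
  shows "\<bar>sq_osc y u w - sq_osc y u' w'\<bar> \<le> 4 * d"
proof -
  have close: "\<exists>b\<in>(\<lambda>z. (z - y)\<^sup>2) ` {u'..w'}. \<bar>a - b\<bar> \<le> 2 * d"
    if uw: "0 \<le> u" "u \<le> w" "w \<le> 1" "0 \<le> u'" "u' \<le> w'" "w' \<le> 1" "\<bar>u - u'\<bar> \<le> d" "\<bar>w - w'\<bar> \<le> d"
      and a: "a \<in> (\<lambda>z. (z - y)\<^sup>2) ` {u..w}" for u w u' w' a
  proof -
    from a obtain z where z: "z \<in> {u..w}" "a = (z - y)\<^sup>2" by auto
    \<comment> \<open>The nearest point of the other interval moves by no more than its end points do.\<close>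
    define z' where "z' = max u' (min w' z)"
    have z': "z' \<in> {u'..w'}" "\<bar>z - z'\<bar> \<le> d" using uw z by (auto simp: z'_def)
    then have "\<bar>a - (z' - y)\<^sup>2\<bar> \<le> 2 * d"
      using sq_diff_le[OF y, of z z'] uw z by auto
    then show ?thesis using z' by blast
  qed
  have "\<bar>sq_osc y u w - sq_osc y u' w'\<bar> \<le> 2 * (2 * d)"
    unfolding sq_osc_def
  proof (rule Sup_minus_Inf_close)
    fix b assume "b \<in> (\<lambda>z. (z - y)\<^sup>2) ` {u'..w'}"
    then have "\<exists>a\<in>(\<lambda>z. (z - y)\<^sup>2) ` {u..w}. \<bar>b - a\<bar> \<le> 2 * d"
      using assms by (intro close[of u' w' u w]) (auto simp: abs_minus_commute)
    then show "\<exists>a\<in>(\<lambda>z. (z - y)\<^sup>2) ` {u..w}. \<bar>a - b\<bar> \<le> 2 * d"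
      by (simp add: abs_minus_commute)
  qed (use assms close in \<open>auto intro: bdd_sq_image\<close>)
  then show ?thesis by simp
qed

text \<open>The coefficient is the squared distance lowered by a variance term of order \<open>1 / n\<close>. The first part gives the
limit of the windows, the second the size of the shift.\<close>

lemma bern_beta_eq:
  assumes "n \<ge> 2"
  shows "bern_beta k n y = (real k / n - y)\<^sup>2 - (real k / n) * (1 - real k / n) / (real n - 1)"
proof -
  define m where "m = real n"
  have "m \<noteq> 0" "m - 1 \<noteq> 0" using assms by (auto simp: m_def)
  then show ?thesis unfolding bern_beta_def m_def[symmetric]
    by (simp add: divide_simps) (simp add: algebra_simps power2_eq_square)
qed

lemma bern_beta_close:
  assumes "n \<ge> 2" "k \<le> n"
  shows "\<bar>bern_beta k n y - (real k / n - y)\<^sup>2\<bar> \<le> 1 / n"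
proof -
  define t where "t = real k / n"
  have t: "t \<in> {0..1}" using assms by (auto simp: t_def)
  have "t * (1 - t) = 1/4 - (t - 1/2)\<^sup>2" by (simp add: power2_eq_square algebra_simps)
  then have "t * (1 - t) \<le> 1/2" using zero_le_power2[of "t - 1/2"] by linarith
  then have "t * (1 - t) / (real n - 1) \<le> (1/2) / (real n - 1)"
    using assms by (intro divide_right_mono) auto
  also have "\<dots> \<le> (1/2) / (real n / 2)" using assms by (intro divide_left_mono) auto
  finally have "t * (1 - t) / (real n - 1) \<le> 1 / n" by simp
  moreover have "0 \<le> t * (1 - t) / (real n - 1)" using t assms by auto
  ultimately show ?thesis unfolding bern_beta_eq[OF assms(1)] t_def[symmetric] by linarith
qed

text \<open>Three errors add up: the coefficients differ from the squared distance by at most \<open>1 / n\<close>, the grid has mesh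
\<open>1 / n\<close>, and the end points differ by at most \<open>d\<close>; the squared distance is 2-Lipschitz on the unit interval.\<close>

lemma window_osc_close:
  assumes y: "y \<in> {0..1}" and n: "n \<ge> 2" and kl: "k + l \<le> n" and uw: "0 \<le> u" "u \<le> w" "w \<le> 1"
    and d: "\<bar>real k / n - u\<bar> \<le> d" "\<bar>real (k + l) / n - w\<bar> \<le> d"
  shows "\<bar>window_osc (\<lambda>i. bern_beta i n y) l k - sq_osc y u w\<bar> \<le> 4 * d + 6 / n"
proof -
  let ?A = "(\<lambda>i. bern_beta i n y) ` {k..k + l}" and ?B = "(\<lambda>z. (z - y)\<^sup>2) ` {u..w}"
  have n0: "real n > 0" using n by simp
  have "\<bar>(Sup ?A - Inf ?A) - (Sup ?B - Inf ?B)\<bar> \<le> 2 * (2 * d + 3 / n)"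
  proof (rule Sup_minus_Inf_close)
    fix a assume "a \<in> ?A"
    then obtain i where i: "i \<in> {k..k + l}" "a = bern_beta i n y" by auto
    define z where "z = max u (min w (real i / n))"
    have in_window: "real k / n \<le> real i / n" "real i / n \<le> real (k + l) / n" "real i / n \<le> 1"
      using i kl n0 by (auto intro: divide_right_mono)
    have z: "z \<in> {u..w}" "\<bar>real i / n - z\<bar> \<le> d"
      using uw d in_window unfolding z_def by auto
    have "\<bar>(real i / n - y)\<^sup>2 - (z - y)\<^sup>2\<bar> \<le> 2 * d"
      using sq_diff_le[OF y, of "real i / n" z] uw z in_window by auto
    moreover have "\<bar>a - (real i / n - y)\<^sup>2\<bar> \<le> 1 / n"
      using bern_beta_close[OF n, of i y] i kl by auto
    moreover have "1 / n \<le> 3 / real n" using n0 by (simp add: divide_simps)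
    ultimately have "\<bar>a - (z - y)\<^sup>2\<bar> \<le> 2 * d + 3 / n" by linarith
    then show "\<exists>b\<in>?B. \<bar>a - b\<bar> \<le> 2 * d + 3 / n" using z by blast
  next
    fix b assume "b \<in> ?B"
    then obtain z where z: "z \<in> {u..w}" "b = (z - y)\<^sup>2" by auto
    define z' where "z' = max (real k / n) (min (real (k + l) / n) z)"
    define i where "i = nat \<lfloor>n * z'\<rfloor>"
    have kln: "real k / n \<le> real (k + l) / n" "0 \<le> real k / n" "real (k + l) / n \<le> 1"
      using n0 kl by (auto simp: divide_right_mono)
    have z': "real k / n \<le> z'" "z' \<le> real (k + l) / n" "\<bar>z' - z\<bar> \<le> d"
      using kln d z uw unfolding z'_def by auto
    then have nz: "real k \<le> n * z'" "n * z' \<le> real (k + l)"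
      using n0 by (auto simp: field_simps)
    have i_eq: "real i = of_int \<lfloor>n * z'\<rfloor>" using nz by (simp add: i_def)
    have i: "i \<in> {k..k + l}"
    proof -
      have "int k \<le> \<lfloor>n * z'\<rfloor>" using nz by (simp add: le_floor_iff)
      moreover have "\<lfloor>n * z'\<rfloor> \<le> int (k + l)" using nz by (simp add: floor_le_iff)
      ultimately show ?thesis by (auto simp: i_def)
    qed
    have "\<bar>real i - n * z'\<bar> \<le> 1" unfolding i_eq by linarith
    then have "\<bar>real i / n - z'\<bar> \<le> 1 / n" using n0 by (simp add: abs_le_iff field_simps)
    then have "\<bar>real i / n - z\<bar> \<le> d + 1 / n" using z' by linarith
    then have "\<bar>(real i / n - y)\<^sup>2 - (z - y)\<^sup>2\<bar> \<le> 2 * (d + 1 / n)"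
      using sq_diff_le[OF y, of "real i / n" z] i kl n0 z uw by auto
    moreover have "\<bar>bern_beta i n y - (real i / n - y)\<^sup>2\<bar> \<le> 1 / n"
      using bern_beta_close[OF n, of i y] i kl by auto
    ultimately have "\<bar>bern_beta i n y - b\<bar> \<le> 2 * d + 3 / n" unfolding z by (simp add: abs_le_iff)
    then show "\<exists>a\<in>?A. \<bar>a - b\<bar> \<le> 2 * d + 3 / n" using i by blast
  qed (use uw bdd_sq_image in auto)
  moreover have "Sup ?A = Max ?A" "Inf ?A = Min ?A"
    by (auto intro!: cSup_eq_Max cInf_eq_Min)
  ultimately show ?thesis by (simp add: window_osc_def sq_osc_def)
qed

lemma coin_mean_variance:
  "coin_mean x s (\<lambda>i. (real i - real s * x)\<^sup>2) 0 = real s * x * (1 - x)"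
proof -
  have "(\<lambda>i. (real i - real s * x)\<^sup>2)
      = (\<lambda>i. real i * (real i - 1) + ((1 - 2 * real s * x) * real i + (real s * x)\<^sup>2))"
    by (simp add: fun_eq_iff power2_eq_square algebra_simps)
  then show ?thesis
    by (simp only: coin_mean_add coin_mean_cmult coin_mean_const coin_mean_linear coin_mean_falling)
       (simp add: power2_eq_square algebra_simps)
qed

lemma coin_mean_abs_le:
  assumes "x \<in> {0..1}" and "\<And>i. i \<in> {k..k + s} \<Longrightarrow> \<bar>f i - c\<bar> \<le> h i"
  shows "\<bar>coin_mean x s f k - c\<bar> \<le> coin_mean x s h k"
proof -
  have "coin_mean x s f k \<le> coin_mean x s (\<lambda>i. c + h i) k"
    by (rule coin_mean_mono[OF assms(1)]) (use assms(2) in fastforce)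
  moreover have "coin_mean x s (\<lambda>i. c + - 1 * h i) k \<le> coin_mean x s f k"
    by (rule coin_mean_mono[OF assms(1)]) (use assms(2) in fastforce)
  ultimately show ?thesis unfolding coin_mean_add coin_mean_cmult coin_mean_const by linarith
qed

text \<open>Both end points of the window after \<open>s\<close> coins deviate from those of the limiting interval by the same fluctuation
of the success count, whose variance is at most \<open>n\<close>.\<close>

lemma coin_mean_window_osc:
  assumes y: "y \<in> {0..1}" and x: "x \<in> {0..1}" and n: "n \<ge> 2" and s: "s \<le> n"
  shows "\<bar>coin_mean x s (window_osc (\<lambda>i. bern_beta i n y) (n - s)) 0
      - sq_osc y (real s / n * x) (real s / n * x + 1 - real s / n)\<bar> \<le> 10 / sqrt n"
proof -
  define r where "r = sqrt (real n)"
  have r: "r > 0" "real n = r\<^sup>2" "r \<ge> 1" using n by (auto simp: r_def)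
  define t where "t = real s / n"
  have t: "t \<in> {0..1}" using n s by (auto simp: t_def)
  define m where "m = real s * x"
  have "\<bar>coin_mean x s (window_osc (\<lambda>i. bern_beta i n y) (n - s)) 0 - sq_osc y (t * x) (t * x + 1 - t)\<bar>
     \<le> coin_mean x s (\<lambda>i. 2 / r ^ 3 * (real i - real s * x)\<^sup>2 + (2 / r + 6 / r\<^sup>2)) 0"
  proof (rule coin_mean_abs_le[OF x])
    fix i assume i: "i \<in> {0..0 + s}"
    define D where "D = \<bar>real i - m\<bar>"
    have D: "real i / n - t * x = (real i - m) / n" "real (i + (n - s)) / n - (t * x + 1 - t) = (real i - m) / n"
      using n s by (simp_all add: t_def m_def divide_simps)
    have d: "\<bar>real i / n - t * x\<bar> \<le> D / n" "\<bar>real (i + (n - s)) / n - (t * x + 1 - t)\<bar> \<le> D / n"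
      unfolding D D_def by (simp_all only: abs_divide abs_of_nat order.refl)
    have "t * x \<le> t" using t x by (intro mult_left_le) auto
    then have tx: "0 \<le> t * x" "t * x \<le> t * x + 1 - t" "t * x + 1 - t \<le> 1"
      using t x by simp_all
    have "i + (n - s) \<le> n" using i s by simp
    from window_osc_close[OF y n this tx d]
    have "\<bar>window_osc (\<lambda>i. bern_beta i n y) (n - s) i - sq_osc y (t * x) (t * x + 1 - t)\<bar>
        \<le> 4 * (D / n) + 6 / n" .
    moreover have "4 * (D / n) \<le> 2 / r ^ 3 * D\<^sup>2 + 2 / r"
    proof -
      \<comment> \<open>The fluctuation \<open>D\<close> is typically of size \<open>r = sqrt n\<close>; this square trades it for its variance.\<close>
      have "0 \<le> 2 / r ^ 3 * (D - r)\<^sup>2" using r by simp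
      also have "\<dots> = 2 / r ^ 3 * D\<^sup>2 + 2 / r - 4 * (D / n)"
        using r by (simp add: power2_eq_square power3_eq_cube divide_simps) (simp add: algebra_simps)
      finally show ?thesis by simp
    qed
    ultimately show "\<bar>window_osc (\<lambda>i. bern_beta i n y) (n - s) i - sq_osc y (t * x) (t * x + 1 - t)\<bar>
        \<le> 2 / r ^ 3 * (real i - real s * x)\<^sup>2 + (2 / r + 6 / r\<^sup>2)"
      using r by (simp add: D_def m_def)
  qed
  also have "\<dots> = 2 / r ^ 3 * (real s * x * (1 - x)) + (2 / r + 6 / r\<^sup>2)"
    by (simp only: coin_mean_add coin_mean_cmult coin_mean_const coin_mean_variance)
  also have "\<dots> \<le> 10 / r"
  proof -
    have "x * (1 - x) \<le> 1" using x by (auto intro: mult_le_one)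
    then have "real s * (x * (1 - x)) \<le> real s * 1" by (intro mult_left_mono) auto
    also have "\<dots> \<le> r\<^sup>2" using s by (simp flip: r(2))
    finally have "2 / r ^ 3 * (real s * x * (1 - x)) \<le> 2 / r ^ 3 * r\<^sup>2"
      using r(1) by (intro mult_left_mono) (auto simp: mult.assoc)
    moreover have "2 / r ^ 3 * r\<^sup>2 = 2 / r" using r(1) by (simp add: power2_eq_square power3_eq_cube)
    moreover have "6 / r\<^sup>2 \<le> 6 / r" using r(1,3) by (auto simp: divide_simps power2_eq_square)
    moreover have "2 / r + (2 / r + 6 / r) = 10 / r" by (simp add: add_divide_distrib[symmetric])
    ultimately show ?thesis by linarith
  qed
  finally show ?thesis unfolding t_def r_def .
qed

section \<open>The mean length of an event to first order\<close>

lemma Riemann_sum_Lipschitz: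
  fixes g :: "real \<Rightarrow> real"
  assumes lip: "\<And>s t. s \<in> {0..1} \<Longrightarrow> t \<in> {0..1} \<Longrightarrow> \<bar>g s - g t\<bar> \<le> L * \<bar>s - t\<bar>" and n: "n \<ge> 1"
  shows "\<bar>(\<Sum>s<n. g (real s / n)) / n - integral {0..1} g\<bar> \<le> L / n"
proof -
  have cont: "continuous_on {0..1} g"
  proof (rule continuous_onI)
    fix s e :: real assume "s \<in> {0..1}" "e > 0"
    have "dist (g t) (g s) \<le> e" if "t \<in> {0..1}" "dist t s < e / (\<bar>L\<bar> + 1)" for t
    proof -
      have "\<bar>g t - g s\<bar> \<le> L * \<bar>t - s\<bar>" using that \<open>s \<in> _\<close> by (intro lip)
      also have "\<dots> \<le> (\<bar>L\<bar> + 1) * \<bar>t - s\<bar>" by (intro mult_right_mono) auto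
      also have "\<dots> \<le> e" using that by (simp add: dist_real_def field_simps)
      finally show ?thesis by (simp add: dist_real_def)
    qed
    then show "\<exists>d>0. \<forall>t\<in>{0..1}. dist t s < d \<longrightarrow> dist (g t) (g s) \<le> e"
      using \<open>e > 0\<close> by (intro exI[of _ "e / (\<bar>L\<bar> + 1)"]) auto
  qed
  have integrable: "g integrable_on {u..w}" if "0 \<le> u" "w \<le> 1" for u w
    using that by (intro integrable_continuous_real continuous_on_subset[OF cont]) auto
  have "\<bar>(\<Sum>s<m. g (real s / n)) / n - integral {0..real m / n} g\<bar> \<le> real m * (L / n\<^sup>2)" if "m \<le> n" for m
    using that
  proof (induction m)
    case (Suc m)
    let ?u = "real m / n" and ?w = "real (Suc m) / n"
    have uw: "0 \<le> ?u" "?u \<le> ?w" "?w \<le> 1" "?w - ?u = 1 / n"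
      using Suc.prems n by (auto simp: divide_simps)
    have L: "0 \<le> L" using lip[of 0 1] by simp
    have split: "integral {0..?w} g = integral {0..?u} g + integral {?u..?w} g"
      using uw by (intro Henstock_Kurzweil_Integration.integral_combine[symmetric] integrable) auto
    have "\<bar>integral {?u..?w} g - g ?u / n\<bar> = \<bar>integral {?u..?w} (\<lambda>t. g t - g ?u)\<bar>"
      using uw by (subst integral_diff) (auto intro!: integrable)
    also have "\<dots> \<le> (L / n) * (?w - ?u)"
    proof -
      have "norm (integral {?u..?w} (\<lambda>t. g t - g ?u)) \<le> (L / n) * (?w - ?u)"
      proof (rule integral_bound)
        show "continuous_on {?u..?w} (\<lambda>t. g t - g ?u)"
          using uw by (intro continuous_intros continuous_on_subset[OF cont]) auto
        fix t assume t: "t \<in> {?u..?w}"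
        then have "t \<in> {0..1}" using uw order.trans[OF uw(1), of t] by auto
        then have "\<bar>g t - g ?u\<bar> \<le> L * \<bar>t - ?u\<bar>" using uw by (intro lip) auto
        also have "\<dots> \<le> L * (1 / n)" using t uw L by (intro mult_left_mono) auto
        finally show "norm (g t - g ?u) \<le> L / n" by simp
      qed (use uw in auto)
      then show ?thesis by simp
    qed
    also have "\<dots> = L / n\<^sup>2" using uw by (simp add: power2_eq_square)
    finally have "\<bar>integral {?u..?w} g - g ?u / n\<bar> \<le> L / n\<^sup>2" .
    moreover have "real (Suc m) * (L / n\<^sup>2) = real m * (L / n\<^sup>2) + L / n\<^sup>2" by (simp add: algebra_simps add_divide_distrib)
    moreover have "(\<Sum>s<Suc m. g (real s / n)) / n = (\<Sum>s<m. g (real s / n)) / n + g ?u / n"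
      by (simp add: add_divide_distrib)
    ultimately show ?case using Suc.IH Suc.prems split by linarith
  qed simp
  from this[of n] show ?thesis using n by (simp add: power2_eq_square)
qed

lemma kappa_integrand_Lipschitz:
  assumes y: "y \<in> {0..1}" and "x \<in> {0..1}" "x' \<in> {0..1}" "s \<in> {0..1}" "t \<in> {0..1}"
  shows "\<bar>sq_osc y (s * x) (s * x + 1 - s) - sq_osc y (t * x) (t * x + 1 - t)\<bar> \<le> 4 * \<bar>s - t\<bar>"
    and "\<bar>sq_osc y (t * x) (t * x + 1 - t) - sq_osc y (t * x') (t * x' + 1 - t)\<bar> \<le> 4 * \<bar>x - x'\<bar>"
proof -
  have r: "0 \<le> s * x" "s * x \<le> s * x + 1 - s" "s * x + 1 - s \<le> 1" if "x \<in> {0..1}" "s \<in> {0..1}" for s x :: real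
    using that mult_left_mono[of x 1 s] by (auto simp: )
  have "\<bar>s * x - t * x\<bar> = \<bar>s - t\<bar> * x"
    using assms by (simp add: abs_mult left_diff_distrib[symmetric])
  then have 1: "\<bar>s * x - t * x\<bar> \<le> \<bar>s - t\<bar>" using assms by (simp add: mult_right_le_one_le)
  have "\<bar>(s * x + 1 - s) - (t * x + 1 - t)\<bar> = \<bar>s - t\<bar> * (1 - x)"
  proof -
    have "(s * x + 1 - s) - (t * x + 1 - t) = (t - s) * (1 - x)" by (simp add: algebra_simps)
    then show ?thesis using assms by (simp add: abs_mult abs_minus_commute)
  qed
  then have 2: "\<bar>(s * x + 1 - s) - (t * x + 1 - t)\<bar> \<le> \<bar>s - t\<bar>"
    using assms by (simp add: mult_right_le_one_le)
  show "\<bar>sq_osc y (s * x) (s * x + 1 - s) - sq_osc y (t * x) (t * x + 1 - t)\<bar> \<le> 4 * \<bar>s - t\<bar>"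
    using assms by (intro sq_osc_close y r 1 2)
  have "\<bar>t * x - t * x'\<bar> = t * \<bar>x - x'\<bar>"
    using assms by (simp add: abs_mult right_diff_distrib[symmetric])
  then have 3: "\<bar>t * x - t * x'\<bar> \<le> \<bar>x - x'\<bar>" using assms by (simp add: mult_left_le_one_le)
  then have 4: "\<bar>(t * x + 1 - t) - (t * x' + 1 - t)\<bar> \<le> \<bar>x - x'\<bar>" by simp
  show "\<bar>sq_osc y (t * x) (t * x + 1 - t) - sq_osc y (t * x') (t * x' + 1 - t)\<bar> \<le> 4 * \<bar>x - x'\<bar>"
    using assms by (intro sq_osc_close y r 3 4)
qed

lemma kappa_integrand_continuous:
  assumes "y \<in> {0..1}" "x \<in> {0..1}"
  shows "continuous_on {0..1} (\<lambda>t. sq_osc y (t * x) (t * x + 1 - t))"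
proof -
  have "4-lipschitz_on {0..1} (\<lambda>t. sq_osc y (t * x) (t * x + 1 - t))"
    using kappa_integrand_Lipschitz(1)[OF assms assms(2)]
    by (intro lipschitz_onI) (auto simp: dist_real_def)
  then show ?thesis by (rule lipschitz_on_continuous_on)
qed

lemma kappa_eq_integral:
  assumes "y \<in> {0..1}" "x \<in> {0..1}"
  shows "kappa y x = integral {0..1} (\<lambda>t. sq_osc y (t * x) (t * x + 1 - t))"
  unfolding kappa_def sq_osc_def[symmetric]
  by (rule set_borel_integral_eq_integral(2), rule borel_integrable_atLeastAtMost')
     (rule kappa_integrand_continuous[OF assms])

lemma kappa_Lipschitz:
  assumes "y \<in> {0..1}" "x \<in> {0..1}" "x' \<in> {0..1}"
  shows "\<bar>kappa y x - kappa y x'\<bar> \<le> 4 * \<bar>x - x'\<bar>"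
proof -
  let ?g = "\<lambda>x t. sq_osc y (t * x) (t * x + 1 - t)"
  have "norm (integral {0..1} (\<lambda>t. ?g x t - ?g x' t)) \<le> 4 * \<bar>x - x'\<bar> * (1 - 0)"
    using assms kappa_integrand_Lipschitz(2)[OF assms, of 0]
    by (intro integral_bound continuous_intros kappa_integrand_continuous) auto
  then show ?thesis
    using assms by (simp add: kappa_eq_integral integral_diff
        integrable_continuous_real kappa_integrand_continuous)
qed

lemma sq_osc_nonneg: "u \<le> w \<Longrightarrow> 0 \<le> sq_osc y u w"
  using cInf_le_cSup[OF _ bdd_sq_image[of y u w]] by (simp add: sq_osc_def)

lemma sq_osc_le:
  assumes "y \<in> {0..1}" "0 \<le> u" "u \<le> w" "w \<le> 1"
  shows "sq_osc y u w \<le> 4"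
proof -
  have "\<bar>sq_osc y u w - sq_osc y u u\<bar> \<le> 4 * 1"
    using assms by (intro sq_osc_close) auto
  then show ?thesis by (simp add: sq_osc_def)
qed

lemma kappa_le:
  assumes "y \<in> {0..1}" "x \<in> {0..1}"
  shows "kappa y x \<le> 4"
proof -
  have "norm (integral {0..1} (\<lambda>t. sq_osc y (t * x) (t * x + 1 - t))) \<le> 4 * (1 - 0)"
  proof (rule integral_bound)
    fix t :: real assume t: "t \<in> {0..1}"
    then have "t * x \<le> t" "0 \<le> t * x" using assms by (auto intro: mult_right_le_one_le)
    then show "norm (sq_osc y (t * x) (t * x + 1 - t)) \<le> 4"
      using t assms sq_osc_le[of y "t * x" "t * x + 1 - t"] sq_osc_nonneg[of "t * x" "t * x + 1 - t" y] by auto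
  qed (use kappa_integrand_continuous[OF assms] in auto)
  then show ?thesis using assms by (simp add: kappa_eq_integral)
qed

text \<open>At \<open>t = 0\<close> the integrand is the oscillation over the whole unit interval, which is positive; by continuity so is
the integral.\<close>

lemma kappa_pos:
  assumes "y \<in> {0..1}" "x \<in> {0..1}"
  shows "0 < kappa y x"
proof -
  let ?g = "\<lambda>t. sq_osc y (t * x) (t * x + 1 - t)"
  have nn: "0 \<le> ?g t" if "t \<in> {0..1}" for t
    using that by (intro sq_osc_nonneg) auto
  have "0 \<le> integral {0..1} ?g" by (rule integral_nonneg)
    (auto intro!: integrable_continuous_real kappa_integrand_continuous assms nn)
  moreover have "integral {0..1} ?g \<noteq> 0"
  proof
    assume "integral {0..1} ?g = 0"
    then have "\<forall>t\<in>{0..1}. ?g t = 0"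
      using integral_eq_0_iff[of 0 1 ?g] kappa_integrand_continuous[OF assms] nn by auto
    from bspec[OF this, of 0] have "(SUP z\<in>{0..1}. (z - y)\<^sup>2) = (INF z\<in>{0..1}. (z - y)\<^sup>2)"
      by (simp add: sq_osc_def)
    moreover have "(INF z\<in>{0..1}. (z - y)\<^sup>2) \<le> 0"
      using assms cINF_lower[OF bdd_sq_image(2)[of y 0 1], of y] by simp
    moreover have "(0 - y)\<^sup>2 \<le> (SUP z\<in>{0..1}. (z - y)\<^sup>2)" "(1 - y)\<^sup>2 \<le> (SUP z\<in>{0..1}. (z - y)\<^sup>2)"
      by (intro cSUP_upper bdd_sq_image; simp)+
    ultimately have "(0 - y)\<^sup>2 \<le> 0" "(1 - y)\<^sup>2 \<le> 0" by linarith+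
    then show False by simp
  qed
  ultimately show ?thesis using assms by (simp add: kappa_eq_integral)
qed

lemma mean_coins_close:
  assumes y: "y \<in> {0..1}" and x: "x \<in> {0..1}" and n: "n \<ge> 2"
  shows "\<bar>mean_coins n y x / n - kappa y x\<bar> \<le> 14 / sqrt n"
proof -
  let ?g = "\<lambda>t. sq_osc y (t * x) (t * x + 1 - t)"
  let ?m = "\<lambda>s. coin_mean x s (window_osc (\<lambda>i. bern_beta i n y) (n - s)) 0"
  have triangle: "\<bar>a - b\<bar> \<le> d \<Longrightarrow> \<bar>b - c\<bar> \<le> e \<Longrightarrow> e \<le> e' \<Longrightarrow> \<bar>a - c\<bar> \<le> d + e'"
    for a b c d e e' :: real by linarith
  have n0: "real n > 0" using n by simp
  have "\<bar>(\<Sum>s<n. ?m s) - (\<Sum>s<n. ?g (real s / n))\<bar> \<le> (\<Sum>s<n. \<bar>?m s - ?g (real s / n)\<bar>)"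
    by (simp add: sum_subtractf[symmetric] sum_abs)
  also have "\<dots> \<le> (\<Sum>s<n. 10 / sqrt n)"
    by (intro sum_mono coin_mean_window_osc y x n) auto
  finally have "\<bar>(\<Sum>s<n. ?m s) - (\<Sum>s<n. ?g (real s / n))\<bar> \<le> n * (10 / sqrt n)" by simp
  then have "\<bar>(\<Sum>s<n. ?m s) - (\<Sum>s<n. ?g (real s / n))\<bar> / n \<le> n * (10 / sqrt n) / n"
    by (rule divide_right_mono) simp
  then have A: "\<bar>mean_coins n y x / n - (\<Sum>s<n. ?g (real s / n)) / n\<bar> \<le> 10 / sqrt n"
    using n0 by (simp add: mean_coins_def diff_divide_distrib[symmetric])
  have B: "\<bar>(\<Sum>s<n. ?g (real s / n)) / n - kappa y x\<bar> \<le> 4 / n"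
    unfolding kappa_eq_integral[OF y x]
    by (rule Riemann_sum_Lipschitz) (use kappa_integrand_Lipschitz(1)[OF y x x] n in auto)
  have C: "4 / real n \<le> 4 / sqrt n"
  proof -
    have "real n * 1 \<le> real n * real n" using n by (intro mult_left_mono) auto
    then have "sqrt n \<le> n" by (intro real_le_lsqrt) (auto simp: power2_eq_square)
    then show ?thesis using n0 by (intro divide_left_mono) auto
  qed
  have "10 / sqrt n + 4 / sqrt n = 14 / sqrt n" by (simp add: add_divide_distrib[symmetric])
  with triangle[OF A B C] show ?thesis by (simp only:)
qed

lemma mean_coins_tot_close:
  fixes y x :: "real ^ 'j::finite"
  assumes "\<And>j. y $ j \<in> {0..1}" "\<And>j. x $ j \<in> {0..1}" "n \<ge> 2"
  shows "\<bar>mean_coins_tot n y x / n - kappa_tot y x\<bar> \<le> CARD('j) * (14 / sqrt n)"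
proof -
  have "\<bar>mean_coins_tot n y x / n - kappa_tot y x\<bar>
      = \<bar>\<Sum>j\<in>UNIV. mean_coins n (y $ j) (x $ j) / n - kappa (y $ j) (x $ j)\<bar>"
    by (simp add: mean_coins_tot_def kappa_tot_def sum_divide_distrib sum_subtractf)
  also have "\<dots> \<le> (\<Sum>j\<in>UNIV. \<bar>mean_coins n (y $ j) (x $ j) / n - kappa (y $ j) (x $ j)\<bar>)"
    by (rule sum_abs)
  also have "\<dots> \<le> (\<Sum>j\<in>(UNIV :: 'j set). 14 / sqrt n)"
    by (intro sum_mono mean_coins_close assms)
  finally show ?thesis unfolding sum_constant .
qed

lemma kappa_tot_pos:
  fixes y x :: "real ^ 'j::finite"
  assumes "\<And>j. y $ j \<in> {0..1}" "\<And>j. x $ j \<in> {0..1}"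
  shows "0 < kappa_tot y x"
  unfolding kappa_tot_def using assms by (intro sum_pos kappa_pos) auto

lemma kappa_tot_le:
  fixes y x :: "real ^ 'j::finite"
  assumes "\<And>j. y $ j \<in> {0..1}" "\<And>j. x $ j \<in> {0..1}"
  shows "kappa_tot y x \<le> 4 * CARD('j)"
proof -
  have "kappa_tot y x \<le> (\<Sum>j\<in>(UNIV :: 'j set). 4)"
    unfolding kappa_tot_def using assms by (intro sum_mono kappa_le) auto
  then show ?thesis by simp
qed

text \<open>The cost constant is Lipschitz in the observables, and the distance to \<open>y\<close> in each component is at most the square
root of the misfit. This lets the constant be frozen at \<open>y\<close> when the misfit is small.\<close>

lemma kappa_tot_near:
  fixes y x :: "real ^ 'j::finite"
  assumes "\<And>j. y $ j \<in> {0..1}" "\<And>j. x $ j \<in> {0..1}"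
  shows "\<bar>kappa_tot y x - kappa_tot y y\<bar> \<le> 4 * CARD('j) * sqrt (misfit y x)"
proof -
  have "\<bar>kappa_tot y x - kappa_tot y y\<bar> \<le> (\<Sum>j\<in>UNIV. \<bar>kappa (y $ j) (x $ j) - kappa (y $ j) (y $ j)\<bar>)"
    unfolding kappa_tot_def by (simp add: sum_subtractf[symmetric] sum_abs)
  also have "\<dots> \<le> (\<Sum>j\<in>(UNIV :: 'j set). 4 * sqrt (misfit y x))"
  proof (rule sum_mono)
    fix j :: 'j
    have "(x $ j - y $ j)\<^sup>2 \<le> misfit y x"
      unfolding misfit_def by (rule member_le_sum) auto
    then have "\<bar>x $ j - y $ j\<bar> \<le> sqrt (misfit y x)"
      by (metis real_sqrt_abs real_sqrt_le_iff)
    then show "\<bar>kappa (y $ j) (x $ j) - kappa (y $ j) (y $ j)\<bar> \<le> 4 * sqrt (misfit y x)"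
      using kappa_Lipschitz[OF assms(1)[of j] assms(2)[of j] assms(1)[of j]] by simp
  qed
  finally show ?thesis by simp
qed

section \<open>The Bernstein shift\<close>

text \<open>Write the coefficient as \<open>d\<^sup>2 - z (1 - z) / (n - 1)\<close> with \<open>d\<close> the distance of \<open>z\<close> to \<open>y\<close>. As \<open>z (1 - z)\<close> is
1-Lipschitz, moving away from \<open>y\<close> gains at most \<open>d / (n - 1)\<close> and costs \<open>d\<^sup>2\<close>, which is worth at most
order \<open>1 / n\<^sup>2\<close>; the grid point below \<open>y\<close> shows that nothing of larger order is lost.\<close>

lemma bern_b_close:
  assumes y: "y \<in> {0..1}" and n: "n \<ge> 2"
  shows "\<bar>(real n - 1) * bern_b n y - y * (1 - y)\<bar> \<le> 2 / n"
proof -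
  define N where "N = real n - 1"
  have N: "N \<ge> 1" "real n = N + 1" using n by (auto simp: N_def)
  \<comment> \<open>Generic in \<open>A\<close> and \<open>B\<close>, so that the simplifier does not expand the products inside them.\<close>
  have clear: "N * - (A - B / N) = B - N * A" for A B using N by (simp add: right_diff_distrib)
  have concave: "\<bar>t * (1 - t) - y * (1 - y)\<bar> \<le> \<bar>t - y\<bar>" if "t \<in> {0..1}" for t
  proof -
    have "t * (1 - t) - y * (1 - y) = (t - y) * (1 - t - y)" by (simp add: algebra_simps)
    moreover have "\<bar>1 - t - y\<bar> \<le> 1" using that y by auto
    ultimately show ?thesis by (simp add: abs_mult mult_right_le_one_le)
  qed
  have "N * - bern_beta k n y \<le> y * (1 - y) + 2 / n" if "k \<le> n" for k
  proof -
    define t where "t = real k / n"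
    define d where "d = \<bar>t - y\<bar>"
    have t: "t \<in> {0..1}" using that n by (auto simp: t_def)
    have "N * - bern_beta k n y = t * (1 - t) - N * d\<^sup>2"
      unfolding bern_beta_eq[OF n] t_def[symmetric] N_def[symmetric] d_def clear by simp
    moreover have "t * (1 - t) \<le> y * (1 - y) + d" using concave[OF t] unfolding d_def by linarith
    moreover have "d - N * d\<^sup>2 \<le> 2 / n"
    proof -
      \<comment> \<open>Completing the square at the maximiser \<open>d = 1 / (2 N)\<close> of \<open>d - N d\<^sup>2\<close>.\<close>
      have "0 \<le> N * (d - 1 / (2 * N))\<^sup>2" using N by simp
      also have "\<dots> = N * d\<^sup>2 - d + 1 / (4 * N)" using N by (simp add: power2_eq_square field_simps)
      finally have "d - N * d\<^sup>2 \<le> 1 / (4 * N)" by simp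
      also have "\<dots> \<le> 2 / n" using N by (simp add: divide_simps)
      finally show ?thesis .
    qed
    ultimately show ?thesis by linarith
  qed
  moreover obtain k where "k \<in> {0..n}" "bern_b n y = - bern_beta k n y"
  proof -
    have "(MIN k\<in>{0..n}. bern_beta k n y) \<in> (\<lambda>k. bern_beta k n y) ` {0..n}" by (rule Min_in) auto
    then obtain k where "(MIN k\<in>{0..n}. bern_beta k n y) = bern_beta k n y" "k \<in> {0..n}"
      by (rule imageE)
    then show ?thesis using that unfolding bern_b_def by metis
  qed
  ultimately have upper: "N * bern_b n y \<le> y * (1 - y) + 2 / n" by force
  define k where "k = nat \<lfloor>n * y\<rfloor>"
  define t where "t = real k / n"
  have k_eq: "real k = of_int \<lfloor>n * y\<rfloor>" using y by (simp add: k_def)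
  have "real k \<le> n * y" "n * y \<le> real k + 1" unfolding k_eq by linarith+
  then have "\<bar>real k - n * y\<bar> / n \<le> 1 / n" by (intro divide_right_mono) auto
  moreover have "t - y = (real k - n * y) / n" using n by (simp add: t_def diff_divide_distrib)
  ultimately have d: "\<bar>t - y\<bar> \<le> 1 / n" by (simp add: abs_divide)
  have "n * y \<le> n" using y by (simp add: mult_left_le)
  then have k: "k \<le> n" using \<open>real k \<le> n * y\<close> by linarith
  then have t: "t \<in> {0..1}" using n by (auto simp: t_def)
  have "(MIN k\<in>{0..n}. bern_beta k n y) \<le> bern_beta k n y" using k by (intro Min_le) auto
  then have "- bern_beta k n y \<le> bern_b n y" unfolding bern_b_def by linarith
  then have "N * - bern_beta k n y \<le> N * bern_b n y" using N by (intro mult_left_mono) auto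
  moreover have "N * - bern_beta k n y = t * (1 - t) - N * \<bar>t - y\<bar>\<^sup>2"
    unfolding bern_beta_eq[OF n] t_def[symmetric] N_def[symmetric] clear by simp
  moreover have "N * \<bar>t - y\<bar>\<^sup>2 \<le> 1 / n"
  proof -
    have "\<bar>t - y\<bar>\<^sup>2 \<le> (1 / n)\<^sup>2" using d by (intro power_mono) auto
    then have "N * \<bar>t - y\<bar>\<^sup>2 \<le> real n * (1 / n)\<^sup>2" using N by (intro mult_mono) auto
    then show ?thesis using n by (simp add: power2_eq_square)
  qed
  moreover have "y * (1 - y) - 1 / n \<le> t * (1 - t)" using concave[OF t] d by linarith
  ultimately have "y * (1 - y) - 2 / n \<le> N * bern_b n y" by simp
  with upper show ?thesis by (simp add: N_def abs_le_iff)
qed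

lemma bern_b_tendsto:
  assumes y: "y \<in> {0..1}"
  shows "(\<lambda>n. real n * bern_b n y) \<longlonglongrightarrow> y * (1 - y)"
proof -
  have "(\<lambda>n. (real n - 1) * bern_b n y - y * (1 - y)) \<longlonglongrightarrow> 0"
  proof (rule Lim_null_comparison)
    show "\<forall>\<^sub>F n in sequentially. norm ((real n - 1) * bern_b n y - y * (1 - y)) \<le> 2 / real n"
      using eventually_ge_at_top[of 2] by eventually_elim (use bern_b_close[OF y] in auto)
    show "(\<lambda>n. 2 / real n) \<longlonglongrightarrow> 0" by real_asymp
  qed
  then have lim: "(\<lambda>n. (real n - 1) * bern_b n y) \<longlonglongrightarrow> y * (1 - y)"
    by (simp add: LIM_zero_iff)
  have "(\<lambda>n. real n / (real n - 1) * ((real n - 1) * bern_b n y)) \<longlonglongrightarrow> 1 * (y * (1 - y))"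
    by (intro tendsto_mult lim) real_asymp
  then have "(\<lambda>n. real n / (real n - 1) * ((real n - 1) * bern_b n y)) \<longlonglongrightarrow> y * (1 - y)"
    by simp
  then show ?thesis
    by (rule Lim_transform_eventually)
       (rule eventually_mono[OF eventually_ge_at_top[of 2]], auto)
qed

lemma bern_b_tot_tendsto:
  fixes y :: "real ^ 'j::finite"
  assumes "\<And>j. y $ j \<in> {0..1}"
  shows "(\<lambda>n. real n * bern_b_tot n y) \<longlonglongrightarrow> D_const y"
  unfolding bern_b_tot_def D_const_def sum_distrib_left
  using assms by (intro tendsto_sum bern_b_tendsto)

section \<open>Elementary exponential integrals\<close>

lemma integrable_exp_neg_powr:
  assumes "0 < (\<alpha>::real)"
  shows "integrable lborel (\<lambda>u. indicator {0..} u * (exp (- u) * u powr \<alpha>))"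
    and "(\<integral> u. indicator {0..} u * (exp (- u) * u powr \<alpha>) \<partial>lborel) = Gamma (\<alpha> + 1)"
proof -
  have eq: "(\<integral>\<^sup>+ u. ennreal (indicator {0..} u * (exp (- u) * u powr \<alpha>)) \<partial>lborel) = ennreal (Gamma (\<alpha> + 1))"
    using Gamma_conv_nn_integral_real[of "\<alpha> + 1"] assms
    by (simp add: exp_minus divide_inverse mult_ac)
  then show "integrable lborel (\<lambda>u. indicator {0..} u * (exp (- u) * u powr \<alpha>))"
    by (intro integrableI_nn_integral_finite) auto
  show "(\<integral> u. indicator {0..} u * (exp (- u) * u powr \<alpha>) \<partial>lborel) = Gamma (\<alpha> + 1)"
    using eq assms by (subst integral_eq_nn_integral) (auto intro: Gamma_real_nonneg)
qed

lemma nn_integral_exp_tail: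
  assumes "0 \<le> s"
  shows "(\<integral>\<^sup>+ u. ennreal (indicator {s..} u * exp (- u)) \<partial>lborel) = ennreal (exp (- s))"
proof -
  have "(\<integral>\<^sup>+ u. ennreal (exp (- u)) * indicator {s..} u \<partial>lborel) = ennreal (0 - (- exp (- s)))"
  proof (rule nn_integral_FTC_atLeast)
    show "((\<lambda>u. - exp (- u)) \<longlongrightarrow> 0) (at_top :: real filter)" by real_asymp
  qed (auto intro!: derivative_eq_intros)
  moreover have "ennreal (exp (- u)) * indicator {s..} u = ennreal (indicator {s..} u * exp (- u))" for u
    by (auto simp: indicator_def)
  ultimately show ?thesis by simp
qed

lemma nn_integral_exp_interval:
  assumes "0 \<le> a" "w \<noteq> 0"
  shows "(\<integral>\<^sup>+ l. ennreal (indicator {0..a} l * exp (- (l * w))) \<partial>lborel) = ennreal ((1 - exp (- (a * w))) / w)"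
proof -
  have "(\<integral>\<^sup>+ l. ennreal (exp (- (l * w))) * indicator {0..a} l \<partial>lborel)
      = ennreal ((- exp (- (a * w)) / w) - (- exp (- (0 * w)) / w))"
    using assms by (intro nn_integral_FTC_Icc) (auto intro!: derivative_eq_intros)
  moreover have "ennreal (exp (- (l * w))) * indicator {0..a} l = ennreal (indicator {0..a} l * exp (- (l * w)))" for l
    by (auto simp: indicator_def)
  ultimately show ?thesis by (simp add: diff_divide_distrib)
qed

lemma nn_integral_exp_inverse:
  assumes "0 < w"
  shows "(\<integral>\<^sup>+ l. ennreal (indicator {0..} l * exp (- (l * w))) \<partial>lborel) = ennreal (1 / w)"
proof -
  have "(\<integral>\<^sup>+ l. ennreal (exp (- (l * w))) * indicator {0..} l \<partial>lborel) = ennreal (0 - (- exp (- (0 * w)) / w))"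
  proof (rule nn_integral_FTC_atLeast)
    show "((\<lambda>l. - exp (- (l * w)) / w) \<longlongrightarrow> 0) at_top" using assms by real_asymp
  qed (use assms in \<open>auto intro!: derivative_eq_intros\<close>)
  moreover have "ennreal (exp (- (l * w))) * indicator {0..} l = ennreal (indicator {0..} l * exp (- (l * w)))" for l
    by (auto simp: indicator_def)
  ultimately show ?thesis by simp
qed

lemma integrable_unit_powr:
  assumes "\<alpha> < (1::real)"
  shows "integrable lborel (\<lambda>s. indicator {0..1} s * s powr (- \<alpha>))"
proof (rule integrableI_nn_integral_finite)
  show "(\<integral>\<^sup>+ s. ennreal (indicator {0..1} s * s powr (- \<alpha>)) \<partial>lborel) = ennreal (1 powr (- \<alpha> + 1) / (- \<alpha> + 1))"
    using assms by (intro nn_integral_has_integral_lebesgue has_integral_powr_from_0) auto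
qed auto

section \<open>Laplace transform of a misfit with a small-ball law\<close>

locale small_ball = prob_space M for M :: "'x measure" +
  fixes Q :: "'x \<Rightarrow> real" and c \<alpha> :: real
  assumes Q_measurable[measurable]: "Q \<in> borel_measurable M"
    and Q_nonneg: "q \<in> space M \<Longrightarrow> 0 \<le> Q q"
    and c_pos: "0 < c" and \<alpha>_pos: "0 < \<alpha>"
    and small_ball: "(\<lambda>t. prob {q \<in> space M. Q q \<le> t}) \<sim>[at_right 0] (\<lambda>t. c * t powr \<alpha>)"
begin

definition ball_prob :: "real \<Rightarrow> real" where "ball_prob t = prob {q \<in> space M. Q q \<le> t}"

lemma ball_prob_measurable[measurable]: "ball_prob \<in> borel_measurable borel"
proof (rule borel_measurable_mono)
  show "mono ball_prob" unfolding ball_prob_def by (intro monoI finite_measure_mono) auto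
qed

lemma ball_prob_range: "0 \<le> ball_prob t" "ball_prob t \<le> 1"
  by (auto simp: ball_prob_def)

lemma ball_prob_limit: "((\<lambda>t. ball_prob t / t powr \<alpha>) \<longlongrightarrow> c) (at_right 0)"
proof -
  have "((\<lambda>t. ball_prob t / (c * t powr \<alpha>)) \<longlongrightarrow> 1) (at_right 0)"
    unfolding ball_prob_def using c_pos
    by (intro asymp_equivD_strong[OF small_ball]) (auto simp: eventually_at_right_less intro: eventually_mono[OF eventually_at_right_less[of 0]])
  from tendsto_mult[OF tendsto_const[of c] this] show ?thesis using c_pos by simp
qed

text \<open>Near 0 the bound follows from the limit; away from 0 the probability is at most 1.\<close>

lemma ball_prob_bound: obtains K where "0 < K" "\<And>t. 0 < t \<Longrightarrow> ball_prob t \<le> K * t powr \<alpha>"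
proof -
  have "\<forall>\<^sub>F t in at_right 0. ball_prob t / t powr \<alpha> < c + 1"
    using order_tendstoD(2)[OF ball_prob_limit, of "c + 1"] by simp
  then obtain d where d: "0 < d" "\<And>t. 0 < t \<Longrightarrow> t < d \<Longrightarrow> ball_prob t / t powr \<alpha> < c + 1"
    by (auto simp: eventually_at_right_field)
  show ?thesis
  proof (rule that)
    show "0 < (c + 1) + 1 / d powr \<alpha>" using c_pos d by (simp add: add_pos_pos)
    fix t :: real assume t: "0 < t"
    show "ball_prob t \<le> ((c + 1) + 1 / d powr \<alpha>) * t powr \<alpha>"
    proof (cases "t < d")
      case True
      then have "ball_prob t \<le> (c + 1) * t powr \<alpha>" using d(2)[OF t] t by (simp add: divide_simps)
      moreover have "0 \<le> 1 / d powr \<alpha> * t powr \<alpha>" using d t by simp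
      ultimately show ?thesis unfolding distrib_right by linarith
    next
      case False
      then have "d powr \<alpha> \<le> t powr \<alpha>" using d \<alpha>_pos by (intro powr_mono2) auto
      then have "1 \<le> 1 / d powr \<alpha> * t powr \<alpha>" using d by (simp add: divide_simps)
      moreover have "0 \<le> (c + 1) * t powr \<alpha>" using c_pos by simp
      ultimately show ?thesis unfolding distrib_right using ball_prob_range(2)[of t] by linarith
    qed
  qed
qed

lemma Q_pos_AE: "AE q in M. 0 < Q q"
proof -
  obtain K where K: "0 < K" "\<And>t. 0 < t \<Longrightarrow> ball_prob t \<le> K * t powr \<alpha>" by (rule ball_prob_bound) blast
  have "((\<lambda>t. K * t powr \<alpha>) \<longlongrightarrow> 0) (at_right 0)" using \<alpha>_pos by real_asymp
  moreover have "\<forall>\<^sub>F t in at_right 0. ball_prob 0 \<le> K * t powr \<alpha>"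
    using eventually_at_right_less[of 0]
  proof eventually_elim
    case (elim t)
    have "ball_prob 0 \<le> ball_prob t" unfolding ball_prob_def using elim by (intro finite_measure_mono) auto
    then show ?case using K(2)[OF elim] by linarith
  qed
  ultimately have "ball_prob 0 \<le> 0"
    by (intro tendsto_le[OF trivial_limit_at_right_real _ tendsto_const])
  then have "prob {q \<in> space M. Q q \<le> 0} = 0" using ball_prob_range(1)[of 0] unfolding ball_prob_def by linarith
  then have "AE q in M. q \<notin> {q \<in> space M. Q q \<le> 0}" by (subst (asm) prob_eq_0) auto
  then show ?thesis using AE_space by eventually_elim auto
qed

definition laplace :: "real \<Rightarrow> real" where "laplace l = (\<integral> q. exp (- (l * Q q)) \<partial>M)"

lemma laplace_measurable[measurable]: "laplace \<in> borel_measurable borel"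
  unfolding laplace_def by measurable

lemma integrable_exp_Q: "0 \<le> l \<Longrightarrow> integrable M (\<lambda>q. exp (- (l * Q q)))"
  by (intro integrable_const_bound[where B = 1] AE_I2) (auto intro!: mult_nonneg_nonneg Q_nonneg)

lemma laplace_range: assumes "0 \<le> l" shows "0 \<le> laplace l" "laplace l \<le> 1"
proof -
  show "0 \<le> laplace l" unfolding laplace_def by (intro integral_nonneg_AE) auto
  have "laplace l \<le> (\<integral> q. 1 \<partial>M)" unfolding laplace_def
    using assms by (intro integral_mono integrable_exp_Q) (auto intro!: mult_nonneg_nonneg Q_nonneg)
  then show "laplace l \<le> 1" by (simp add: prob_space)
qed

lemma nn_integral_exp_Q: "0 \<le> l \<Longrightarrow> (\<integral>\<^sup>+ q. ennreal (exp (- (l * Q q))) \<partial>M) = ennreal (laplace l)"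
  unfolding laplace_def by (intro nn_integral_eq_integral integrable_exp_Q) auto

text \<open>Write \<open>exp (- l Q)\<close> as the integral of \<open>exp (- u)\<close> over \<open>u \<ge> l Q\<close> and exchange the integrals.\<close>

lemma laplace_eq:
  assumes l: "0 < l"
  shows "laplace l = (\<integral> u. indicator {0..} u * (exp (- u) * ball_prob (u / l)) \<partial>lborel)"
proof -
  have "ennreal (laplace l) = (\<integral>\<^sup>+ q. \<integral>\<^sup>+ u. ennreal (indicator {l * Q q..} u * exp (- u)) \<partial>lborel \<partial>M)"
    using l Q_nonneg by (subst nn_integral_exp_Q[symmetric])
      (auto intro!: nn_integral_cong nn_integral_exp_tail[symmetric])
  also have "\<dots> = (\<integral>\<^sup>+ q. \<integral>\<^sup>+ u. ennreal (indicator {0..} u * exp (- u)) * (if Q q \<le> u / l then 1 else 0) \<partial>lborel \<partial>M)"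
  proof (intro nn_integral_cong)
    fix q u assume q: "q \<in> space M"
    have "0 \<le> l * Q q" using l Q_nonneg[OF q] by simp
    moreover have "Q q \<le> u / l \<longleftrightarrow> l * Q q \<le> u" using l by (simp add: field_simps)
    ultimately show "ennreal (indicator {l * Q q..} u * exp (- u))
        = ennreal (indicator {0..} u * exp (- u)) * (if Q q \<le> u / l then 1 else 0)"
      using q by (auto simp: indicator_def)
  qed
  also have "\<dots> = (\<integral>\<^sup>+ u. \<integral>\<^sup>+ q. ennreal (indicator {0..} u * exp (- u)) * (if Q q \<le> u / l then 1 else 0) \<partial>M \<partial>lborel)"
  proof -
    interpret pair_sigma_finite lborel M by standard
    show ?thesis by (rule Fubini') measurable
  qed
  also have "\<dots> = (\<integral>\<^sup>+ u. ennreal (indicator {0..} u * (exp (- u) * ball_prob (u / l))) \<partial>lborel)"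
  proof (rule nn_integral_cong)
    fix u :: real
    have "(\<integral>\<^sup>+ q. (if Q q \<le> u / l then 1 else 0) \<partial>M) = (\<integral>\<^sup>+ q. indicator {q \<in> space M. Q q \<le> u / l} q \<partial>M)"
      by (intro nn_integral_cong) (auto simp: indicator_def)
    also have "\<dots> = ennreal (ball_prob (u / l))" by (simp add: ball_prob_def emeasure_eq_measure)
    finally show "(\<integral>\<^sup>+ q. ennreal (indicator {0..} u * exp (- u)) * (if Q q \<le> u / l then 1 else 0) \<partial>M)
        = ennreal (indicator {0..} u * (exp (- u) * ball_prob (u / l)))"
      by (simp add: nn_integral_cmult ball_prob_range mult.assoc[symmetric] ennreal_mult)
  qed
  finally have "enn2real (ennreal (laplace l)) = (\<integral> u. indicator {0..} u * (exp (- u) * ball_prob (u / l)) \<partial>lborel)"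
    by (subst integral_eq_nn_integral) (auto simp: ball_prob_range)
  then show ?thesis using laplace_range(1)[of l] l by simp
qed

lemma laplace_scaled_eq:
  assumes l: "0 < l"
  shows "l powr \<alpha> * laplace l
    = (\<integral> u. indicator {0..} u * (exp (- u) * u powr \<alpha>) * (ball_prob (u / l) / (u / l) powr \<alpha>) \<partial>lborel)"
proof -
  have "l powr \<alpha> * laplace l = (\<integral> u. l powr \<alpha> * (indicator {0..} u * (exp (- u) * ball_prob (u / l))) \<partial>lborel)"
    by (simp add: laplace_eq[OF l])
  also have "\<dots> = (\<integral> u. indicator {0..} u * (exp (- u) * u powr \<alpha>) * (ball_prob (u / l) / (u / l) powr \<alpha>) \<partial>lborel)"
  proof (rule integral_cong_AE)
    show "AE u in lborel. l powr \<alpha> * (indicator {0..} u * (exp (- u) * ball_prob (u / l)))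
        = indicator {0..} u * (exp (- u) * u powr \<alpha>) * (ball_prob (u / l) / (u / l) powr \<alpha>)"
      using AE_lborel_singleton[of 0]
      by eventually_elim (use l in \<open>auto simp: indicator_def powr_divide\<close>)
  qed measurable
  finally show ?thesis .
qed

text \<open>The Abelian half of Karamata's theorem: after scaling, the integrand in \<open>laplace_eq\<close> converges
pointwise by the small-ball law and is dominated by \<open>ball_prob_bound\<close>.\<close>

lemma laplace_limit: "((\<lambda>l. l powr \<alpha> * laplace l) \<longlongrightarrow> c * Gamma (\<alpha> + 1)) at_top"
proof -
  let ?g = "\<lambda>u::real. indicator {0..} u * (exp (- u) * u powr \<alpha>)"
  obtain K where K: "0 < K" "\<And>t. 0 < t \<Longrightarrow> ball_prob t \<le> K * t powr \<alpha>" by (rule ball_prob_bound) blast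
  have "((\<lambda>l. \<integral> u. ?g u * (ball_prob (u / l) / (u / l) powr \<alpha>) \<partial>lborel) \<longlongrightarrow> (\<integral> u. ?g u * c \<partial>lborel)) at_top"
  proof (rule integral_dominated_convergence_at_top[where w = "\<lambda>u. ?g u * K"])
    show "integrable lborel (\<lambda>u. ?g u * K)"
      using integrable_exp_neg_powr(1)[OF \<alpha>_pos] by (rule integrable_mult_left)
    show "AE u in lborel. ((\<lambda>l. ?g u * (ball_prob (u / l) / (u / l) powr \<alpha>)) \<longlongrightarrow> ?g u * c) at_top"
      using AE_lborel_singleton[of 0]
    proof eventually_elim
      case (elim u)
      show ?case
      proof (cases "u > 0")
        case True
        then have "filterlim (\<lambda>l. u / l) (at_right 0) at_top" by real_asymp
        from filterlim_compose[OF ball_prob_limit this] show ?thesis by (intro tendsto_mult tendsto_const)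
      qed (use elim in auto)
    qed
    show "\<forall>\<^sub>F l in at_top. AE u in lborel. norm (?g u * (ball_prob (u / l) / (u / l) powr \<alpha>)) \<le> ?g u * K"
      using eventually_gt_at_top[of 0]
    proof eventually_elim
      case (elim l)
      show ?case using AE_lborel_singleton[of 0]
      proof eventually_elim
        case (elim u)
        show ?case
        proof (cases "u > 0")
          case True
          have "0 < u / l" using True \<open>0 < l\<close> by simp
          then have "ball_prob (u / l) / (u / l) powr \<alpha> \<le> K"
            using K(2)[of "u / l"] by (subst pos_divide_le_eq) auto
          moreover have "0 \<le> ball_prob (u / l) / (u / l) powr \<alpha>" by (simp add: ball_prob_range)
          ultimately have le: "\<bar>ball_prob (u / l) / (u / l) powr \<alpha>\<bar> \<le> K" by simp
          show ?thesis unfolding real_norm_def abs_mult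
            by (intro mult_mono le) (auto simp: abs_mult)
        qed (use elim K(1) in auto)
      qed
    qed
  qed measurable
  then have "((\<lambda>l. \<integral> u. ?g u * (ball_prob (u / l) / (u / l) powr \<alpha>) \<partial>lborel) \<longlongrightarrow> c * Gamma (\<alpha> + 1)) at_top"
    by (simp only: Bochner_Integration.integral_mult_left[OF integrable_exp_neg_powr(1)[OF \<alpha>_pos]]
        integrable_exp_neg_powr(2)[OF \<alpha>_pos] mult.commute[of "Gamma (\<alpha> + 1)"])
  moreover have "\<forall>\<^sub>F l in at_top. (\<integral> u. ?g u * (ball_prob (u / l) / (u / l) powr \<alpha>) \<partial>lborel) = l powr \<alpha> * laplace l"
    using eventually_gt_at_top[of 0] by eventually_elim (rule laplace_scaled_eq[symmetric])
  ultimately show ?thesis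
    by (rule Lim_transform_eventually)
qed

lemma laplace_bound: obtains K where "0 < K" "\<And>l. 0 < l \<Longrightarrow> laplace l \<le> K * l powr (- \<alpha>)"
proof -
  let ?g = "\<lambda>u::real. indicator {0..} u * (exp (- u) * u powr \<alpha>)"
  obtain K where K: "0 < K" "\<And>t. 0 < t \<Longrightarrow> ball_prob t \<le> K * t powr \<alpha>" by (rule ball_prob_bound) blast
  show ?thesis
  proof (rule that)
    show "0 < K * Gamma (\<alpha> + 1)" using K \<alpha>_pos by (simp add: Gamma_real_pos)
    fix l :: real assume l: "0 < l"
    have "laplace l \<le> (\<integral> u. ?g u * (K * l powr (- \<alpha>)) \<partial>lborel)"
      unfolding laplace_eq[OF l]
    proof (rule integral_mono_AE')
      show "integrable lborel (\<lambda>u. ?g u * (K * l powr (- \<alpha>)))"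
        using integrable_exp_neg_powr(1)[OF \<alpha>_pos] by (rule integrable_mult_left)
      show "AE u in lborel. indicator {0..} u * (exp (- u) * ball_prob (u / l)) \<le> ?g u * (K * l powr (- \<alpha>))"
        using AE_lborel_singleton[of 0]
      proof eventually_elim
        case (elim u)
        show ?case
        proof (cases "u > 0")
          case True
          then have "ball_prob (u / l) \<le> K * (u / l) powr \<alpha>" using l by (intro K(2)) simp
          also have "\<dots> = u powr \<alpha> * (K * l powr (- \<alpha>))"
            using l True by (simp add: powr_divide powr_minus_divide)
          finally show ?thesis using True by simp
        qed (use elim in auto)
      qed
      show "AE u in lborel. 0 \<le> ?g u * (K * l powr (- \<alpha>))"
        using K by simp
    qed
    also have "\<dots> = K * Gamma (\<alpha> + 1) * l powr (- \<alpha>)"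
      using integrable_exp_neg_powr[OF \<alpha>_pos] by simp
    finally show "laplace l \<le> K * Gamma (\<alpha> + 1) * l powr (- \<alpha>)" .
  qed
qed

text \<open>The mean of \<^const>\<open>tests_per_label\<close> over the candidates when \<open>Q\<close> is the misfit.\<close>

definition mean_tests :: "real \<Rightarrow> real \<Rightarrow> real" where
  "mean_tests a b = (\<integral> q. (1 - exp (- (a * (Q q + b)))) / (Q q + b) \<partial>M)"

lemma tests_bounds:
  fixes a b t :: real
  assumes "0 < a" "0 < b" "0 \<le> t"
  shows "0 \<le> (1 - exp (- (a * (t + b)))) / (t + b)"
    and "(1 - exp (- (a * (t + b)))) / (t + b) \<le> a"
    and "0 < t \<Longrightarrow> (1 - exp (- (a * (t + b)))) / (t + b) \<le> 1 / t"
proof -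
  show "0 \<le> (1 - exp (- (a * (t + b)))) / (t + b)"
    using assms by (intro divide_nonneg_nonneg) auto
  have "1 - exp (- (a * (t + b))) \<le> a * (t + b)"
    using exp_ge_add_one_self[of "- (a * (t + b))"] by linarith
  then show "(1 - exp (- (a * (t + b)))) / (t + b) \<le> a" using assms by (simp add: divide_simps)
  assume t: "0 < t"
  have "(1 - exp (- (a * (t + b)))) / (t + b) \<le> 1 / (t + b)"
    using assms by (intro divide_right_mono) auto
  also have "\<dots> \<le> 1 / t" using assms t by (intro divide_left_mono) auto
  finally show "(1 - exp (- (a * (t + b)))) / (t + b) \<le> 1 / t" .
qed

lemma mean_tests_integrable:
  assumes "0 < a" "0 < b"
  shows "integrable M (\<lambda>q. (1 - exp (- (a * (Q q + b)))) / (Q q + b))"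
proof (intro integrable_const_bound[where B = a] AE_I2)
  fix q assume "q \<in> space M"
  from tests_bounds(1,2)[OF assms Q_nonneg[OF this]]
  show "norm ((1 - exp (- (a * (Q q + b)))) / (Q q + b)) \<le> a" unfolding real_norm_def by linarith
qed measurable

text \<open>The quotient is the integral of \<open>exp (- l (Q + b))\<close> over \<open>l\<close> in \<open>[0, a]\<close>; exchanging integrals leaves
the Laplace transform.\<close>

lemma mean_tests_eq:
  assumes ab: "0 < a" "0 < b"
  shows "mean_tests a b = (\<integral> l. indicator {0..a} l * (exp (- (l * b)) * laplace l) \<partial>lborel)"
proof -
  have "ennreal (mean_tests a b) = (\<integral>\<^sup>+ q. ennreal ((1 - exp (- (a * (Q q + b)))) / (Q q + b)) \<partial>M)"
    unfolding mean_tests_def using tests_bounds(1)[OF ab Q_nonneg]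
    by (intro nn_integral_eq_integral[symmetric] mean_tests_integrable ab AE_I2) auto
  also have "\<dots> = (\<integral>\<^sup>+ q. \<integral>\<^sup>+ l. ennreal (indicator {0..a} l * exp (- (l * (Q q + b)))) \<partial>lborel \<partial>M)"
    using ab Q_nonneg by (intro nn_integral_cong nn_integral_exp_interval[symmetric]) (auto simp: add_nonneg_eq_0_iff)
  also have "\<dots> = (\<integral>\<^sup>+ l. \<integral>\<^sup>+ q. ennreal (indicator {0..a} l * exp (- (l * (Q q + b)))) \<partial>M \<partial>lborel)"
  proof -
    interpret pair_sigma_finite lborel M by standard
    show ?thesis by (rule Fubini') measurable
  qed
  also have "\<dots> = (\<integral>\<^sup>+ l. ennreal (indicator {0..a} l * (exp (- (l * b)) * laplace l)) \<partial>lborel)"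
  proof (rule nn_integral_cong)
    fix l :: real
    show "(\<integral>\<^sup>+ q. ennreal (indicator {0..a} l * exp (- (l * (Q q + b)))) \<partial>M)
        = ennreal (indicator {0..a} l * (exp (- (l * b)) * laplace l))"
    proof (cases "l \<in> {0..a}")
      case True
      then have "(\<integral>\<^sup>+ q. ennreal (indicator {0..a} l * exp (- (l * (Q q + b)))) \<partial>M)
          = (\<integral>\<^sup>+ q. ennreal (exp (- (l * b))) * ennreal (exp (- (l * Q q))) \<partial>M)"
        by (intro nn_integral_cong) (simp add: algebra_simps flip: ennreal_mult exp_add)
      also have "\<dots> = ennreal (exp (- (l * b))) * ennreal (laplace l)"
        using True by (simp add: nn_integral_cmult nn_integral_exp_Q)
      finally show ?thesis using True laplace_range(1)[of l] by (simp add: ennreal_mult)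
    qed simp
  qed
  finally have "enn2real (ennreal (mean_tests a b)) = (\<integral> l. indicator {0..a} l * (exp (- (l * b)) * laplace l) \<partial>lborel)"
    by (subst integral_eq_nn_integral) (auto simp: indicator_def laplace_range)
  moreover have "0 \<le> mean_tests a b"
    unfolding mean_tests_def using tests_bounds(1)[OF ab Q_nonneg] by (intro integral_nonneg_AE AE_I2) auto
  ultimately show ?thesis by simp
qed

lemma mean_tests_scaled_eq:
  assumes a: "0 < a" and b: "0 < b"
  shows "mean_tests a b / a powr (1 - \<alpha>)
    = (\<integral> s. indicator {0..1} s * (exp (- (s * (a * b))) * (a powr \<alpha> * laplace (a * s))) \<partial>lborel)"
proof -
  have "mean_tests a b = a * (\<integral> s. indicator {0..a} (0 + a * s) * (exp (- ((0 + a * s) * b)) * laplace (0 + a * s)) \<partial>lborel)"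
    unfolding mean_tests_eq[OF a b] using a by (subst lborel_integral_real_affine[of a _ 0]) auto
  also have "\<dots> = a * (\<integral> s. indicator {0..1} s * (exp (- (s * (a * b))) * laplace (a * s)) \<partial>lborel)"
  proof -
    have "indicator {0..a} (0 + a * s) = (indicator {0..1} s :: real)" for s
      using a by (auto simp: indicator_def zero_le_mult_iff)
    then show ?thesis by (simp add: mult_ac)
  qed
  also have "\<dots> = (a powr \<alpha> * a powr (1 - \<alpha>)) * (\<integral> s. indicator {0..1} s * (exp (- (s * (a * b))) * laplace (a * s)) \<partial>lborel)"
    using a by (simp flip: powr_add)
  finally have "mean_tests a b / a powr (1 - \<alpha>)
      = a powr \<alpha> * (\<integral> s. indicator {0..1} s * (exp (- (s * (a * b))) * laplace (a * s)) \<partial>lborel)"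
    using a by simp
  also have "\<dots> = (\<integral> s. a powr \<alpha> * (indicator {0..1} s * (exp (- (s * (a * b))) * laplace (a * s))) \<partial>lborel)"
    by simp
  finally show ?thesis by (simp add: mult_ac)
qed

lemma mean_tests_limit_lt_1:
  fixes a b :: "nat \<Rightarrow> real"
  assumes \<alpha>: "\<alpha> < 1" and a: "\<And>k. 0 < a k" "filterlim a at_top sequentially"
    and b: "\<And>k. 0 < b k" and ab: "(\<lambda>k. a k * b k) \<longlonglongrightarrow> \<beta>"
  shows "(\<lambda>k. mean_tests (a k) (b k) / a k powr (1 - \<alpha>))
    \<longlonglongrightarrow> c * (Gamma (\<alpha> + 1) * (\<integral> s. indicator {0..1} s * (exp (- (s * \<beta>)) * s powr (- \<alpha>)) \<partial>lborel))"
proof -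
  obtain K where K: "0 < K" "\<And>l. 0 < l \<Longrightarrow> laplace l \<le> K * l powr (- \<alpha>)" by (rule laplace_bound) blast
  have scale: "a k powr \<alpha> * laplace (a k * s) = s powr (- \<alpha>) * ((a k * s) powr \<alpha> * laplace (a k * s))"
    if "0 < s" for k s
    using that a(1)[of k] by (simp add: powr_mult powr_minus)
  have "(\<lambda>k. \<integral> s. indicator {0..1} s * (exp (- (s * (a k * b k))) * (a k powr \<alpha> * laplace (a k * s))) \<partial>lborel)
    \<longlonglongrightarrow> (\<integral> s. indicator {0..1} s * (exp (- (s * \<beta>)) * (s powr (- \<alpha>) * (c * Gamma (\<alpha> + 1)))) \<partial>lborel)"
  proof (rule integral_dominated_convergence[where w = "\<lambda>s. indicator {0..1} s * s powr (- \<alpha>) * K"])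
    show "integrable lborel (\<lambda>s. indicator {0..1} s * s powr (- \<alpha>) * K)"
      using integrable_unit_powr[OF \<alpha>] by (rule integrable_mult_left)
    show "AE s in lborel. (\<lambda>k. indicator {0..1} s * (exp (- (s * (a k * b k))) * (a k powr \<alpha> * laplace (a k * s))))
        \<longlonglongrightarrow> indicator {0..1} s * (exp (- (s * \<beta>)) * (s powr (- \<alpha>) * (c * Gamma (\<alpha> + 1))))"
      using AE_lborel_singleton[of 0]
    proof eventually_elim
      case (elim s)
      show ?case
      proof (cases "0 < s")
        case True
        then have "filterlim (\<lambda>k. a k * s) at_top sequentially"
          by (intro filterlim_tendsto_pos_mult_at_top[OF tendsto_const _ a(2), THEN filterlim_cong[THEN iffD1, rotated -1]])
             (auto simp: mult.commute)
        from filterlim_compose[OF laplace_limit this]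
        have A: "(\<lambda>k. (a k * s) powr \<alpha> * laplace (a k * s)) \<longlonglongrightarrow> c * Gamma (\<alpha> + 1)" .
        have B: "(\<lambda>k. exp (- (s * (a k * b k)))) \<longlonglongrightarrow> exp (- (s * \<beta>))"
          by (intro tendsto_intros ab)
        show ?thesis
          unfolding scale[OF True]
          by (rule tendsto_mult[OF tendsto_const tendsto_mult[OF B tendsto_mult[OF tendsto_const A]]])
      qed (use elim in auto)
    qed
    show "AE s in lborel. norm (indicator {0..1} s * (exp (- (s * (a k * b k))) * (a k powr \<alpha> * laplace (a k * s))))
        \<le> indicator {0..1} s * s powr (- \<alpha>) * K" for k
      using AE_lborel_singleton[of 0]
    proof eventually_elim
      case (elim s)
      show ?case
      proof (cases "0 < s \<and> s \<le> 1")
        case True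
        then have as: "0 < a k * s" using a(1)[of k] by simp
        have "(a k * s) powr \<alpha> * laplace (a k * s) \<le> (a k * s) powr \<alpha> * (K * (a k * s) powr (- \<alpha>))"
          by (intro mult_left_mono K(2) as) auto
        also have "\<dots> = K * (a k * s) powr (\<alpha> + - \<alpha>)" by (simp only: powr_add mult_ac)
        also have "\<dots> = K" using as by (auto simp: zero_less_mult_iff)
        finally have 1: "a k powr \<alpha> * laplace (a k * s) \<le> s powr (- \<alpha>) * K"
          using True by (simp add: scale mult_left_mono)
        have 2: "exp (- (s * (a k * b k))) \<le> 1" using True a(1)[of k] b[of k] by simp
        have "exp (- (s * (a k * b k))) * (a k powr \<alpha> * laplace (a k * s)) \<le> 1 * (s powr (- \<alpha>) * K)"
          using as laplace_range(1)[of "a k * s"] by (intro mult_mono 1 2) auto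
        then show ?thesis using True as laplace_range(1)[of "a k * s"] by simp
      qed (use elim in \<open>auto simp: indicator_def\<close>)
    qed
  qed measurable
  moreover have "(\<integral> s. indicator {0..1} s * (exp (- (s * \<beta>)) * (s powr (- \<alpha>) * (c * Gamma (\<alpha> + 1)))) \<partial>lborel)
    = (\<integral> s. (c * Gamma (\<alpha> + 1)) * (indicator {0..1} s * (exp (- (s * \<beta>)) * s powr (- \<alpha>))) \<partial>lborel)"
    by (simp add: mult_ac)
  ultimately show ?thesis by (simp add: mean_tests_scaled_eq[OF a(1) b] mult.assoc)
qed

text \<open>The substitution \<open>l = a powr s\<close> maps \<open>[0, 1]\<close> to \<open>[1, a]\<close> with Jacobian \<open>ln a * a powr s\<close>; the remaining
part \<open>[0, 1]\<close> contributes at most 1.\<close>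

lemma mean_tests_log_split:
  assumes a: "1 < a" and b: "0 < b"
  shows "\<bar>mean_tests a b / ln a
    - (\<integral> s. indicator {0..1} s * (exp (- (a powr s * b)) * (a powr s * laplace (a powr s))) \<partial>lborel)\<bar> \<le> 1 / ln a"
proof -
  define T where "T = ln a"
  have T: "0 < T" using a by (simp add: T_def)
  let ?f = "\<lambda>l. exp (- (l * b)) * laplace l"
  have f: "0 \<le> ?f l" "?f l \<le> 1" if "0 \<le> l" for l
    using that b laplace_range[OF that] mult_le_one[of "exp (- (l * b))" "laplace l"] by auto
  have integrable: "set_integrable lborel {u..w} ?f" if "0 \<le> u" for u w
    unfolding set_integrable_def
    by (rule Bochner_Integration.integrable_bound[of _ "indicator {u..w} :: real \<Rightarrow> real"])
       (use that f in \<open>auto simp: indicator_def emeasure_lborel_Icc_eq intro!: integrable_real_indicator\<close>)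
  have head: "0 \<le> (LBINT l:{0..1}. ?f l)" "(LBINT l:{0..1}. ?f l) \<le> 1"
  proof -
    show "0 \<le> (LBINT l:{0..1}. ?f l)"
      unfolding set_lebesgue_integral_def using f by (intro integral_nonneg_AE) (auto simp: indicator_def)
    have "(LBINT l:{0..1}. ?f l) \<le> (LBINT l:{0..1::real}. 1)"
      using f by (intro set_integral_mono integrable) (auto simp: set_integrable_def)
    then show "(LBINT l:{0..1}. ?f l) \<le> 1" by (simp add: set_lebesgue_integral_def)
  qed
  have "mean_tests a b = (LBINT l:{0..a}. ?f l)"
    using a b by (simp add: mean_tests_eq set_lebesgue_integral_def)
  also have "\<dots> = (LBINT l:{0..1} \<union> {1<..a}. ?f l)"
    using a by (intro arg_cong2[where f = "\<lambda>A g. set_lebesgue_integral lborel A g"]) auto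
  also have "\<dots> = (LBINT l:{0..1}. ?f l) + (LBINT l:{1<..a}. ?f l)"
    by (rule set_integral_Un) (auto intro!: integrable set_integrable_subset[OF integrable[of 1 a]])
  also have "(LBINT l:{1<..a}. ?f l) = (LBINT l:{1..a}. ?f l)"
    unfolding set_lebesgue_integral_def
    by (rule integral_cong_AE) (use AE_lborel_singleton[of 1] in \<open>auto simp: indicator_def elim!: eventually_mono\<close>)
  also have "\<dots> = (\<integral> s. ?f (exp (s * T)) * (T * exp (s * T)) * indicator {0..1} s \<partial>lborel)"
  proof -
    have "(LBINT l. ?f l * indicator {exp (0 * T)..exp (1 * T)} l)
        = (LBINT s. ?f (exp (s * T)) * (T * exp (s * T)) * indicator {0..1} s)"
      by (rule integral_substitution(2)[where g = "\<lambda>s. exp (s * T)"])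
         (use T in \<open>auto intro!: derivative_eq_intros continuous_intros integrable\<close>)
    then show ?thesis using a by (simp add: T_def set_lebesgue_integral_def mult.commute)
  qed
  also have "\<dots> = (\<integral> s. T * (indicator {0..1} s * (exp (- (a powr s * b)) * (a powr s * laplace (a powr s)))) \<partial>lborel)"
    using a by (simp add: powr_def T_def mult_ac)
  also have "\<dots> = T * (\<integral> s. indicator {0..1} s * (exp (- (a powr s * b)) * (a powr s * laplace (a powr s))) \<partial>lborel)"
    by simp
  finally have "mean_tests a b / T = (LBINT l:{0..1}. ?f l) / T
      + (\<integral> s. indicator {0..1} s * (exp (- (a powr s * b)) * (a powr s * laplace (a powr s))) \<partial>lborel)"
    using T by (simp add: add_divide_distrib)
  moreover have "0 \<le> (LBINT l:{0..1}. ?f l) / T" "(LBINT l:{0..1}. ?f l) / T \<le> 1 / T"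
    using head T by (auto intro: divide_right_mono)
  ultimately show ?thesis by (simp add: T_def)
qed

text \<open>On the logarithmic scale of \<open>mean_tests_log_split\<close> every \<open>s\<close> strictly between 0 and 1 contributes the limit of
\<open>l * laplace l\<close>, and the damping \<open>exp (- l b)\<close> disappears because \<open>l b\<close> is of order \<open>a powr (s - 1)\<close>.\<close>

lemma mean_tests_limit_eq_1:
  fixes a b :: "nat \<Rightarrow> real"
  assumes \<alpha>: "\<alpha> = 1" and a: "\<And>k. 1 < a k" "filterlim a at_top sequentially"
    and b: "\<And>k. 0 < b k" and ab: "(\<lambda>k. a k * b k) \<longlonglongrightarrow> \<beta>"
  shows "(\<lambda>k. mean_tests (a k) (b k) / ln (a k)) \<longlonglongrightarrow> c"
proof -
  obtain K where K: "0 < K" "\<And>l. 0 < l \<Longrightarrow> laplace l \<le> K * l powr (- \<alpha>)" by (rule laplace_bound) blast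
  let ?J = "\<lambda>k. \<integral> s. indicator {0..1} s * (exp (- (a k powr s * b k)) * (a k powr s * laplace (a k powr s))) \<partial>lborel"
  have "?J \<longlonglongrightarrow> (\<integral> s. indicator {0..1::real} s * c \<partial>lborel)"
  proof (rule integral_dominated_convergence[where w = "\<lambda>s. indicator {0..1::real} s * K"])
    show "integrable lborel (\<lambda>s. indicator {0..1::real} s * K)" by simp
    show "AE s in lborel. (\<lambda>k. indicator {0..1} s * (exp (- (a k powr s * b k)) * (a k powr s * laplace (a k powr s))))
        \<longlonglongrightarrow> indicator {0..1} s * c"
      using AE_lborel_singleton[of 0] AE_lborel_singleton[of 1]
    proof eventually_elim
      case (elim s)
      show ?case
      proof (cases "0 < s \<and> s < 1")
        case True
        have pow: "filterlim (\<lambda>k. a k powr s) at_top sequentially"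
          using True by (intro filterlim_compose[OF _ a(2)]) real_asymp
        have "(\<lambda>k. a k powr (s - 1)) \<longlonglongrightarrow> 0"
          using True by (intro filterlim_compose[OF _ a(2)]) real_asymp
        from tendsto_mult[OF this ab] have "(\<lambda>k. a k powr (s - 1) * (a k * b k)) \<longlonglongrightarrow> 0" by simp
        moreover have "a k powr (s - 1) * (a k * b k) = a k powr s * b k" for k
          using a(1)[of k] by (simp add: powr_diff)
        ultimately have "(\<lambda>k. a k powr s * b k) \<longlonglongrightarrow> 0" by simp
        then have 1: "(\<lambda>k. exp (- (a k powr s * b k))) \<longlonglongrightarrow> exp (- 0)" by (intro tendsto_intros)
        have "(\<lambda>k. (a k powr s) powr \<alpha> * laplace (a k powr s)) \<longlonglongrightarrow> c * Gamma (\<alpha> + 1)"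
          by (rule filterlim_compose[OF laplace_limit pow])
        moreover have "(a k powr s) powr \<alpha> = a k powr s" for k using \<alpha> by (simp add: powr_powr)
        moreover have "Gamma (\<alpha> + 1) = 1" using Gamma_fact[of 1, where 'a = real] \<alpha> by simp
        ultimately have 2: "(\<lambda>k. a k powr s * laplace (a k powr s)) \<longlonglongrightarrow> c" by simp
        have "(\<lambda>k. indicator {0..1} s * (exp (- (a k powr s * b k)) * (a k powr s * laplace (a k powr s))))
          \<longlonglongrightarrow> indicator {0..1} s * (exp (- 0) * c)"
          by (intro tendsto_mult 1 2 tendsto_const)
        then show ?thesis by simp
      qed (use elim in \<open>auto simp: indicator_def\<close>)
    qed
    show "AE s in lborel. norm (indicator {0..1} s * (exp (- (a k powr s * b k)) * (a k powr s * laplace (a k powr s))))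
        \<le> indicator {0..1} s * K" for k
    proof (rule AE_I2)
      fix s :: real
      have pos: "0 < a k powr s" using a(1)[of k] by simp
      have "a k powr s * laplace (a k powr s) \<le> a k powr s * (K * (a k powr s) powr (- \<alpha>))"
        by (intro mult_left_mono K(2) pos) auto
      also have "\<dots> = K" using pos \<alpha> by (simp add: powr_minus)
      finally have 1: "a k powr s * laplace (a k powr s) \<le> K" .
      have 2: "exp (- (a k powr s * b k)) \<le> 1" using b[of k] by simp
      have "exp (- (a k powr s * b k)) * (a k powr s * laplace (a k powr s)) \<le> 1 * K"
        using laplace_range(1)[of "a k powr s"] by (intro mult_mono 1 2) auto
      then show "norm (indicator {0..1} s * (exp (- (a k powr s * b k)) * (a k powr s * laplace (a k powr s))))
        \<le> indicator {0..1} s * K"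
        using laplace_range(1)[of "a k powr s"] by (simp add: indicator_def)
    qed
  qed measurable
  then have J: "?J \<longlonglongrightarrow> c" by simp
  have "(\<lambda>k. mean_tests (a k) (b k) / ln (a k) - ?J k) \<longlonglongrightarrow> 0"
  proof (rule Lim_null_comparison)
    show "\<forall>\<^sub>F k in sequentially. norm (mean_tests (a k) (b k) / ln (a k) - ?J k) \<le> 1 / ln (a k)"
      using mean_tests_log_split[OF a(1) b] by simp
    show "(\<lambda>k. 1 / ln (a k)) \<longlonglongrightarrow> 0"
      by (rule filterlim_compose[OF _ a(2)]) real_asymp
  qed
  from tendsto_add[OF this J] show ?thesis by simp
qed

text \<open>The mean of \<open>1 / Q\<close> is the integral of the Laplace transform over the half line, and the latter decays like
\<open>l powr (- \<alpha>)\<close>.\<close>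

lemma inverse_Q_integrable:
  assumes \<alpha>: "1 < \<alpha>"
  shows "integrable M (\<lambda>q. 1 / Q q)"
proof -
  obtain K where K: "0 < K" "\<And>l. 0 < l \<Longrightarrow> laplace l \<le> K * l powr (- \<alpha>)" by (rule laplace_bound) blast
  have tail: "(\<integral>\<^sup>+ l. ennreal (K * l powr (- \<alpha>)) * indicator {1..} l \<partial>lborel)
      = ennreal (0 - K * 1 powr (1 - \<alpha>) / (1 - \<alpha>))"
  proof (rule nn_integral_FTC_atLeast[where F = "\<lambda>l. K * l powr (1 - \<alpha>) / (1 - \<alpha>)"])
    show "((\<lambda>l. K * l powr (1 - \<alpha>) / (1 - \<alpha>)) \<longlongrightarrow> 0) at_top"
      using \<alpha> by real_asymp
    show "((\<lambda>l. K * l powr (1 - \<alpha>) / (1 - \<alpha>)) has_real_derivative K * l powr (- \<alpha>)) (at l)" if "1 \<le> l" for l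
      using that \<alpha> by (auto intro!: derivative_eq_intros)
  qed (use K in auto)
  have "(\<integral>\<^sup>+ q. ennreal (1 / Q q) \<partial>M) = (\<integral>\<^sup>+ q. \<integral>\<^sup>+ l. ennreal (indicator {0..} l * exp (- (l * Q q))) \<partial>lborel \<partial>M)"
    using Q_pos_AE by (intro nn_integral_cong_AE) (auto elim!: eventually_mono simp: nn_integral_exp_inverse)
  also have "\<dots> = (\<integral>\<^sup>+ l. \<integral>\<^sup>+ q. ennreal (indicator {0..} l * exp (- (l * Q q))) \<partial>M \<partial>lborel)"
  proof -
    interpret pair_sigma_finite lborel M by standard
    show ?thesis by (rule Fubini') measurable
  qed
  also have "\<dots> \<le> (\<integral>\<^sup>+ l. indicator {0..1} l + ennreal (K * l powr (- \<alpha>)) * indicator {1..} l \<partial>lborel)"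
  proof (rule nn_integral_mono)
    fix l :: real
    show "(\<integral>\<^sup>+ q. ennreal (indicator {0..} l * exp (- (l * Q q))) \<partial>M)
        \<le> indicator {0..1} l + ennreal (K * l powr (- \<alpha>)) * indicator {1..} l"
    proof (cases "0 \<le> l")
      case True
      then have "(\<integral>\<^sup>+ q. ennreal (indicator {0..} l * exp (- (l * Q q))) \<partial>M) = ennreal (laplace l)"
        by (simp add: nn_integral_exp_Q)
      also have "\<dots> \<le> indicator {0..1} l + ennreal (K * l powr (- \<alpha>)) * indicator {1..} l"
      proof (cases "l < 1")
        case l: True
        then show ?thesis using True laplace_range[of l] by (simp add: ennreal_le_1)
      next
        case l: False
        then have "laplace l \<le> K * l powr (- \<alpha>)" by (intro K(2)) auto
        then show ?thesis using l by (auto intro!: add_increasing ennreal_leI)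
      qed
      finally show ?thesis .
    qed simp
  qed
  also have "\<dots> = 1 + ennreal (0 - K * 1 powr (1 - \<alpha>) / (1 - \<alpha>))"
    by (subst nn_integral_add) (auto simp: tail)
  also have "\<dots> < \<infinity>" by simp
  finally show ?thesis
    using Q_nonneg by (intro integrableI_nonneg) (auto intro!: AE_I2)
qed

end

section \<open>The constant for exponents below 1\<close>

lemma Gamma_scaled:
  assumes "0 < \<alpha>" "0 < s"
  shows "(\<integral>\<^sup>+ t. ennreal (indicator {0..} t * (t powr (\<alpha> - 1) * exp (- (t * s)))) \<partial>lborel)
    = ennreal (Gamma \<alpha> * s powr (- \<alpha>))" (is "?I = _")
proof -
  have "ennreal (Gamma \<alpha>) = (\<integral>\<^sup>+ t. ennreal (indicator {0..} t * t powr (\<alpha> - 1) / exp t) \<partial>lborel)"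
    by (rule Gamma_conv_nn_integral_real[OF assms(1)])
  also have "\<dots> = ennreal s * (\<integral>\<^sup>+ t. ennreal (indicator {0..} (0 + s * t) * (0 + s * t) powr (\<alpha> - 1) / exp (0 + s * t)) \<partial>lborel)"
    using assms(2) by (subst nn_integral_real_affine[of _ s 0]) auto
  also have "(\<integral>\<^sup>+ t. ennreal (indicator {0..} (0 + s * t) * (0 + s * t) powr (\<alpha> - 1) / exp (0 + s * t)) \<partial>lborel)
      = (\<integral>\<^sup>+ t. ennreal (s powr (\<alpha> - 1)) * ennreal (indicator {0..} t * (t powr (\<alpha> - 1) * exp (- (t * s)))) \<partial>lborel)"
  proof (rule nn_integral_cong)
    fix t :: real
    have "indicator {0..} (s * t) = (indicator {0..} t :: real)"
      using assms(2) by (auto simp: indicator_def zero_le_mult_iff)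
    then show "ennreal (indicator {0..} (0 + s * t) * (0 + s * t) powr (\<alpha> - 1) / exp (0 + s * t))
        = ennreal (s powr (\<alpha> - 1)) * ennreal (indicator {0..} t * (t powr (\<alpha> - 1) * exp (- (t * s))))"
      using assms(2) by (cases "0 \<le> t") (auto simp: powr_mult exp_minus divide_inverse mult_ac simp flip: ennreal_mult)
  qed
  also have "\<dots> = ennreal (s powr (\<alpha> - 1)) * (\<integral>\<^sup>+ t. ennreal (indicator {0..} t * (t powr (\<alpha> - 1) * exp (- (t * s)))) \<partial>lborel)"
    by (rule nn_integral_cmult) auto
  finally have "ennreal (Gamma \<alpha>) = ennreal s * (ennreal (s powr (\<alpha> - 1)) * ?I)" .
  moreover have "ennreal s * ennreal (s powr (\<alpha> - 1)) = ennreal (s powr \<alpha>)"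
    using assms(2) by (subst ennreal_mult[symmetric]) (auto simp: powr_diff)
  ultimately have Gamma: "ennreal (Gamma \<alpha>) = ennreal (s powr \<alpha>) * ?I"
    by (simp only: mult.assoc[symmetric])
  have "ennreal (Gamma \<alpha> * s powr (- \<alpha>)) = ennreal (s powr (- \<alpha>)) * ennreal (Gamma \<alpha>)"
    using assms by (subst mult.commute, subst ennreal_mult) (auto simp: Gamma_real_nonneg)
  also have "\<dots> = (ennreal (s powr (- \<alpha>)) * ennreal (s powr \<alpha>)) * ?I"
    by (simp only: Gamma mult.assoc)
  also have "ennreal (s powr (- \<alpha>)) * ennreal (s powr \<alpha>) = 1"
    using assms(2) by (subst ennreal_mult[symmetric]) (auto simp: powr_minus)
  finally show ?thesis by simp
qed

text \<open>Write the quotient in the definition of \<^const>\<open>Psi\<close> as an integral of \<open>exp (- s (\<beta> + t))\<close> over \<open>s\<close> in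
\<open>[0, 1]\<close>, exchange the integrals, and recognise the Gamma integral in \<open>t\<close>.\<close>

lemma Psi_eq:
  assumes \<alpha>: "0 < \<alpha>" "\<alpha> < 1" and \<beta>: "0 < \<beta>"
  shows "Psi \<alpha> \<beta> = Gamma (\<alpha> + 1) * (\<integral> s. indicator {0..1} s * (exp (- (s * \<beta>)) * s powr (- \<alpha>)) \<partial>lborel)"
    and "0 < Psi \<alpha> \<beta>"
proof -
  let ?g = "\<lambda>s. indicator {0..1} s * (exp (- (s * \<beta>)) * s powr (- \<alpha>))"
  let ?h = "\<lambda>t. t powr (\<alpha> - 1) * ((1 - exp (- (\<beta> + t))) / (\<beta> + t))"
  have "(\<integral>\<^sup>+ t. ennreal (indicator {0..} t * ?h t) \<partial>lborel)
      = (\<integral>\<^sup>+ t. \<integral>\<^sup>+ s. ennreal (indicator {0..} t * t powr (\<alpha> - 1)) * ennreal (indicator {0..1} s * exp (- (s * (\<beta> + t)))) \<partial>lborel \<partial>lborel)"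
  proof (rule nn_integral_cong)
    fix t :: real
    show "ennreal (indicator {0..} t * ?h t)
      = (\<integral>\<^sup>+ s. ennreal (indicator {0..} t * t powr (\<alpha> - 1)) * ennreal (indicator {0..1} s * exp (- (s * (\<beta> + t)))) \<partial>lborel)"
    proof (cases "0 \<le> t")
      case True
      have "(\<integral>\<^sup>+ s. ennreal (indicator {0..} t * t powr (\<alpha> - 1)) * ennreal (indicator {0..1} s * exp (- (s * (\<beta> + t)))) \<partial>lborel)
          = ennreal (t powr (\<alpha> - 1)) * ennreal ((1 - exp (- (1 * (\<beta> + t)))) / (\<beta> + t))"
        using True \<beta> by (subst nn_integral_cmult) (simp_all only: nn_integral_exp_interval, auto)
      also have "\<dots> = ennreal (t powr (\<alpha> - 1) * ((1 - exp (- (1 * (\<beta> + t)))) / (\<beta> + t)))"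
        using True \<beta> by (intro ennreal_mult[symmetric] divide_nonneg_nonneg) auto
      finally show ?thesis using True by simp
    qed simp
  qed
  also have "\<dots> = (\<integral>\<^sup>+ s. \<integral>\<^sup>+ t. ennreal (indicator {0..} t * t powr (\<alpha> - 1)) * ennreal (indicator {0..1} s * exp (- (s * (\<beta> + t)))) \<partial>lborel \<partial>lborel)"
    by (rule lborel_pair.Fubini') measurable
  also have "\<dots> = (\<integral>\<^sup>+ s. ennreal (Gamma \<alpha> * ?g s) \<partial>lborel)"
  proof (rule nn_integral_cong_AE)
    show "AE s in lborel. (\<integral>\<^sup>+ t. ennreal (indicator {0..} t * t powr (\<alpha> - 1)) * ennreal (indicator {0..1} s * exp (- (s * (\<beta> + t)))) \<partial>lborel)
      = ennreal (Gamma \<alpha> * ?g s)"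
      using AE_lborel_singleton[of 0]
    proof eventually_elim
      case (elim s)
      show ?case
      proof (cases "0 < s \<and> s \<le> 1")
        case True
        have "(\<integral>\<^sup>+ t. ennreal (indicator {0..} t * t powr (\<alpha> - 1)) * ennreal (indicator {0..1} s * exp (- (s * (\<beta> + t)))) \<partial>lborel)
            = (\<integral>\<^sup>+ t. ennreal (exp (- (s * \<beta>))) * ennreal (indicator {0..} t * (t powr (\<alpha> - 1) * exp (- (t * s)))) \<partial>lborel)"
          using True by (intro nn_integral_cong)
            (simp add: algebra_simps exp_diff exp_minus divide_inverse flip: ennreal_mult exp_add)
        also have "\<dots> = ennreal (exp (- (s * \<beta>))) * ennreal (Gamma \<alpha> * s powr (- \<alpha>))"
          using True \<alpha> by (subst nn_integral_cmult) (auto simp: Gamma_scaled)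
        finally show ?thesis using True \<alpha> by (simp add: Gamma_real_nonneg mult_ac flip: ennreal_mult)
      qed (use elim in \<open>auto simp: indicator_def\<close>)
    qed
  qed
  finally have eq: "(\<integral>\<^sup>+ t. ennreal (indicator {0..} t * ?h t) \<partial>lborel) = (\<integral>\<^sup>+ s. ennreal (Gamma \<alpha> * ?g s) \<partial>lborel)" .
  have "(LBINT t:{0<..}. ?h t) = (\<integral> t. indicator {0..} t * ?h t \<partial>lborel)"
    unfolding set_lebesgue_integral_def
    by (rule integral_cong_AE) (use AE_lborel_singleton[of 0] in \<open>auto simp: indicator_def elim!: eventually_mono\<close>)
  also have "\<dots> = enn2real (\<integral>\<^sup>+ t. ennreal (indicator {0..} t * ?h t) \<partial>lborel)"
    using \<beta> by (intro integral_eq_nn_integral) (auto simp: indicator_def)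
  also have "\<dots> = (\<integral> s. Gamma \<alpha> * ?g s \<partial>lborel)"
    unfolding eq using \<alpha> by (intro integral_eq_nn_integral[symmetric]) (auto simp: Gamma_real_nonneg)
  finally have "(LBINT t:{0<..}. ?h t) = Gamma \<alpha> * (\<integral> s. ?g s \<partial>lborel)" by simp
  then have "Psi \<alpha> \<beta> = \<alpha> * Gamma \<alpha> * (\<integral> s. ?g s \<partial>lborel)" by (simp add: Psi_def)
  also have "\<alpha> * Gamma \<alpha> = Gamma (\<alpha> + 1)" using \<alpha> by (intro Gamma_plus1[symmetric]) (auto elim!: nonpos_Ints_cases)
  finally show Psi: "Psi \<alpha> \<beta> = Gamma (\<alpha> + 1) * (\<integral> s. ?g s \<partial>lborel)" .
  have "integrable lborel ?g"
    by (rule Bochner_Integration.integrable_bound[OF integrable_unit_powr[OF \<alpha>(2)]]) (use \<beta> in \<open>auto simp: indicator_def mult_left_le_one_le\<close>)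
  have "(\<integral> s. indicator {0..1::real} s * exp (- \<beta>) \<partial>lborel) \<le> (\<integral> s. ?g s \<partial>lborel)"
  proof (rule integral_mono_AE)
    show "integrable lborel ?g" by fact
    show "AE s in lborel. indicator {0..1} s * exp (- \<beta>) \<le> ?g s"
      using AE_lborel_singleton[of 0]
    proof eventually_elim
      case (elim s)
      show ?case
      proof (cases "0 < s \<and> s \<le> 1")
        case True
        then have "1 \<le> s powr (- \<alpha>)" using \<alpha> powr_mono2'[of "- \<alpha>" s 1] by simp
        moreover have "exp (- \<beta>) \<le> exp (- (s * \<beta>))" using True \<beta> by (simp add: mult_left_le_one_le)
        ultimately have "exp (- \<beta>) * 1 \<le> exp (- (s * \<beta>)) * s powr (- \<alpha>)" by (intro mult_mono) auto
        then show ?thesis using True by simp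
      qed (use elim in \<open>auto simp: indicator_def\<close>)
    qed
  qed auto
  then have "exp (- \<beta>) \<le> (\<integral> s. ?g s \<partial>lborel)" by simp
  then have "0 < (\<integral> s. ?g s \<partial>lborel)" by (rule less_le_trans[OF exp_gt_zero])
  then show "0 < Psi \<alpha> \<beta>" using \<alpha> by (simp add: Psi Gamma_real_pos)
qed

section \<open>Weighted means\<close>

text \<open>Either \<open>sqrt Q\<close> is below the threshold \<open>1 / sqrt r\<close>, or the bound \<open>1 / Q\<close> for the quotient applies. Since \<open>r\<close> is
going to be of the order of the mean of the quotient, both terms are then of smaller order than that mean.\<close>

lemma (in small_ball) sqrt_times_tests_le:
  assumes "0 < a" "0 < b" "0 < r" "q \<in> space M"
  defines "h \<equiv> (1 - exp (- (a * (Q q + b)))) / (Q q + b)"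
  shows "sqrt (Q q) * h \<le> h / sqrt r + sqrt r"
proof -
  note h = tests_bounds[OF assms(1,2) Q_nonneg[OF assms(4)], folded h_def]
  define s where "s = sqrt (Q q)"
  have s: "0 \<le> s" "Q q = s\<^sup>2" using Q_nonneg[OF assms(4)] by (auto simp: s_def)
  show ?thesis
  proof (cases "s \<le> 1 / sqrt r")
    case True
    then have "s * h \<le> 1 / sqrt r * h" using h(1) by (intro mult_right_mono)
    then show ?thesis using assms(3) by (simp add: s_def add_increasing2)
  next
    case False
    moreover have r: "0 < 1 / sqrt r" using assms(3) by simp
    ultimately have s0: "0 < s" by linarith
    then have "s * h \<le> s * (1 / s\<^sup>2)" using h(3) s by (intro mult_left_mono) auto
    also have "\<dots> = 1 / s" using s0 by (simp add: power2_eq_square)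
    also have "\<dots> \<le> 1 / (1 / sqrt r)" using False r s0 by (intro divide_left_mono) auto
    also have "\<dots> \<le> h / sqrt r + sqrt r" using h(1) assms(3) by simp
    finally show ?thesis by (simp add: s_def)
  qed
qed

text \<open>When the means of the quotient diverge, they are carried by points with \<open>Q\<close> near 0: with \<open>r\<close> their rate of
growth, \<open>sqrt_times_tests_le\<close> shows that replacing a weight by a constant \<open>w0\<close> within \<open>C sqrt Q\<close> of it changes
the means only by \<open>o(r)\<close>.\<close>

lemma (in small_ball) concentration:
  fixes a b r e :: "nat \<Rightarrow> real" and w :: "nat \<Rightarrow> 'x \<Rightarrow> real"
  defines "h \<equiv> \<lambda>k q. (1 - exp (- (a k * (Q q + b k)))) / (Q q + b k)"
  assumes a: "\<And>k. 0 < a k" and b: "\<And>k. 0 < b k"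
    and r: "\<And>k. 0 < r k" "filterlim r at_top sequentially"
    and P: "(\<lambda>k. mean_tests (a k) (b k) / r k) \<longlonglongrightarrow> P"
    and w[measurable]: "\<And>k. w k \<in> borel_measurable M"
    and near: "\<And>k q. q \<in> space M \<Longrightarrow> \<bar>w k q - w0\<bar> \<le> e k + C * sqrt (Q q)"
    and e: "e \<longlonglongrightarrow> 0" and C: "0 \<le> C"
  shows "(\<lambda>k. (\<integral> q. w k q * h k q \<partial>M) / r k) \<longlonglongrightarrow> w0 * P"
proof -
  let ?B = "\<lambda>k q. e k * h k q + C * (h k q / sqrt (r k) + sqrt (r k))"
  have h: "0 \<le> h k q" if "q \<in> space M" for k q
    unfolding h_def using tests_bounds(1)[OF a b Q_nonneg[OF that]] .
  have hint: "integrable M (h k)" for k unfolding h_def by (rule mean_tests_integrable[OF a b])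
  have Bint: "integrable M (?B k)" for k using hint by (intro Bochner_Integration.integrable_add integrable_mult_right integrable_divide) auto
  have le: "\<bar>(w k q - w0) * h k q\<bar> \<le> ?B k q" if q: "q \<in> space M" for k q
  proof -
    have "\<bar>(w k q - w0) * h k q\<bar> \<le> (e k + C * sqrt (Q q)) * h k q"
      unfolding abs_mult using near[OF q, of k] h[OF q, of k] by (simp add: mult_right_mono)
    also have "\<dots> = e k * h k q + C * (sqrt (Q q) * h k q)" by (simp add: algebra_simps)
    also have "\<dots> \<le> ?B k q"
      using sqrt_times_tests_le[OF a b r(1) q, of k k k] C
      by (intro add_left_mono mult_left_mono) (auto simp: h_def)
    finally show ?thesis .
  qed
  have [measurable]: "h k \<in> borel_measurable M" for k using hint by auto
  have dint: "integrable M (\<lambda>q. (w k q - w0) * h k q)" for k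
    by (rule Bochner_Integration.integrable_bound[OF Bint[of k]])
       (use le[of _ k] in \<open>auto intro!: AE_I2 intro: order.trans[OF _ abs_ge_self]\<close>)
  have split: "(\<integral> q. w k q * h k q \<partial>M) = (\<integral> q. (w k q - w0) * h k q \<partial>M) + w0 * mean_tests (a k) (b k)" for k
  proof -
    have "(\<integral> q. w k q * h k q \<partial>M) = (\<integral> q. (w k q - w0) * h k q + w0 * h k q \<partial>M)"
      by (simp add: algebra_simps)
    also have "\<dots> = (\<integral> q. (w k q - w0) * h k q \<partial>M) + (\<integral> q. w0 * h k q \<partial>M)"
      using dint hint by (intro Bochner_Integration.integral_add) auto
    also have "(\<integral> q. w0 * h k q \<partial>M) = w0 * mean_tests (a k) (b k)"
      unfolding mean_tests_def h_def by (rule integral_mult_right_zero)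
    finally show ?thesis .
  qed
  have "(\<lambda>k. (\<integral> q. (w k q - w0) * h k q \<partial>M) / r k) \<longlonglongrightarrow> 0"
  proof (rule Lim_null_comparison)
    let ?P = "\<lambda>k. mean_tests (a k) (b k) / r k"
    show "\<forall>\<^sub>F k in sequentially. norm ((\<integral> q. (w k q - w0) * h k q \<partial>M) / r k)
        \<le> e k * ?P k + C * (?P k / sqrt (r k) + 1 / sqrt (r k))"
    proof (intro always_eventually allI)
      fix k
      have "norm (\<integral> q. (w k q - w0) * h k q \<partial>M) \<le> (\<integral> q. norm ((w k q - w0) * h k q) \<partial>M)"
        by (rule integral_norm_bound)
      also have "\<dots> \<le> (\<integral> q. ?B k q \<partial>M)"
        by (intro integral_mono integrable_norm dint Bint) (simp only: real_norm_def le)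
      also have "\<dots> = e k * mean_tests (a k) (b k) + C * (mean_tests (a k) (b k) / sqrt (r k) + sqrt (r k))"
      proof -
        have "mean_tests (a k) (b k) = integral\<^sup>L M (h k)" by (simp add: mean_tests_def h_def)
        then show ?thesis using hint[of k] by (simp add: prob_space)
      qed
      finally have "norm (\<integral> q. (w k q - w0) * h k q \<partial>M) / r k
          \<le> (e k * mean_tests (a k) (b k) + C * (mean_tests (a k) (b k) / sqrt (r k) + sqrt (r k))) / r k"
        using r(1)[of k] by (intro divide_right_mono) auto
      also have "\<dots> = e k * ?P k + C * (?P k / sqrt (r k) + 1 / sqrt (r k))"
      proof -
        have "sqrt (r k) / r k = 1 / sqrt (r k)" using r(1)[of k] by (simp add: real_div_sqrt field_simps)
        moreover have "(e k * u + C * (u / s + s)) / r k = e k * (u / r k) + C * (u / r k / s + s / r k)" for u s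
          using r(1)[of k] by (simp add: add_divide_distrib distrib_left)
        ultimately show ?thesis by (simp only:)
      qed
      finally show "norm ((\<integral> q. (w k q - w0) * h k q \<partial>M) / r k) \<le> e k * ?P k + C * (?P k / sqrt (r k) + 1 / sqrt (r k))"
        using r(1)[of k] by simp
    qed
    have inv: "(\<lambda>k. 1 / sqrt (r k)) \<longlonglongrightarrow> 0"
      by (rule filterlim_compose[OF _ r(2)]) real_asymp
    have "(\<lambda>k. e k * ?P k + C * (?P k * (1 / sqrt (r k)) + 1 / sqrt (r k))) \<longlonglongrightarrow> 0 * P + C * (P * 0 + 0)"
      by (intro tendsto_intros e P inv)
    then show "(\<lambda>k. e k * ?P k + C * (?P k / sqrt (r k) + 1 / sqrt (r k))) \<longlonglongrightarrow> 0" by simp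
  qed
  from tendsto_add[OF this tendsto_mult[OF tendsto_const[of w0] P]]
  show ?thesis by (simp add: split add_divide_distrib)
qed

text \<open>Without divergence there is no concentration: the quotient tends to \<open>1 / Q\<close>, which also bounds it and is
integrable, so dominated convergence applies with any bounded convergent weights.\<close>

lemma (in small_ball) inverse_misfit_limit:
  fixes a b :: "nat \<Rightarrow> real" and w :: "nat \<Rightarrow> 'x \<Rightarrow> real"
  assumes \<alpha>: "1 < \<alpha>" and a: "\<And>k. 0 < a k" "filterlim a at_top sequentially"
    and b: "\<And>k. 0 < b k" and ab: "(\<lambda>k. a k * b k) \<longlonglongrightarrow> \<beta>"
    and w[measurable]: "\<And>k. w k \<in> borel_measurable M"
    and bound: "\<And>k q. q \<in> space M \<Longrightarrow> \<bar>w k q\<bar> \<le> B"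
    and lim: "\<And>q. q \<in> space M \<Longrightarrow> (\<lambda>k. w k q) \<longlonglongrightarrow> v q"
  shows "(\<lambda>k. \<integral> q. w k q * ((1 - exp (- (a k * (Q q + b k)))) / (Q q + b k)) \<partial>M) \<longlonglongrightarrow> (\<integral> q. v q / Q q \<partial>M)"
proof (rule integral_dominated_convergence[where w = "\<lambda>q. B * (1 / Q q)"])
  have v[measurable]: "v \<in> borel_measurable M" by (rule borel_measurable_LIMSEQ_real[OF lim w])
  show "(\<lambda>q. v q / Q q) \<in> borel_measurable M" by measurable
  show "integrable M (\<lambda>q. B * (1 / Q q))" using inverse_Q_integrable[OF \<alpha>] by (rule integrable_mult_right)
  show "AE q in M. (\<lambda>k. w k q * ((1 - exp (- (a k * (Q q + b k)))) / (Q q + b k))) \<longlonglongrightarrow> v q / Q q"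
    using Q_pos_AE AE_space
  proof eventually_elim
    case (elim q)
    have "filterlim (\<lambda>k. a k * b k + a k * Q q) at_top sequentially"
      using elim by (intro filterlim_tendsto_add_at_top[OF ab] filterlim_at_top_mult_tendsto_pos[OF tendsto_const _ a(2)]) auto
    then have "filterlim (\<lambda>k. a k * (Q q + b k)) at_top sequentially" by (simp add: algebra_simps)
    then have "(\<lambda>k. exp (- (a k * (Q q + b k)))) \<longlonglongrightarrow> 0"
      by (rule filterlim_compose[rotated]) real_asymp
    moreover have "b \<longlonglongrightarrow> 0"
    proof -
      have "(\<lambda>k. a k * b k * (1 / a k)) \<longlonglongrightarrow> \<beta> * 0"
        by (intro tendsto_mult ab filterlim_compose[OF _ a(2)]) real_asymp
      moreover have "a k * b k * (1 / a k) = b k" for k using a(1)[of k] by simp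
      ultimately show ?thesis by simp
    qed
    ultimately have "(\<lambda>k. w k q * ((1 - exp (- (a k * (Q q + b k)))) / (Q q + b k))) \<longlonglongrightarrow> v q * ((1 - 0) / (Q q + 0))"
      using elim by (intro tendsto_intros lim) auto
    then show ?case by simp
  qed
  show "AE q in M. norm (w k q * ((1 - exp (- (a k * (Q q + b k)))) / (Q q + b k))) \<le> B * (1 / Q q)" for k
    using Q_pos_AE AE_space
  proof eventually_elim
    case (elim q)
    note h = tests_bounds(1,3)[OF a(1)[of k] b[of k], of "Q q"]
    have "\<bar>w k q\<bar> * \<bar>(1 - exp (- (a k * (Q q + b k)))) / (Q q + b k)\<bar> \<le> B * (1 / Q q)"
      using elim h bound[of q k] by (intro mult_mono) (auto simp del: abs_divide)
    then show ?case by (simp only: real_norm_def abs_mult)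
  qed
qed measurable

text \<open>The misfit is positive almost everywhere, so the extended quotient is the real one. The value is needed to be
positive because an asymptotic equivalence to 0 would say more than the limit does.\<close>

lemma I_const_eq:
  fixes y :: "real ^ 'j::finite"
  assumes sb: "small_ball \<mu> (\<lambda>q. misfit y (p q)) c \<alpha>" and \<alpha>: "1 < \<alpha>"
    and x: "\<And>q j. q \<in> space \<mu> \<Longrightarrow> p q $ j \<in> {0..1}" and y: "\<And>j. y $ j \<in> {0..1}"
    and meas[measurable]: "(\<lambda>q. kappa_tot y (p q)) \<in> borel_measurable \<mu>"
  shows "I_const \<mu> p y = ennreal (\<integral> q. kappa_tot y (p q) / misfit y (p q) \<partial>\<mu>)"
    and "0 < (\<integral> q. kappa_tot y (p q) / misfit y (p q) \<partial>\<mu>)"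
proof -
  interpret small_ball \<mu> "\<lambda>q. misfit y (p q)" c \<alpha> by fact
  let ?f = "\<lambda>q. kappa_tot y (p q) / misfit y (p q)"
  have \<kappa>: "0 < kappa_tot y (p q)" "kappa_tot y (p q) \<le> 4 * CARD('j)" if "q \<in> space \<mu>" for q
    using kappa_tot_pos[OF y x[OF that]] kappa_tot_le[OF y x[OF that]] by auto
  have "integrable \<mu> (\<lambda>q. (4 * CARD('j)) * (1 / misfit y (p q)))"
    using inverse_Q_integrable[OF \<alpha>] by (rule integrable_mult_right)
  then have int: "integrable \<mu> ?f"
  proof (rule Bochner_Integration.integrable_bound)
    show "AE q in \<mu>. norm (?f q) \<le> norm ((4 * CARD('j)) * (1 / misfit y (p q)))"
      using \<kappa> misfit_nonneg by (intro AE_I2) (auto intro!: divide_right_mono simp: abs_of_pos)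
  qed measurable
  have pos: "AE q in \<mu>. 0 < ?f q"
    using Q_pos_AE AE_space by eventually_elim (use \<kappa> in auto)
  have "I_const \<mu> p y = (\<integral>\<^sup>+ q. ennreal (?f q) \<partial>\<mu>)"
    unfolding I_const_def
  proof (rule nn_integral_cong_AE)
    show "AE q in \<mu>. ennreal (kappa_tot y (p q)) / ennreal (misfit y (p q)) = ennreal (?f q)"
      using Q_pos_AE AE_space by eventually_elim (use \<kappa> in \<open>auto intro!: divide_ennreal less_imp_le\<close>)
  qed
  also have "\<dots> = ennreal (integral\<^sup>L \<mu> ?f)"
    using int pos by (intro nn_integral_eq_integral) (auto elim!: eventually_mono)
  finally show "I_const \<mu> p y = ennreal (integral\<^sup>L \<mu> ?f)" .
  show "0 < integral\<^sup>L \<mu> ?f"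
  proof -
    have "0 \<le> integral\<^sup>L \<mu> ?f" using pos by (intro integral_nonneg_AE) (auto elim!: eventually_mono)
    moreover have "integral\<^sup>L \<mu> ?f \<noteq> 0"
    proof
      assume "integral\<^sup>L \<mu> ?f = 0"
      moreover have "AE q in \<mu>. 0 \<le> ?f q" using pos by (auto elim!: eventually_mono)
      ultimately have "AE q in \<mu>. ?f q = 0" using integral_nonneg_eq_0_iff_AE[OF int] by blast
      with pos have "AE q in \<mu>. False" by eventually_elim auto
      then show False by simp
    qed
    ultimately show ?thesis by simp
  qed
qed

lemma mean_coins_tot_limit:
  fixes y x :: "real ^ 'j::finite" and n :: "nat \<Rightarrow> nat"
  assumes "\<And>j. y $ j \<in> {0..1}" "\<And>j. x $ j \<in> {0..1}" "\<And>k. n k \<ge> 2"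
    and n: "filterlim n at_top sequentially"
  shows "(\<lambda>k. mean_coins_tot (n k) y x / n k) \<longlonglongrightarrow> kappa_tot y x"
proof -
  have "(\<lambda>k. mean_coins_tot (n k) y x / n k - kappa_tot y x) \<longlonglongrightarrow> 0"
  proof (rule Lim_null_comparison)
    show "\<forall>\<^sub>F k in sequentially. norm (mean_coins_tot (n k) y x / n k - kappa_tot y x) \<le> CARD('j) * (14 / sqrt (n k))"
      using assms by (intro always_eventually allI) (simp only: real_norm_def, rule mean_coins_tot_close)
    show "(\<lambda>k. CARD('j) * (14 / sqrt (n k))) \<longlonglongrightarrow> 0"
      by (rule filterlim_compose[OF _ n]) real_asymp
  qed
  then show ?thesis by (simp add: LIM_zero_iff)
qed

section \<open>Asymptotics of the expected cost\<close>

text \<open>Along a sequence of parameters the expected cost is \<open>\<gamma> exp (a b) n\<close> times the mean of \<open>K\<^sub>n / n\<close> against the quotient,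
and the three factors converge after normalisation by \<open>1\<close>, \<open>a\<close> and the rate of the last mean. Sequences are used
because dominated convergence is a statement about them.\<close>

lemma E_W_act_limits_pos:
  fixes \<mu> :: "'x measure" and y :: "real ^ 'j::finite" and a :: "nat \<Rightarrow> real" and n :: "nat \<Rightarrow> nat"
  assumes sb: "small_ball \<mu> (\<lambda>q. misfit y (p q)) c \<alpha>"
    and p[measurable]: "p \<in> borel_measurable \<mu>"
    and x: "\<And>q j. q \<in> space \<mu> \<Longrightarrow> p q $ j \<in> {0..1}" and y: "\<And>j. y $ j \<in> {0..1}"
    and \<gamma>: "0 < \<gamma>" and a: "\<And>k. 1 < a k" "filterlim a at_top sequentially"
    and n: "\<And>k. n k \<ge> 2" "filterlim n at_top sequentially"
    and \<theta>: "(\<lambda>k. real (n k) / a k) \<longlonglongrightarrow> \<theta>"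
    and b_pos: "\<And>k. 0 < bern_b_tot (n k) y" and b_lim: "(\<lambda>k. a k * bern_b_tot (n k) y) \<longlonglongrightarrow> \<beta>" and \<beta>: "0 < \<beta>"
  shows "\<alpha> < 1 \<Longrightarrow> (\<lambda>k. E_W_act \<mu> p \<gamma> (a k) (n k) y / a k powr (2 - \<alpha>))
      \<longlonglongrightarrow> \<gamma> * exp \<beta> * \<theta> * c * kappa_tot y y * Psi \<alpha> \<beta>"
    and "\<alpha> = 1 \<Longrightarrow> (\<lambda>k. E_W_act \<mu> p \<gamma> (a k) (n k) y / (a k * ln (a k)))
      \<longlonglongrightarrow> \<gamma> * exp \<beta> * \<theta> * c * kappa_tot y y"
    and "\<alpha> > 1 \<Longrightarrow> (\<lambda>k. E_W_act \<mu> p \<gamma> (a k) (n k) y / a k)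
      \<longlonglongrightarrow> \<gamma> * exp \<beta> * \<theta> * (\<integral> q. kappa_tot y (p q) / misfit y (p q) \<partial>\<mu>)"
proof -
  interpret small_ball \<mu> "\<lambda>q. misfit y (p q)" c \<alpha> by fact
  define b where "b k = bern_b_tot (n k) y" for k
  define w where "w k q = mean_coins_tot (n k) y (p q) / n k" for k q
  define h where "h k q = (1 - exp (- (a k * (misfit y (p q) + b k)))) / (misfit y (p q) + b k)" for k q
  define J where "J k = (\<integral> q. w k q * h k q \<partial>\<mu>)" for k
  have a0: "0 < a k" for k using a(1)[of k] by simp
  note b = b_pos[folded b_def] and ab = b_lim[folded b_def]
  have E: "E_W_act \<mu> p \<gamma> (a k) (n k) y = \<gamma> * exp (a k * b k) * (real (n k) * J k)" for k
  proof -
    have "J k = (\<integral> q. (1 / n k) * (mean_coins_tot (n k) y (p q) * tests_per_label (a k) (n k) y (p q)) \<partial>\<mu>)"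
      by (simp add: J_def w_def h_def tests_per_label_def b_def)
    also have "\<dots> = (1 / n k) * (\<integral> q. mean_coins_tot (n k) y (p q) * tests_per_label (a k) (n k) y (p q) \<partial>\<mu>)"
      by (rule integral_mult_right_zero)
    finally show ?thesis
      using n(1)[of k] E_W_act_eq[OF prob_space_axioms p x y n(1)[of k] a0[of k] \<gamma>] b[of k] by (simp add: b_def)
  qed
  have w_meas: "w k \<in> borel_measurable \<mu>" for k unfolding w_def by measurable
  let ?e = "\<lambda>k. CARD('j) * (14 / sqrt (n k))"
  have e: "?e \<longlonglongrightarrow> 0" by (rule filterlim_compose[OF _ n(2)]) real_asymp
  have near: "\<bar>w k q - kappa_tot y y\<bar> \<le> ?e k + 4 * CARD('j) * sqrt (misfit y (p q))" if "q \<in> space \<mu>" for k q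
  proof -
    have "\<bar>w k q - kappa_tot y (p q)\<bar> \<le> ?e k"
      unfolding w_def by (rule mean_coins_tot_close[OF y x[OF that] n(1)])
    with kappa_tot_near[OF y x[OF that]] show ?thesis by linarith
  qed
  have factor: "(\<lambda>k. \<gamma> * exp (a k * b k) * (real (n k) / a k)) \<longlonglongrightarrow> \<gamma> * exp \<beta> * \<theta>"
    by (intro tendsto_intros ab \<theta>)
  show "(\<lambda>k. E_W_act \<mu> p \<gamma> (a k) (n k) y / a k powr (2 - \<alpha>))
      \<longlonglongrightarrow> \<gamma> * exp \<beta> * \<theta> * c * kappa_tot y y * Psi \<alpha> \<beta>" if \<alpha>: "\<alpha> < 1"
  proof -
    have r: "filterlim (\<lambda>k. a k powr (1 - \<alpha>)) at_top sequentially"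
      using \<alpha> by (intro filterlim_compose[OF _ a(2)]) real_asymp
    have "(\<lambda>k. mean_tests (a k) (b k) / a k powr (1 - \<alpha>)) \<longlonglongrightarrow> c * Psi \<alpha> \<beta>"
      unfolding Psi_eq(1)[OF \<alpha>_pos \<alpha> \<beta>] by (rule mean_tests_limit_lt_1[OF \<alpha> a0 a(2) b ab])
    from concentration[OF a0 b _ r this w_meas near e, folded h_def J_def]
    have "(\<lambda>k. J k / a k powr (1 - \<alpha>)) \<longlonglongrightarrow> kappa_tot y y * (c * Psi \<alpha> \<beta>)"
      using a0 by (simp add: less_imp_neq[symmetric])
    from tendsto_mult[OF factor this]
    have "(\<lambda>k. \<gamma> * exp (a k * b k) * (real (n k) / a k) * (J k / a k powr (1 - \<alpha>)))
      \<longlonglongrightarrow> \<gamma> * exp \<beta> * \<theta> * c * kappa_tot y y * Psi \<alpha> \<beta>" by (simp add: mult_ac)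
    then show ?thesis
    proof (rule Lim_transform_eventually)
      have "a k powr (2 - \<alpha>) = a k * a k powr (1 - \<alpha>)" for k
        using a0[of k] powr_add[of "a k" 1 "1 - \<alpha>"] by simp
      then show "\<forall>\<^sub>F k in sequentially. \<gamma> * exp (a k * b k) * (real (n k) / a k) * (J k / a k powr (1 - \<alpha>))
          = E_W_act \<mu> p \<gamma> (a k) (n k) y / a k powr (2 - \<alpha>)"
        by (simp add: E)
    qed
  qed
  show "(\<lambda>k. E_W_act \<mu> p \<gamma> (a k) (n k) y / (a k * ln (a k)))
      \<longlonglongrightarrow> \<gamma> * exp \<beta> * \<theta> * c * kappa_tot y y" if \<alpha>: "\<alpha> = 1"
  proof -
    have r: "filterlim (\<lambda>k. ln (a k)) at_top sequentially"
      by (intro filterlim_compose[OF _ a(2)]) real_asymp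
    have ln_pos: "0 < ln (a k)" for k using a(1)[of k] by simp
    have "(\<lambda>k. mean_tests (a k) (b k) / ln (a k)) \<longlonglongrightarrow> c"
      by (rule mean_tests_limit_eq_1[OF \<alpha> a b ab])
    from concentration[OF a0 b ln_pos r this w_meas near e, folded h_def J_def]
    have "(\<lambda>k. J k / ln (a k)) \<longlonglongrightarrow> kappa_tot y y * c" by simp
    from tendsto_mult[OF factor this] show ?thesis by (simp add: E mult_ac)
  qed
  show "(\<lambda>k. E_W_act \<mu> p \<gamma> (a k) (n k) y / a k)
      \<longlonglongrightarrow> \<gamma> * exp \<beta> * \<theta> * (\<integral> q. kappa_tot y (p q) / misfit y (p q) \<partial>\<mu>)" if \<alpha>: "\<alpha> > 1"
  proof -
    have "\<bar>w k q\<bar> \<le> real CARD('j) * 18" if q: "q \<in> space \<mu>" for k q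
    proof -
      have "\<bar>w k q - kappa_tot y (p q)\<bar> \<le> ?e k"
        unfolding w_def by (rule mean_coins_tot_close[OF y x[OF q] n(1)])
      moreover have "0 < kappa_tot y (p q)" "kappa_tot y (p q) \<le> 4 * CARD('j)"
        by (intro kappa_tot_pos kappa_tot_le y x q)+
      moreover have "?e k \<le> real CARD('j) * 14"
      proof -
        have "1 \<le> sqrt (n k)" using n(1)[of k] by simp
        then have "14 / sqrt (n k) \<le> 14 / 1" by (intro divide_left_mono) auto
        from mult_left_mono[OF this, of "real CARD('j)"] show ?thesis by simp
      qed
      ultimately show ?thesis by linarith
    qed
    from inverse_misfit_limit[OF \<alpha> a0 a(2) b ab w_meas this mean_coins_tot_limit[OF y x n, folded w_def]]
    have "J \<longlonglongrightarrow> (\<integral> q. kappa_tot y (p q) / misfit y (p q) \<partial>\<mu>)"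
      by (simp add: J_def[abs_def] h_def)
    from tendsto_mult[OF factor this] show ?thesis by (simp add: E mult_ac)
  qed
qed

text \<open>Conditions that hold only eventually may be assumed for all members of the sequence, since initial segments do
not influence limits.\<close>

lemma tendsto_at_right_0_sequentially:
  fixes f :: "real \<Rightarrow> real"
  assumes P: "\<forall>\<^sub>F \<sigma> in at_right 0. P \<sigma>"
    and seq: "\<And>X. (\<And>k. P (X k)) \<Longrightarrow> filterlim X (at_right 0) sequentially \<Longrightarrow> (\<lambda>k. f (X k)) \<longlonglongrightarrow> L"
  shows "(f \<longlongrightarrow> L) (at_right 0)"
  unfolding tendsto_at_iff_sequentially
proof (intro allI impI)
  fix X :: "nat \<Rightarrow> real" assume X: "\<forall>i. X i \<in> {0<..} - {0}" "X \<longlonglongrightarrow> 0"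
  have "0 < X i" for i using X(1) by simp
  then have "X i \<in> {0<..} \<and> X i \<noteq> 0" for i by (simp add: less_imp_neq[symmetric])
  with X(2) have lim: "filterlim X (at_right 0) sequentially"
    by (simp add: filterlim_at)
  from P lim have "\<forall>\<^sub>F k in sequentially. P (X k)" by (rule eventually_compose_filterlim)
  then obtain N where "\<And>k. k \<ge> N \<Longrightarrow> P (X k)" by (auto simp: eventually_sequentially)
  moreover have "filterlim (\<lambda>k. X (k + N)) (at_right 0) sequentially"
    by (rule filterlim_compose[OF lim]) (rule filterlim_add_const_nat_at_top)
  ultimately have "(\<lambda>k. f (X (k + N))) \<longlonglongrightarrow> L" by (intro seq) auto
  then show "(f \<circ> X) \<longlonglongrightarrow> L" unfolding comp_def by (rule LIMSEQ_offset)
qed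

lemma a_sigma_at_top: "filterlim a_sigma at_top (at_right 0)"
  unfolding a_sigma_def by real_asymp

theorem theorem3p11:
  fixes \<mu>0 :: "'x measure"
    and p :: "'x \<Rightarrow> real ^ 'j::finite"
    and y :: "real ^ 'j"
    and \<gamma> c \<alpha> \<theta> \<beta> :: real
    and n :: "real \<Rightarrow> nat"
    and EW :: "real \<Rightarrow> real"
  assumes "prob_space \<mu>0"
    and "p \<in> borel_measurable \<mu>0"
    and "\<And>q j. q \<in> space \<mu>0 \<Longrightarrow> p q $ j \<in> {0..1}"
    and "\<And>j. y $ j \<in> {0<..<1}"
    and "\<gamma> > 0"
    and "c > 0" and "\<alpha> > 0"
    and "(\<lambda>t. measure \<mu>0 {q \<in> space \<mu>0. misfit y (p q) \<le> t})
           \<sim>[at_right 0] (\<lambda>t. c * t powr \<alpha>)"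
    and "\<And>\<sigma>. \<sigma> > 0 \<Longrightarrow> n \<sigma> \<ge> 2"
    and "\<theta> > 0"
    and "((\<lambda>\<sigma>. real (n \<sigma>) / a_sigma \<sigma>) \<longlongrightarrow> \<theta>) (at_right 0)"
  defines "\<beta> \<equiv> D_const y / \<theta>"
    and "EW \<equiv> \<lambda>\<sigma>. E_W_act \<mu>0 p \<gamma> (a_sigma \<sigma>) (n \<sigma>) y"
  shows "(\<alpha> < 1 \<longrightarrow>
            EW \<sim>[at_right 0] (\<lambda>\<sigma>. \<gamma> * exp \<beta> * \<theta> * c * kappa_tot y y * Psi \<alpha> \<beta>
                                    * a_sigma \<sigma> powr (2 - \<alpha>)))
       \<and> (\<alpha> = 1 \<longrightarrow>
            EW \<sim>[at_right 0] (\<lambda>\<sigma>. \<gamma> * exp \<beta> * \<theta> * c * kappa_tot y y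
                                    * a_sigma \<sigma> * ln (a_sigma \<sigma>)))
       \<and> (\<alpha> > 1 \<longrightarrow>
            I_const \<mu>0 p y < \<infinity> \<and>
            EW \<sim>[at_right 0] (\<lambda>\<sigma>. \<gamma> * exp \<beta> * \<theta> * enn2real (I_const \<mu>0 p y) * a_sigma \<sigma>))
       \<and> (\<alpha> < 1 \<longrightarrow> EW \<in> \<Theta>[at_right 0](\<lambda>\<sigma>. \<gamma> * \<sigma> powr (- 4 + 2 * \<alpha>)))
       \<and> (\<alpha> = 1 \<longrightarrow> EW \<in> \<Theta>[at_right 0](\<lambda>\<sigma>. \<gamma> * \<sigma> powr (- 2) * ln (1 / \<sigma>)))
       \<and> (\<alpha> > 1 \<longrightarrow> EW \<in> \<Theta>[at_right 0](\<lambda>\<sigma>. \<gamma> * \<sigma> powr (- 2)))"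
proof -
  note p = assms(2) and x = assms(3) and \<gamma> = assms(5) and c = assms(6) and \<alpha>0 = assms(7)
    and n2 = assms(9) and \<theta> = assms(10) and n\<theta> = assms(11)
  have y: "y $ j \<in> {0..1}" for j using assms(4)[of j] by auto
  have misfit_meas: "(\<lambda>q. misfit y (p q)) \<in> borel_measurable \<mu>0"
    by (rule measurable_compose[OF p measurable_misfit])
  have sb: "small_ball \<mu>0 (\<lambda>q. misfit y (p q)) c \<alpha>"
    using assms(1,6,7,8) misfit_meas
    by (auto intro!: small_ball.intro small_ball_axioms.intro misfit_nonneg)
  have D: "0 < D_const y" unfolding D_const_def using assms(4) by (intro sum_pos) auto
  then have \<beta>: "0 < \<beta>" using \<theta> by (simp add: \<beta>_def)
  have \<kappa>: "0 < kappa_tot y y" by (intro kappa_tot_pos y)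

  have n_top: "filterlim n at_top (at_right 0)"
  proof -
    have "filterlim (\<lambda>\<sigma>. real (n \<sigma>) / a_sigma \<sigma> * a_sigma \<sigma>) at_top (at_right 0)"
      by (rule filterlim_tendsto_pos_mult_at_top[OF n\<theta> \<theta> a_sigma_at_top])
    moreover have "\<forall>\<^sub>F \<sigma> in at_right 0. real (n \<sigma>) / a_sigma \<sigma> * a_sigma \<sigma> = real (n \<sigma>)"
      using eventually_at_right_less[of 0] by eventually_elim (simp add: a_sigma_def)
    ultimately have "filterlim (\<lambda>\<sigma>. real (n \<sigma>)) at_top (at_right 0)"
      by (simp cong: filterlim_cong)
    then have "\<forall>\<^sub>F \<sigma> in at_right 0. real Z \<le> real (n \<sigma>)" for Z
      unfolding filterlim_at_top by blast
    then show ?thesis unfolding filterlim_at_top by simp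
  qed
  have nb: "((\<lambda>\<sigma>. real (n \<sigma>) * bern_b_tot (n \<sigma>) y) \<longlongrightarrow> D_const y) (at_right 0)"
    by (rule filterlim_compose[OF bern_b_tot_tendsto[OF y] n_top])
  have ab: "((\<lambda>\<sigma>. a_sigma \<sigma> * bern_b_tot (n \<sigma>) y) \<longlongrightarrow> \<beta>) (at_right 0)"
  proof (rule Lim_transform_eventually)
    show "((\<lambda>\<sigma>. real (n \<sigma>) * bern_b_tot (n \<sigma>) y / (real (n \<sigma>) / a_sigma \<sigma>)) \<longlongrightarrow> \<beta>) (at_right 0)"
      unfolding \<beta>_def using \<theta> by (intro tendsto_divide nb n\<theta>) auto
    show "\<forall>\<^sub>F \<sigma> in at_right 0. real (n \<sigma>) * bern_b_tot (n \<sigma>) y / (real (n \<sigma>) / a_sigma \<sigma>)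
        = a_sigma \<sigma> * bern_b_tot (n \<sigma>) y"
      using eventually_at_right_less[of 0]
    proof eventually_elim
      case (elim \<sigma>)
      show ?case using n2[OF elim] elim by (simp add: a_sigma_def)
    qed
  qed
  \<comment> \<open>What the exact formula and the logarithm need; it holds for all sufficiently small \<open>\<sigma>\<close>.\<close>
  define P where "P \<sigma> \<longleftrightarrow> 0 < \<sigma> \<and> 1 < a_sigma \<sigma> \<and> 0 < bern_b_tot (n \<sigma>) y" for \<sigma>
  have P: "\<forall>\<^sub>F \<sigma> in at_right 0. P \<sigma>"
  proof -
    have "\<forall>\<^sub>F \<sigma> in at_right 0. 0 < a_sigma \<sigma> * bern_b_tot (n \<sigma>) y"
      using order_tendstoD(1)[OF ab \<beta>] .
    moreover have "\<forall>\<^sub>F \<sigma> in at_right 0. 1 < a_sigma \<sigma>"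
      using a_sigma_at_top unfolding filterlim_at_top_dense by blast
    ultimately show ?thesis
      using eventually_at_right_less[of 0] by eventually_elim (auto simp: P_def zero_less_mult_iff)
  qed
  have limits:
    "\<alpha> < 1 \<Longrightarrow> (\<lambda>k. EW (X k) / a_sigma (X k) powr (2 - \<alpha>))
      \<longlonglongrightarrow> \<gamma> * exp \<beta> * \<theta> * c * kappa_tot y y * Psi \<alpha> \<beta>"
    "\<alpha> = 1 \<Longrightarrow> (\<lambda>k. EW (X k) / (a_sigma (X k) * ln (a_sigma (X k))))
      \<longlonglongrightarrow> \<gamma> * exp \<beta> * \<theta> * c * kappa_tot y y"
    "\<alpha> > 1 \<Longrightarrow> (\<lambda>k. EW (X k) / a_sigma (X k))
      \<longlonglongrightarrow> \<gamma> * exp \<beta> * \<theta> * (\<integral> q. kappa_tot y (p q) / misfit y (p q) \<partial>\<mu>0)"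
    if PX: "\<And>k. P (X k)" and X: "filterlim X (at_right 0) sequentially" for X
    unfolding EW_def
    using PX n2
    by (intro E_W_act_limits_pos[OF sb p x y \<gamma> _ filterlim_compose[OF a_sigma_at_top X] _
          filterlim_compose[OF n_top X] filterlim_compose[OF n\<theta> X] _ filterlim_compose[OF ab X] \<beta>];
        simp add: P_def)+
  have 1: "EW \<sim>[at_right 0] (\<lambda>\<sigma>. \<gamma> * exp \<beta> * \<theta> * c * kappa_tot y y * Psi \<alpha> \<beta> * a_sigma \<sigma> powr (2 - \<alpha>))"
    if \<alpha>: "\<alpha> < 1"
  proof (rule asymp_equivI'_const)
    show "((\<lambda>\<sigma>. EW \<sigma> / a_sigma \<sigma> powr (2 - \<alpha>)) \<longlongrightarrow> \<gamma> * exp \<beta> * \<theta> * c * kappa_tot y y * Psi \<alpha> \<beta>) (at_right 0)"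
      by (rule tendsto_at_right_0_sequentially[OF P limits(1)[OF _ _ \<alpha>]])
    show "\<gamma> * exp \<beta> * \<theta> * c * kappa_tot y y * Psi \<alpha> \<beta> \<noteq> 0"
      using \<gamma> \<theta> c \<kappa> Psi_eq(2)[OF \<alpha>0 \<alpha> \<beta>] by simp
  qed
  have 2: "EW \<sim>[at_right 0] (\<lambda>\<sigma>. \<gamma> * exp \<beta> * \<theta> * c * kappa_tot y y * a_sigma \<sigma> * ln (a_sigma \<sigma>))"
    if \<alpha>: "\<alpha> = 1"
  proof -
    have "EW \<sim>[at_right 0] (\<lambda>\<sigma>. (\<gamma> * exp \<beta> * \<theta> * c * kappa_tot y y) * (a_sigma \<sigma> * ln (a_sigma \<sigma>)))"
    proof (rule asymp_equivI'_const)
      show "((\<lambda>\<sigma>. EW \<sigma> / (a_sigma \<sigma> * ln (a_sigma \<sigma>))) \<longlongrightarrow> \<gamma> * exp \<beta> * \<theta> * c * kappa_tot y y) (at_right 0)"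
        by (rule tendsto_at_right_0_sequentially[OF P limits(2)[OF _ _ \<alpha>]])
    qed (use \<gamma> \<theta> c \<kappa> in simp)
    then show ?thesis by (simp only: mult.assoc)
  qed
  have "(\<lambda>q. kappa_tot y (p q)) \<in> borel_measurable \<mu>0"
  proof (rule borel_measurable_LIMSEQ_real)
    show "(\<lambda>k. mean_coins_tot (k + 2) y (p q) / real (k + 2)) \<longlonglongrightarrow> kappa_tot y (p q)" if "q \<in> space \<mu>0" for q
      by (rule mean_coins_tot_limit[OF y x[OF that] _ filterlim_add_const_nat_at_top]) simp
    show "(\<lambda>q. mean_coins_tot (k + 2) y (p q) / real (k + 2)) \<in> borel_measurable \<mu>0" for k
      using measurable_compose[OF p measurable_mean_coins_tot[of "k + 2" y]] by (intro borel_measurable_divide) auto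
  qed
  note I = I_const_eq[OF sb _ x y this]
  have 3: "I_const \<mu>0 p y < \<infinity>"
    "EW \<sim>[at_right 0] (\<lambda>\<sigma>. \<gamma> * exp \<beta> * \<theta> * enn2real (I_const \<mu>0 p y) * a_sigma \<sigma>)"
    "enn2real (I_const \<mu>0 p y) > 0" if \<alpha>: "\<alpha> > 1"
  proof -
    let ?I = "\<integral> q. kappa_tot y (p q) / misfit y (p q) \<partial>\<mu>0"
    show "I_const \<mu>0 p y < \<infinity>" by (simp add: I(1)[OF \<alpha>])
    have I_real: "enn2real (I_const \<mu>0 p y) = ?I" using I(2)[OF \<alpha>] by (simp add: I(1)[OF \<alpha>])
    then show "enn2real (I_const \<mu>0 p y) > 0" using I(2)[OF \<alpha>] by simp
    show "EW \<sim>[at_right 0] (\<lambda>\<sigma>. \<gamma> * exp \<beta> * \<theta> * enn2real (I_const \<mu>0 p y) * a_sigma \<sigma>)"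
    proof (rule asymp_equivI'_const)
      show "((\<lambda>\<sigma>. EW \<sigma> / a_sigma \<sigma>) \<longlongrightarrow> \<gamma> * exp \<beta> * \<theta> * enn2real (I_const \<mu>0 p y)) (at_right 0)"
        unfolding I_real
        by (rule tendsto_at_right_0_sequentially[OF P limits(3)[OF _ _ \<alpha>]])
    qed (use \<gamma> \<theta> I(2)[OF \<alpha>] I_real in simp)
  qed
  have 4: "EW \<in> \<Theta>[at_right 0](\<lambda>\<sigma>. \<gamma> * \<sigma> powr (- 4 + 2 * \<alpha>))" if \<alpha>: "\<alpha> < 1"
  proof -
    define C where "C = \<gamma> * exp \<beta> * \<theta> * c * kappa_tot y y * Psi \<alpha> \<beta>"
    have C: "C > 0" using \<gamma> \<theta> c \<kappa> Psi_eq(2)[OF \<alpha>0 \<alpha> \<beta>] by (simp add: C_def)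
    have "EW \<in> \<Theta>[at_right 0](\<lambda>\<sigma>. C * a_sigma \<sigma> powr (2 - \<alpha>))"
      using 1[OF \<alpha>] unfolding C_def by (rule asymp_equiv_imp_bigtheta)
    also have "(\<lambda>\<sigma>. C * a_sigma \<sigma> powr (2 - \<alpha>)) \<in> \<Theta>[at_right 0](\<lambda>\<sigma>. \<gamma> * \<sigma> powr (- 4 + 2 * \<alpha>))"
      unfolding a_sigma_def using C \<gamma> by real_asymp
    finally show ?thesis .
  qed
  have 5: "EW \<in> \<Theta>[at_right 0](\<lambda>\<sigma>. \<gamma> * \<sigma> powr (- 2) * ln (1 / \<sigma>))" if \<alpha>: "\<alpha> = 1"
  proof -
    define C where "C = \<gamma> * exp \<beta> * \<theta> * c * kappa_tot y y"
    have C: "C > 0" using \<gamma> \<theta> c \<kappa> by (simp add: C_def)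
    have "EW \<in> \<Theta>[at_right 0](\<lambda>\<sigma>. C * a_sigma \<sigma> * ln (a_sigma \<sigma>))"
      using 2[OF \<alpha>] unfolding C_def by (rule asymp_equiv_imp_bigtheta)
    also have "(\<lambda>\<sigma>. C * a_sigma \<sigma> * ln (a_sigma \<sigma>)) \<in> \<Theta>[at_right 0](\<lambda>\<sigma>. \<gamma> * \<sigma> powr (- 2) * ln (1 / \<sigma>))"
      unfolding a_sigma_def using C \<gamma> by real_asymp
    finally show ?thesis .
  qed
  have 6: "EW \<in> \<Theta>[at_right 0](\<lambda>\<sigma>. \<gamma> * \<sigma> powr (- 2))" if \<alpha>: "\<alpha> > 1"
  proof -
    define C where "C = \<gamma> * exp \<beta> * \<theta> * enn2real (I_const \<mu>0 p y)"
    have C: "C > 0" using \<gamma> \<theta> 3(3)[OF \<alpha>] by (simp add: C_def)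
    have "EW \<in> \<Theta>[at_right 0](\<lambda>\<sigma>. C * a_sigma \<sigma>)"
      using 3(2)[OF \<alpha>] unfolding C_def by (rule asymp_equiv_imp_bigtheta)
    also have "(\<lambda>\<sigma>. C * a_sigma \<sigma>) \<in> \<Theta>[at_right 0](\<lambda>\<sigma>. \<gamma> * \<sigma> powr (- 2))"
      unfolding a_sigma_def using C \<gamma> by real_asymp
    finally show ?thesis .
  qed
  show ?thesis using 1 2 3(1,2) 4 5 6 by blast
qed

end
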